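(* Let $g\in C^3_b(\mathbb{R}^d,\mathcal{L}(\mathbb{R}^m,\mathbb{R}^d))$ and let $\mathbf{x}=(x,\mathbb{X})$ be a $\nu$-Hölder rough path on $[a,b]$ over $\mathbb{R}^m$. For $y_a\in\mathbb{R}^d$ let $y_t=y_t(\mathbf{x},y_a)$, $t\in[a,b]$, be the solution of $dy_t=g(y_t)\,dx_t$ with initial value $y_a$. Then $y_t(\mathbf{x},y_a)$ is differentiable with respect to the initial condition $y_a$; moreover, its derivative $\frac{\partial y_t}{\partial y_a}(\mathbf{x},y_a)$ is the matrix solution of the linearized rough differential equation $$d\xi_t=Dg(y_t)\xi_t\,dx_t,\qquad t\in[a,b],$$ with initial value $\xi_a$ equal to the identity matrix.
   Context: Parameters: $\frac13<\alpha<\nu<\frac12$. Write $y_{s,t}=y_t-y_s$. $C^3_b$ means three times continuously differentiable with $g$ and its derivatives up to order 3 bounded. $C^\alpha(I,W)$ is the space of $\alpha$-Hölder paths on the compact interval $I$, and $C^{2\alpha}(I^2,W)$ the continuous two-parameter functions with $\sup_{s<t}\|R_{s,t}\|/|t-s|^{2\alpha}<\infty$. Rough path: a $\nu$-Hölder rough path on $I$ over $\mathbb{R}^m$ is $\mathbf{x}=(x,\mathbb{X})$ with $x\in C^\nu(I,\mathbb{R}^m)$, $\mathbb{X}\in C^{2\nu}(I^2,\mathbb{R}^m\otimes\mathbb{R}^m)$ and $\mathbb{X}_{s,t}-\mathbb{X}_{s,u}-\mathbb{X}_{u,t}=x_{s,u}\otimes x_{u,t}$ for $s\le u\le t$. Controlled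 paths: $(y,y')\in\mathcal{D}^{2\alpha}_x(I)$ with values in $W$ means $y\in C^\alpha(I,W)$, $y'\in C^\alpha(I,\mathcal{L}(\mathbb{R}^m,W))$ and $y_{s,t}=y'_sx_{s,t}+R^y_{s,t}$ for $s\le t$ with $R^y\in C^{2\alpha}(I^2,W)$. For a controlled path $(Y,Y')$ with values in $\mathcal{L}(\mathbb{R}^m,\mathbb{R}^d)$ the Gubinelli rough integral is $\int_s^tY_u\,dx_u=\lim_{|\Pi|\to0}\sum_{[u,v]\in\Pi}\big(Y_ux_{u,v}+Y'_u\mathbb{X}_{u,v}\big)$ over finite partitions $\Pi$ of $[s,t]$, where $A\in\mathcal{L}(\mathbb{R}^m,\mathcal{L}(\mathbb{R}^m,\mathbb{R}^d))$ acts on $\mathbb{R}^m\otimes\mathbb{R}^m$ by $A(u\otimes v)=(Au)v$. Solution of $dy=g(y)dx$: a path $y$ with $(y,y')\in\mathcal{D}^{2\alpha}_x([a,b])$, $y'_t=g(y_t)$, initial value $y_a$, and $y_t=y_a+\int_a^tg(y_u)\,dx_u$ for all $t\in[a,b]$, where $g(y)$ has Gubinelli derivative $u\otimes v\mapsto(Dg(y_s)[g(y_s)u])v$. Existence and uniqueness of this solution is known (Gubinelli). Solution of the linearized equation: a vector solution is a path $\xi$ in $\mathbb{R}^d$ with $(\xi,\xi')\in\mathcal{D}^{2\alpha}_x([a,b])$, where $\xi'_tu=(Dg(y_t)\xi_t)u$, such that $\xi_t=\xi_a+\int_a^tDg(y_u)\xi_u\,dx_u$ for all $t\in[a,b]$;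 here $Dg(y_t)\xi_t:=Dg(y_t)[\xi_t]\in\mathcal{L}(\mathbb{R}^m,\mathbb{R}^d)$, and the integrand $Dg(y)\xi$ has Gubinelli derivative $u\otimes v\mapsto\big(D^2g(y_s)[g(y_s)u,\xi_s]+Dg(y_s)[\xi'_su]\big)v$. The matrix solution with initial value the identity is the path in $\mathbb{R}^{d\times d}$ whose columns are the vector solutions started from the standard basis vectors. *)

theory Defs
  imports "HOL-Analysis.Analysis"
begin

section \<open>Hoelder paths and two-parameter functions\<close>

definition hoelder_path :: "real \<Rightarrow> real set \<Rightarrow> (real \<Rightarrow> 'w::real_normed_vector) \<Rightarrow> bool" where
  "hoelder_path \<alpha> I y \<longleftrightarrow> (\<exists>C. \<forall>s\<in>I. \<forall>t\<in>I. norm (y t - y s) \<le> C * \<bar>t - s\<bar> powr \<alpha>)"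

definition hoelder2 :: "real \<Rightarrow> real set \<Rightarrow> (real \<Rightarrow> real \<Rightarrow> 'w::real_normed_vector) \<Rightarrow> bool" where
  "hoelder2 \<beta> I R \<longleftrightarrow>
     continuous_on (I \<times> I) (\<lambda>(s, t). R s t) \<and>
     (\<exists>C. \<forall>s\<in>I. \<forall>t\<in>I. s < t \<longrightarrow> norm (R s t) \<le> C * \<bar>t - s\<bar> powr \<beta>)"


section \<open>Second-order tensors and rough paths\<close>

text \<open>The tensor product of \<open>real ^ 'm\<close> with itself is represented by the matrices
  \<open>real ^ 'm ^ 'm\<close>, the entry \<open>M $ i $ j\<close> being the coefficient of the tensor product of the
  \<open>i\<close>-th and the \<open>j\<close>-th standard basis vector. An \<open>A\<close> in \<open>L(R^m, L(R^m, W))\<close> acts on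
  tensors by linear extension of \<open>A (u \<otimes> v) = (A u) v\<close>; see \<open>tensor_apply_tensor\<close>.\<close>

definition tensor :: "real ^ 'm \<Rightarrow> real ^ 'm \<Rightarrow> real ^ 'm ^ 'm" where
  "tensor u v = (\<chi> i j. u $ i * v $ j)"

definition tensor_apply ::
    "((real ^ 'm) \<Rightarrow>\<^sub>L ((real ^ 'm) \<Rightarrow>\<^sub>L 'w::real_normed_vector)) \<Rightarrow> real ^ 'm ^ 'm \<Rightarrow> 'w" where
  "tensor_apply A M = (\<Sum>i\<in>UNIV. \<Sum>j\<in>UNIV. M $ i $ j *\<^sub>R A (axis i 1) (axis j 1))"

lemma tensor_apply_tensor: "tensor_apply A (tensor u v) = A u v"
proof -
  have u: "u = (\<Sum>i\<in>UNIV. u $ i *\<^sub>R axis i 1)" and v: "v = (\<Sum>j\<in>UNIV. v $ j *\<^sub>R axis j 1)"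
    using basis_expansion[of u] basis_expansion[of v] by (simp_all add: scalar_mult_eq_scaleR)
  have "A u v = A (\<Sum>i\<in>UNIV. u $ i *\<^sub>R axis i 1) (\<Sum>j\<in>UNIV. v $ j *\<^sub>R axis j 1)"
    using u v by simp
  also have "\<dots> = (\<Sum>i\<in>UNIV. \<Sum>j\<in>UNIV. (u $ i * v $ j) *\<^sub>R A (axis i 1) (axis j 1))"
    by (simp add: blinfun.sum_right blinfun.sum_left blinfun.scaleR_left blinfun.scaleR_right
        scaleR_sum_right mult.commute) (rule sum.swap)
  finally show ?thesis
    by (simp add: tensor_apply_def tensor_def)
qed

definition rough_path ::
    "real \<Rightarrow> real set \<Rightarrow> (real \<Rightarrow> real ^ 'm) \<Rightarrow> (real \<Rightarrow> real \<Rightarrow> real ^ 'm ^ 'm) \<Rightarrow> bool" where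
  "rough_path \<nu> I x X \<longleftrightarrow>
     hoelder_path \<nu> I x \<and> hoelder2 (2 * \<nu>) I X \<and>
     (\<forall>s\<in>I. \<forall>u\<in>I. \<forall>t\<in>I. s \<le> u \<longrightarrow> u \<le> t \<longrightarrow>
        X s t - X s u - X u t = tensor (x u - x s) (x t - x u))"


section \<open>Controlled paths and the rough integral\<close>

definition controlled_path ::
    "real \<Rightarrow> (real \<Rightarrow> real ^ 'm) \<Rightarrow> real set \<Rightarrow> (real \<Rightarrow> 'w::real_normed_vector) \<Rightarrow>
     (real \<Rightarrow> ((real ^ 'm) \<Rightarrow>\<^sub>L 'w)) \<Rightarrow> bool" where
  "controlled_path \<alpha> x I y y' \<longleftrightarrow>
     hoelder_path \<alpha> I y \<and> hoelder_path \<alpha> I y' \<and>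
     (\<exists>R. hoelder2 (2 * \<alpha>) I R \<and>
        (\<forall>s\<in>I. \<forall>t\<in>I. s \<le> t \<longrightarrow> y t - y s = y' s (x t - x s) + R s t))"

text \<open>A finite partition of \<open>[s, t]\<close> is the strictly increasing list of its points; its
  intervals are the pairs of consecutive points.\<close>

definition partition_of :: "real \<Rightarrow> real \<Rightarrow> real list \<Rightarrow> bool" where
  "partition_of s t p \<longleftrightarrow> p \<noteq> [] \<and> sorted_wrt (<) p \<and> hd p = s \<and> last p = t"

definition intervals :: "real list \<Rightarrow> (real \<times> real) list" where
  "intervals p = zip p (tl p)"

definition mesh_to_0 :: "real \<Rightarrow> real \<Rightarrow> real list filter" where
  "mesh_to_0 s t =
     (INF \<delta>\<in>{0<..}. principal {p. partition_of s t p \<and> (\<forall>(u, v)\<in>set (intervals p). v - u < \<delta>)})"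

definition has_rough_integral ::
    "(real \<Rightarrow> real ^ 'm) \<Rightarrow> (real \<Rightarrow> real \<Rightarrow> real ^ 'm ^ 'm) \<Rightarrow> real \<Rightarrow> real \<Rightarrow>
     (real \<Rightarrow> ((real ^ 'm) \<Rightarrow>\<^sub>L 'w::real_normed_vector)) \<Rightarrow>
     (real \<Rightarrow> ((real ^ 'm) \<Rightarrow>\<^sub>L ((real ^ 'm) \<Rightarrow>\<^sub>L 'w))) \<Rightarrow> 'w \<Rightarrow> bool" where
  "has_rough_integral x X s t Y Y' J \<longleftrightarrow>
     ((\<lambda>p. \<Sum>(u, v)\<leftarrow>intervals p. Y u (x v - x u) + tensor_apply (Y' u) (X u v)) \<longlongrightarrow> J)
       (mesh_to_0 s t)"


section \<open>Derivatives and coefficient fields\<close>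

definition fderiv ::
    "('a::real_normed_vector \<Rightarrow> 'b::real_normed_vector) \<Rightarrow> 'a \<Rightarrow> ('a \<Rightarrow>\<^sub>L 'b)" where
  "fderiv f z = Blinfun (frechet_derivative f (at z))"

lemma fderiv_works:
  "f differentiable (at z) \<longleftrightarrow> (f has_derivative blinfun_apply (fderiv f z)) (at z)"
proof
  assume "f differentiable (at z)"
  then have "(f has_derivative frechet_derivative f (at z)) (at z)"
    by (simp add: frechet_derivative_works)
  moreover from this have "bounded_linear (frechet_derivative f (at z))"
    by (rule has_derivative_bounded_linear)
  ultimately show "(f has_derivative blinfun_apply (fderiv f z)) (at z)"
    by (simp add: fderiv_def bounded_linear_Blinfun_apply)
qed (auto simp: differentiable_def)

definition C3b :: "('a::real_normed_vector \<Rightarrow> 'b::real_normed_vector) \<Rightarrow> bool" where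
  "C3b f \<longleftrightarrow>
     f differentiable_on UNIV \<and>
     fderiv f differentiable_on UNIV \<and>
     fderiv (fderiv f) differentiable_on UNIV \<and>
     continuous_on UNIV (fderiv (fderiv (fderiv f))) \<and>
     bounded (range f) \<and>
     bounded (range (fderiv f)) \<and>
     bounded (range (fderiv (fderiv f))) \<and>
     bounded (range (fderiv (fderiv (fderiv f))))"


section \<open>The rough differential equation and its linearization\<close>

text \<open>The equation \<open>z t = z a + J\<close>, where \<open>J\<close> is the rough integral from \<open>a\<close> to \<open>t\<close>, is written
  by saying that \<open>z t - z a\<close> is the rough integral. The composition \<open>fderiv g (y u) o\<^sub>L g (y u)\<close>
  is the map sending \<open>h\<close> to \<open>Dg (y u) [g (y u) h]\<close>.\<close>

definition rde_solution ::
    "real \<Rightarrow> (real ^ 'd \<Rightarrow> ((real ^ 'm) \<Rightarrow>\<^sub>L (real ^ 'd))) \<Rightarrow>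
     (real \<Rightarrow> real ^ 'm) \<Rightarrow> (real \<Rightarrow> real \<Rightarrow> real ^ 'm ^ 'm) \<Rightarrow> real \<Rightarrow> real \<Rightarrow>
     real ^ 'd \<Rightarrow> (real \<Rightarrow> real ^ 'd) \<Rightarrow> bool" where
  "rde_solution \<alpha> g x X a b y0 y \<longleftrightarrow>
     controlled_path \<alpha> x {a..b} y (\<lambda>t. g (y t)) \<and>
     y a = y0 \<and>
     (\<forall>t\<in>{a..b}. has_rough_integral x X a t
        (\<lambda>u. g (y u)) (\<lambda>u. fderiv g (y u) o\<^sub>L g (y u)) (y t - y a))"

text \<open>The Gubinelli derivative of the integrand \<open>Dg(y) \<xi>\<close>, for values \<open>z = y s\<close>, \<open>w = \<xi> s\<close> and
  \<open>w' = \<xi>' s\<close>; the lemma below shows that \<open>Blinfun\<close> is applied to a bounded linear map.\<close>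

definition lin_integrand_deriv ::
    "(real ^ 'd \<Rightarrow> ((real ^ 'm) \<Rightarrow>\<^sub>L (real ^ 'd))) \<Rightarrow> real ^ 'd \<Rightarrow> real ^ 'd \<Rightarrow>
     ((real ^ 'm) \<Rightarrow>\<^sub>L (real ^ 'd)) \<Rightarrow> ((real ^ 'm) \<Rightarrow>\<^sub>L ((real ^ 'm) \<Rightarrow>\<^sub>L (real ^ 'd)))" where
  "lin_integrand_deriv g z w w' =
     Blinfun (\<lambda>u. fderiv (fderiv g) z (g z u) w + fderiv g z (w' u))"

lemma lin_integrand_deriv_apply:
  "lin_integrand_deriv g z w w' u = fderiv (fderiv g) z (g z u) w + fderiv g z (w' u)"
proof -
  have "bounded_linear (\<lambda>u. fderiv (fderiv g) z (g z u) w + fderiv g z (w' u))"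
    by (intro bounded_linear_intros)
  then show ?thesis
    by (simp add: lin_integrand_deriv_def bounded_linear_Blinfun_apply)
qed

definition lin_rde_solution ::
    "real \<Rightarrow> (real ^ 'd \<Rightarrow> ((real ^ 'm) \<Rightarrow>\<^sub>L (real ^ 'd))) \<Rightarrow>
     (real \<Rightarrow> real ^ 'm) \<Rightarrow> (real \<Rightarrow> real \<Rightarrow> real ^ 'm ^ 'm) \<Rightarrow> real \<Rightarrow> real \<Rightarrow>
     (real \<Rightarrow> real ^ 'd) \<Rightarrow> real ^ 'd \<Rightarrow> (real \<Rightarrow> real ^ 'd) \<Rightarrow> bool" where
  "lin_rde_solution \<alpha> g x X a b y \<xi>0 \<xi> \<longleftrightarrow>
     controlled_path \<alpha> x {a..b} \<xi> (\<lambda>t. fderiv g (y t) (\<xi> t)) \<and>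
     \<xi> a = \<xi>0 \<and>
     (\<forall>t\<in>{a..b}. has_rough_integral x X a t
        (\<lambda>u. fderiv g (y u) (\<xi> u))
        (\<lambda>u. lin_integrand_deriv g (y u) (\<xi> u) (fderiv g (y u) (\<xi> u)))
        (\<xi> t - \<xi> a))"

definition matrix_lin_rde_solution ::
    "real \<Rightarrow> (real ^ 'd \<Rightarrow> ((real ^ 'm) \<Rightarrow>\<^sub>L (real ^ 'd))) \<Rightarrow>
     (real \<Rightarrow> real ^ 'm) \<Rightarrow> (real \<Rightarrow> real \<Rightarrow> real ^ 'm ^ 'm) \<Rightarrow> real \<Rightarrow> real \<Rightarrow>
     (real \<Rightarrow> real ^ 'd) \<Rightarrow> (real \<Rightarrow> real ^ 'd ^ 'd) \<Rightarrow> bool" where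
  "matrix_lin_rde_solution \<alpha> g x X a b y \<Xi> \<longleftrightarrow>
     (\<forall>j. lin_rde_solution \<alpha> g x X a b y (axis j 1) (\<lambda>t. column j (\<Xi> t)))"

end

theory Submission
  imports Defs
begin

text \<open>
Write \<open>x\<^sub>s\<^sub>t\<close> for an increment and consider the one-step map \<open>z \<mapsto> z + f\<^sub>s\<^sub>t(z)\<close> of the second-order
Euler scheme, \<open>f\<^sub>s\<^sub>t(z) = g(z) x\<^sub>s\<^sub>t + (Dg(z) g(z)) X\<^sub>s\<^sub>t\<close>. By sewing, a solution \<open>y\<close> of the rough
equation satisfies \<open>y\<^sub>t - y\<^sub>s - f\<^sub>s\<^sub>t(y\<^sub>s) = O(\<bar>t - s\<bar>\<^sup>3\<^sup>\<alpha>)\<close>, and \<open>\<xi>\<close> solves the linearized equation if and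
only if \<open>\<xi>\<^sub>t - \<xi>\<^sub>s - Df\<^sub>s\<^sub>t(y\<^sub>s) \<xi>\<^sub>s = O(\<bar>t - s\<bar>\<^sup>3\<^sup>\<alpha>)\<close>: the Gubinelli derivative of the linearized
integrand is exactly the derivative of \<open>Dg g\<close> in the direction \<open>\<xi>\<close>, up to the symmetry of \<open>D\<^sup>2g\<close>.
After this translation the integrals are gone. What remains is a statement about
differences of one-step maps. Besides their smoothness in \<open>z\<close>, what matters is that two consecutive steps
and one long step differ by \<open>O(\<bar>t - s\<bar>\<^sup>3\<^sup>\<alpha>)\<close>, both in value and in Lipschitz constant (the locale
\<open>almost_flow\<close>). Chen's relation and the three derivatives of \<open>g\<close> are spent on this fact.

The engine is that \<open>3\<alpha> > 1\<close>, so that cutting an interval at its midpoint divides \<open>\<bar>t - s\<bar>\<^sup>3\<^sup>\<alpha>\<close> by more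
than two. Hence a remainder that is bounded by the remainders over the two halves plus
\<open>B \<bar>t - s\<bar>\<^sup>3\<^sup>\<alpha>\<close>, and for which some constant is known, has a bound that depends on \<open>B\<close> only
(\<open>midpoint_absorption\<close>). Applied to one solution and to the difference of two, this gives remainder
bounds that are uniform in the initial value and a Lipschitz flow (\<open>local_lipschitz\<close>,
\<open>global_lipschitz\<close>).

For differentiability let \<open>\<eta>\<^sup>k\<close> be the solution started from \<open>z + k\<close> minus the one started from \<open>z\<close>. A Taylor
expansion of \<open>f\<^sub>s\<^sub>t\<close> shows that \<open>\<eta>\<^sup>k\<close> satisfies the linearized expansion with error
\<open>O(\<bar>k\<bar> \<bar>t - s\<bar>\<^sup>3\<^sup>\<alpha> + \<bar>k\<bar>\<^sup>2 \<bar>t - s\<bar>\<^sup>\<alpha>)\<close>. The second term is not summable along partitions, but \<open>n\<close>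
halvings only cost it a factor \<open>3\<^sup>n\<close> while the first term gains a factor \<open>\<rho>\<^sup>n\<close> with \<open>\<rho> < 1\<close>. So a path
that vanishes at \<open>a\<close> and satisfies the linearized expansion up to
\<open>M \<bar>t - s\<bar>\<^sup>3\<^sup>\<alpha> + \<epsilon> \<bar>t - s\<bar>\<^sup>\<alpha>\<close> is bounded by a constant times \<open>\<rho>\<^sup>n M + 3\<^sup>n \<epsilon>\<close>, for every \<open>n\<close>
(\<open>variation_stability\<close>). Comparing \<open>\<eta>\<^sup>k\<close> with the linear combination of the quotients \<open>\<eta>\<^sup>\<tau>\<^sup>i / \<tau>\<close> over basis
vectors \<open>i\<close> that has the same value at \<open>a\<close>, and choosing first \<open>n\<close> and then \<open>\<tau>\<close>, shows that
\<open>k \<mapsto> \<eta>\<^sup>k\<close> at time \<open>t\<close> is as close to linear as desired, hence differentiable (\<open>flow_differentiable\<close>). In the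
limit of the difference quotients the term of order \<open>\<bar>k\<bar>\<^sup>2\<close> disappears, so the derivative solves the
linearized equation, which also shows that this equation is solvable. Its
uniqueness is the stability estimate with \<open>\<epsilon> = 0\<close>.
\<close>

section \<open>Differential calculus with bounded and Lipschitz derivatives\<close>

lemma mean_value_bound:
  fixes \<phi> :: "'a::real_normed_vector \<Rightarrow> 'b::real_normed_vector"
  assumes deriv: "\<And>z. (\<phi> has_derivative \<phi>' z) (at z)"
    and bound: "\<And>z h. norm (\<phi>' z h) \<le> B * norm h" and "0 \<le> B"
  shows "norm (\<phi> z - \<phi> w) \<le> B * norm (z - w)"
proof (rule differentiable_bound[of UNIV \<phi> \<phi>'])
  show "onorm (\<phi>' z) \<le> B" for z
    using \<open>0 \<le> B\<close> bound[of z] by (rule onorm_bound)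
qed (use deriv in auto)

lemma taylor_bound:
  fixes \<phi> :: "'a::real_normed_vector \<Rightarrow> 'b::real_normed_vector"
  assumes deriv: "\<And>z. (\<phi> has_derivative \<phi>' z) (at z)"
    and lip: "\<And>z w h. norm (\<phi>' z h - \<phi>' w h) \<le> B * norm (z - w) * norm h"
    and "0 \<le> B"
  shows "norm (\<phi> (z + k) - \<phi> z - \<phi>' z k) \<le> B * (norm k)\<^sup>2"
proof -
  have lin: "bounded_linear (\<phi>' z)"
    using deriv by (rule has_derivative_bounded_linear)
  have "norm ((\<phi> (z + k) - \<phi>' z (z + k)) - (\<phi> z - \<phi>' z z)) \<le> B * norm k * norm (z + k - z)"
  proof (rule differentiable_bound[of "cball z (norm k)" "\<lambda>v. \<phi> v - \<phi>' z v" "\<lambda>v h. \<phi>' v h - \<phi>' z h"])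
    show "((\<lambda>v. \<phi> v - \<phi>' z v) has_derivative (\<lambda>h. \<phi>' v h - \<phi>' z h)) (at v within cball z (norm k))"
      for v
      by (intro has_derivative_diff bounded_linear.has_derivative[OF lin]
          has_derivative_at_withinI[OF deriv] has_derivative_ident)
    show "onorm (\<lambda>h. \<phi>' v h - \<phi>' z h) \<le> B * norm k" if "v \<in> cball z (norm k)" for v
    proof (rule onorm_bound)
      show "0 \<le> B * norm k"
        using \<open>0 \<le> B\<close> by simp
      fix h :: 'a
      have "B * norm (v - z) * norm h \<le> B * norm k * norm h"
        using that \<open>0 \<le> B\<close> by (intro mult_right_mono mult_left_mono) (auto simp: dist_norm norm_minus_commute)
      then show "norm (\<phi>' v h - \<phi>' z h) \<le> B * norm k * norm h"
        using lip[of v h z] by linarith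
    qed
  qed (auto simp: dist_norm)
  then show ?thesis
    using linear_add[OF bounded_linear.linear[OF lin], of z k]
    by (simp add: power2_eq_square algebra_simps)
qed

text \<open>Splitting off the shift \<open>v - v'\<close> leaves the increment of \<open>z \<mapsto> \<phi> (z + v) - \<phi> z\<close>, whose derivative is small
by the Lipschitz property of \<open>\<phi>'\<close>. This is how differences of two solutions are compared after one step.\<close>

lemma four_point_bound:
  fixes \<phi> :: "'a::real_normed_vector \<Rightarrow> 'b::real_normed_vector"
  assumes deriv: "\<And>z. (\<phi> has_derivative \<phi>' z) (at z)"
    and bound: "\<And>z h. norm (\<phi>' z h) \<le> B * norm h"
    and lip: "\<And>z w h. norm (\<phi>' z h - \<phi>' w h) \<le> B * norm (z - w) * norm h"
    and "0 \<le> B"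
  shows "norm ((\<phi> (z + v) - \<phi> z) - (\<phi> (w + v') - \<phi> w)) \<le> B * (norm v * norm (z - w) + norm (v - v'))"
proof -
  have "norm ((\<phi> (z + v) - \<phi> z) - (\<phi> (w + v) - \<phi> w)) \<le> B * norm v * norm (z - w)"
  proof (rule mean_value_bound[of "\<lambda>z. \<phi> (z + v) - \<phi> z" "\<lambda>z h. \<phi>' (z + v) h - \<phi>' z h"])
    show "((\<lambda>z. \<phi> (z + v) - \<phi> z) has_derivative (\<lambda>h. \<phi>' (z + v) h - \<phi>' z h)) (at z)" for z
      by (intro has_derivative_diff deriv has_derivative_compose[OF _ deriv, of "\<lambda>z. z + v" "\<lambda>h. h"])
        (auto intro!: derivative_eq_intros)
    show "norm (\<phi>' (z + v) h - \<phi>' z h) \<le> B * norm v * norm h" for z h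
      using lip[of "z + v" h z] by simp
  qed (use \<open>0 \<le> B\<close> in simp)
  moreover have "norm (\<phi> (w + v) - \<phi> (w + v')) \<le> B * norm (v - v')"
    using mean_value_bound[OF deriv bound \<open>0 \<le> B\<close>, of "w + v" "w + v'"] by simp
  moreover have "(\<phi> (z + v) - \<phi> z) - (\<phi> (w + v') - \<phi> w) =
      ((\<phi> (z + v) - \<phi> z) - (\<phi> (w + v) - \<phi> w)) + (\<phi> (w + v) - \<phi> (w + v'))"
    by simp
  ultimately show ?thesis
    using norm_triangle_ineq[of "(\<phi> (z + v) - \<phi> z) - (\<phi> (w + v) - \<phi> w)" "\<phi> (w + v) - \<phi> (w + v')"]
    by (simp add: algebra_simps)
qed

lemma has_derivative_tendsto_quotient:
  fixes \<phi> :: "'a::real_normed_vector \<Rightarrow> 'b::real_normed_vector"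
  assumes deriv: "(\<phi> has_derivative \<phi>') (at z)"
  shows "((\<lambda>\<tau>. (\<phi> (z + \<tau> *\<^sub>R h) - \<phi> z) /\<^sub>R \<tau>) \<longlongrightarrow> \<phi>' h) (at 0)"
proof -
  have lin: "linear \<phi>'"
    using deriv by (rule has_derivative_linear)
  have "((\<lambda>\<tau>. \<phi> (z + \<tau> *\<^sub>R h)) has_derivative (\<lambda>\<tau>. \<phi>' (\<tau> *\<^sub>R h))) (at 0)"
    by (rule has_derivative_compose[of "\<lambda>\<tau>. z + \<tau> *\<^sub>R h" "\<lambda>\<tau>. \<tau> *\<^sub>R h" 0 UNIV \<phi> \<phi>'])
      (use deriv in \<open>auto intro!: derivative_eq_intros\<close>)
  then have "((\<lambda>\<tau>. norm (\<phi> (z + \<tau> *\<^sub>R h) - \<phi> z - \<tau> *\<^sub>R \<phi>' h) / norm \<tau>) \<longlongrightarrow> 0) (at 0)"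
    by (simp add: has_derivative_at linear_scale[OF lin])
  then have "((\<lambda>\<tau>. norm ((\<phi> (z + \<tau> *\<^sub>R h) - \<phi> z) /\<^sub>R \<tau> - \<phi>' h)) \<longlongrightarrow> 0) (at 0)"
  proof (rule Lim_transform_eventually)
    have "norm (\<phi> (z + \<tau> *\<^sub>R h) - \<phi> z - \<tau> *\<^sub>R \<phi>' h) / norm \<tau> =
        norm ((\<phi> (z + \<tau> *\<^sub>R h) - \<phi> z) /\<^sub>R \<tau> - \<phi>' h)" if "\<tau> \<noteq> 0" for \<tau> :: real
    proof -
      have "(\<phi> (z + \<tau> *\<^sub>R h) - \<phi> z) /\<^sub>R \<tau> - \<phi>' h = (\<phi> (z + \<tau> *\<^sub>R h) - \<phi> z - \<tau> *\<^sub>R \<phi>' h) /\<^sub>R \<tau>"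
        using that by (simp add: scaleR_diff_right)
      then show ?thesis
        by (simp add: divide_inverse_commute)
    qed
    then show "\<forall>\<^sub>F \<tau> in at 0. norm (\<phi> (z + \<tau> *\<^sub>R h) - \<phi> z - \<tau> *\<^sub>R \<phi>' h) / norm \<tau> =
        norm ((\<phi> (z + \<tau> *\<^sub>R h) - \<phi> z) /\<^sub>R \<tau> - \<phi>' h)"
      by (simp add: eventually_at_filter)
  qed
  then show ?thesis
    by (simp add: LIM_zero_iff tendsto_norm_zero_iff)
qed

lemma derivative_bound_of_lipschitz:
  fixes \<phi> :: "'a::real_normed_vector \<Rightarrow> 'b::real_normed_vector"
  assumes deriv: "(\<phi> has_derivative \<phi>') (at z)"
    and lip: "\<And>w. norm (\<phi> w - \<phi> z) \<le> B * norm (w - z)"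
  shows "norm (\<phi>' h) \<le> B * norm h"
proof (rule tendsto_upperbound)
  show "((\<lambda>\<tau>. norm ((\<phi> (z + \<tau> *\<^sub>R h) - \<phi> z) /\<^sub>R \<tau>)) \<longlongrightarrow> norm (\<phi>' h)) (at 0)"
    by (intro tendsto_norm has_derivative_tendsto_quotient deriv)
  have "norm ((\<phi> (z + \<tau> *\<^sub>R h) - \<phi> z) /\<^sub>R \<tau>) \<le> B * norm h" if "\<tau> \<noteq> 0" for \<tau>
  proof -
    have "norm (\<phi> (z + \<tau> *\<^sub>R h) - \<phi> z) / \<bar>\<tau>\<bar> \<le> B * norm h"
      using lip[of "z + \<tau> *\<^sub>R h"] that by (simp add: pos_divide_le_eq mult_ac)
    then show ?thesis
      by (simp add: divide_inverse_commute)
  qed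
  then show "\<forall>\<^sub>F \<tau> in at 0. norm ((\<phi> (z + \<tau> *\<^sub>R h) - \<phi> z) /\<^sub>R \<tau>) \<le> B * norm h"
    by (simp add: eventually_at_filter)
qed simp

text \<open>A function is differentiable as soon as it is, for every \<open>\<epsilon>\<close>, within \<open>\<epsilon> \<bar>k\<bar>\<close> of some linear map of the
increment \<open>k\<close>: two such maps are close to each other because both are close to the same increment of \<open>\<phi>\<close> and
linear maps are determined by small vectors, so the maps form a Cauchy sequence, and its limit is the
derivative.\<close>

lemma differentiable_of_approx_linear:
  fixes \<phi> :: "'a::real_normed_vector \<Rightarrow> 'b::banach"
  assumes approx: "\<And>\<epsilon>. 0 < \<epsilon> \<Longrightarrow> \<exists>W r. bounded_linear W \<and> 0 < r \<and>
      (\<forall>k. norm k < r \<longrightarrow> norm (\<phi> (z + k) - \<phi> z - W k) \<le> \<epsilon> * norm k)"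
  shows "\<phi> differentiable (at z)"
proof -
  have "\<exists>W r. \<forall>n. 0 < r n \<and>
      (\<forall>k. norm k < r n \<longrightarrow> norm (\<phi> (z + k) - \<phi> z - blinfun_apply (W n) k) \<le> inverse (real (Suc n)) * norm k)"
  proof -
    have "\<forall>n. \<exists>W r. 0 < r \<and>
      (\<forall>k. norm k < r \<longrightarrow> norm (\<phi> (z + k) - \<phi> z - blinfun_apply W k) \<le> inverse (real (Suc n)) * norm k)"
    proof
      fix n
      obtain W r where "bounded_linear W" "0 < r"
        "\<forall>k. norm k < r \<longrightarrow> norm (\<phi> (z + k) - \<phi> z - W k) \<le> inverse (real (Suc n)) * norm k"
        using approx[of "inverse (real (Suc n))"] by auto
      then show "\<exists>W r. 0 < r \<and>
        (\<forall>k. norm k < r \<longrightarrow> norm (\<phi> (z + k) - \<phi> z - blinfun_apply W k) \<le> inverse (real (Suc n)) * norm k)"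
        by (intro exI[of _ "Blinfun W"] exI[of _ r]) (simp add: bounded_linear_Blinfun_apply)
    qed
    then show ?thesis by metis
  qed
  then obtain W :: "nat \<Rightarrow> 'a \<Rightarrow>\<^sub>L 'b" and r where r: "\<And>n. 0 < r n"
    and W: "\<And>n k. norm k < r n \<Longrightarrow> norm (\<phi> (z + k) - \<phi> z - W n k) \<le> inverse (real (Suc n)) * norm k"
    by blast
  have close: "norm (W n - W m) \<le> inverse (real (Suc n)) + inverse (real (Suc m))" for n m
  proof (rule norm_blinfun_bound)
    fix v :: 'a
    show "norm ((W n - W m) v) \<le> (inverse (real (Suc n)) + inverse (real (Suc m))) * norm v"
    proof (cases "v = 0")
      case False
      define c where "c = min (r n) (r m) / (2 * norm v)"
      have c: "0 < c" "norm (c *\<^sub>R v) < r n" "norm (c *\<^sub>R v) < r m"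
        using r[of n] r[of m] False by (auto simp: c_def field_simps min_def)
      have "norm ((W n - W m) (c *\<^sub>R v)) \<le> inverse (real (Suc n)) * norm (c *\<^sub>R v) + inverse (real (Suc m)) * norm (c *\<^sub>R v)"
        using W[OF c(2)] W[OF c(3)]
          norm_triangle_ineq4[of "\<phi> (z + c *\<^sub>R v) - \<phi> z - W m (c *\<^sub>R v)" "\<phi> (z + c *\<^sub>R v) - \<phi> z - W n (c *\<^sub>R v)"]
        by (simp add: blinfun.diff_left)
      then have "c * norm ((W n - W m) v) \<le> c * ((inverse (real (Suc n)) + inverse (real (Suc m))) * norm v)"
        using c(1) by (simp add: blinfun.scaleR_right algebra_simps)
      then show ?thesis
        using c(1) by (simp only: mult_le_cancel_left_pos)
    qed simp
  qed simp
  have "Cauchy W"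
  proof (rule metric_CauchyI)
    fix e :: real assume "0 < e"
    then obtain N where N: "inverse (real (Suc N)) < e / 2"
      using reals_Archimedean[of "e / 2"] by auto
    have "dist (W m) (W n) < e" if "N \<le> m" "N \<le> n" for m n
    proof -
      have "inverse (real (Suc m)) \<le> inverse (real (Suc N))" "inverse (real (Suc n)) \<le> inverse (real (Suc N))"
        using that by (auto intro!: le_imp_inverse_le)
      then show ?thesis
        unfolding dist_norm using close[of m n] N by linarith
    qed
    then show "\<exists>M. \<forall>m\<ge>M. \<forall>n\<ge>M. dist (W m) (W n) < e" by blast
  qed
  then obtain D where D: "W \<longlonglongrightarrow> D"
    using Cauchy_convergent_iff convergent_def by blast
  have WD: "norm (W n - D) \<le> inverse (real (Suc n))" for n
  proof (rule tendsto_le)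
    show "(\<lambda>m. norm (W n - W m)) \<longlonglongrightarrow> norm (W n - D)"
      by (intro tendsto_intros D)
    show "(\<lambda>m. inverse (real (Suc n)) + inverse (real (Suc m))) \<longlonglongrightarrow> inverse (real (Suc n))"
      using tendsto_add[OF tendsto_const LIMSEQ_inverse_real_of_nat, of "inverse (real (Suc n))"] by simp
  qed (use close in auto)
  have "(\<phi> has_derivative D) (at z)"
    unfolding has_derivative_at_alt
  proof (intro conjI allI impI)
    fix e :: real assume "0 < e"
    then obtain n where n: "inverse (real (Suc n)) < e / 2"
      using reals_Archimedean[of "e / 2"] by auto
    have "norm (\<phi> w - \<phi> z - D (w - z)) \<le> e * norm (w - z)" if "norm (w - z) < r n" for w
    proof -
      have "norm (\<phi> w - \<phi> z - D (w - z)) \<le>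
          norm (\<phi> w - \<phi> z - W n (w - z)) + norm ((W n - D) (w - z))"
        using norm_triangle_ineq[of "\<phi> w - \<phi> z - W n (w - z)" "(W n - D) (w - z)"]
        by (simp add: blinfun.diff_left)
      also have "\<dots> \<le> inverse (real (Suc n)) * norm (w - z) + inverse (real (Suc n)) * norm (w - z)"
        using W[OF that] norm_blinfun[of "W n - D" "w - z"] mult_right_mono[OF WD[of n] norm_ge_zero, of "w - z"]
        unfolding add_diff_cancel_left' diff_add_cancel add.commute[of z "w - z"] by linarith
      also have "\<dots> \<le> e * norm (w - z)"
        unfolding distrib_right[symmetric] using n by (intro mult_right_mono norm_ge_zero) linarith
      finally show ?thesis .
    qed
    then show "\<exists>d>0. \<forall>y. norm (y - z) < d \<longrightarrow> norm (\<phi> y - \<phi> z - D (y - z)) \<le> e * norm (y - z)"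
      using r[of n] by blast
  qed (rule blinfun.bounded_linear_right)
  then show ?thesis
    by (auto simp: differentiable_def)
qed

text \<open>Both \<open>\<phi>2 z u v\<close> and \<open>\<phi>2 z v u\<close> are the leading term of the second difference \<open>\<Delta> u v\<close>, which is symmetric;
the errors are of third order, so they vanish after scaling by \<open>\<tau>\<close>.\<close>

lemma second_derivative_symmetric:
  fixes \<phi> :: "'a::real_normed_vector \<Rightarrow> 'b::real_normed_vector"
    and \<phi>1 :: "'a \<Rightarrow> 'a \<Rightarrow>\<^sub>L 'b" and \<phi>2 :: "'a \<Rightarrow> 'a \<Rightarrow>\<^sub>L 'a \<Rightarrow>\<^sub>L 'b"
  assumes d1: "\<And>z. (\<phi> has_derivative \<phi>1 z) (at z)"
    and d2: "\<And>z. (\<phi>1 has_derivative \<phi>2 z) (at z)"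
    and lip: "\<And>z w. norm (\<phi>2 z - \<phi>2 w) \<le> B * norm (z - w)"
    and "0 \<le> B"
  shows "\<phi>2 z u v = \<phi>2 z v u"
proof -
  define \<Delta> where "\<Delta> u v = \<phi> (z + u + v) - \<phi> (z + u) - \<phi> (z + v) + \<phi> z" for u v
  have lip2: "norm (\<phi>1 (w + v) h - \<phi>1 w h - \<phi>2 z v h) \<le> (B * (norm v)\<^sup>2 + B * norm (w - z) * norm v) * norm h"
    for w v h
  proof -
    have "norm (\<phi>1 (w + v) - \<phi>1 w - \<phi>2 w v) \<le> B * (norm v)\<^sup>2"
    proof (rule taylor_bound[OF d2 _ \<open>0 \<le> B\<close>])
      show "norm (\<phi>2 z h - \<phi>2 w h) \<le> B * norm (z - w) * norm h" for z w h
        using norm_blinfun[of "\<phi>2 z - \<phi>2 w" h] mult_right_mono[OF lip[of z w], of "norm h"]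
        by (simp add: blinfun.diff_left)
    qed
    moreover have "norm (\<phi>2 w v - \<phi>2 z v) \<le> B * norm (w - z) * norm v"
      using norm_blinfun[of "\<phi>2 w - \<phi>2 z" v] mult_right_mono[OF lip[of w z], of "norm v"]
      by (simp add: blinfun.diff_left)
    ultimately have "norm (\<phi>1 (w + v) - \<phi>1 w - \<phi>2 z v) \<le> B * (norm v)\<^sup>2 + B * norm (w - z) * norm v"
      using norm_triangle_ineq[of "\<phi>1 (w + v) - \<phi>1 w - \<phi>2 w v" "\<phi>2 w v - \<phi>2 z v"] by simp
    from order_trans[OF norm_blinfun mult_right_mono[OF this norm_ge_zero]] show ?thesis
      by (simp add: blinfun.diff_left)
  qed
  have \<Delta>: "norm (\<Delta> u v - \<phi>2 z v u) \<le> (B * (norm v)\<^sup>2 + B * norm u * norm v) * norm u" for u v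
  proof -
    have "norm ((\<phi> (z + u + v) - \<phi> (z + u) - \<phi>2 z v (z + u)) - (\<phi> (z + v) - \<phi> z - \<phi>2 z v z))
        \<le> (B * (norm v)\<^sup>2 + B * norm u * norm v) * norm (z + u - z)"
    proof (rule differentiable_bound[of "cball z (norm u)" "\<lambda>w. \<phi> (w + v) - \<phi> w - \<phi>2 z v w"
          "\<lambda>w h. \<phi>1 (w + v) h - \<phi>1 w h - \<phi>2 z v h"])
      show "((\<lambda>w. \<phi> (w + v) - \<phi> w - \<phi>2 z v w) has_derivative (\<lambda>h. \<phi>1 (w + v) h - \<phi>1 w h - \<phi>2 z v h))
          (at w within cball z (norm u))" for w
      proof (rule has_derivative_at_withinI, intro has_derivative_diff d1)
        show "((\<lambda>w. \<phi> (w + v)) has_derivative \<phi>1 (w + v)) (at w)"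
          by (rule has_derivative_compose[OF _ d1, of "\<lambda>z. z + v" "\<lambda>h. h"]) (auto intro!: derivative_eq_intros)
        show "(\<phi>2 z v has_derivative \<phi>2 z v) (at w)"
          by (rule bounded_linear_imp_has_derivative[OF blinfun.bounded_linear_right])
      qed
      show "onorm (\<lambda>h. \<phi>1 (w + v) h - \<phi>1 w h - \<phi>2 z v h) \<le> B * (norm v)\<^sup>2 + B * norm u * norm v"
        if "w \<in> cball z (norm u)" for w
      proof (rule onorm_bound)
        fix h :: 'a
        have "B * norm (w - z) * norm v \<le> B * norm u * norm v"
          using that \<open>0 \<le> B\<close> by (intro mult_right_mono mult_left_mono) (auto simp: dist_norm norm_minus_commute)
        then have "(B * (norm v)\<^sup>2 + B * norm (w - z) * norm v) * norm h
            \<le> (B * (norm v)\<^sup>2 + B * norm u * norm v) * norm h"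
          by (intro mult_right_mono) auto
        then show "norm (\<phi>1 (w + v) h - \<phi>1 w h - \<phi>2 z v h) \<le> (B * (norm v)\<^sup>2 + B * norm u * norm v) * norm h"
          using lip2[of w v h] by linarith
      qed (use \<open>0 \<le> B\<close> in auto)
    qed (auto simp: dist_norm)
    then show ?thesis
      by (simp add: \<Delta>_def blinfun.add_right algebra_simps)
  qed
  define K where "K = (B * (norm v)\<^sup>2 + B * norm u * norm v) * norm u + (B * (norm u)\<^sup>2 + B * norm v * norm u) * norm v"
  have *: "norm (\<phi>2 z v u - \<phi>2 z u v) \<le> \<tau> * K" if "0 < \<tau>" for \<tau> :: real
  proof -
    have "\<Delta> (\<tau> *\<^sub>R u) (\<tau> *\<^sub>R v) = \<Delta> (\<tau> *\<^sub>R v) (\<tau> *\<^sub>R u)"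
      by (simp add: \<Delta>_def add.commute add.left_commute)
    then have "norm (\<phi>2 z (\<tau> *\<^sub>R v) (\<tau> *\<^sub>R u) - \<phi>2 z (\<tau> *\<^sub>R u) (\<tau> *\<^sub>R v)) \<le> \<tau> ^ 3 * K"
      using \<Delta>[of "\<tau> *\<^sub>R u" "\<tau> *\<^sub>R v"] \<Delta>[of "\<tau> *\<^sub>R v" "\<tau> *\<^sub>R u"] that
        norm_triangle_ineq4[of "\<Delta> (\<tau> *\<^sub>R v) (\<tau> *\<^sub>R u) - \<phi>2 z (\<tau> *\<^sub>R u) (\<tau> *\<^sub>R v)" "\<Delta> (\<tau> *\<^sub>R u) (\<tau> *\<^sub>R v) - \<phi>2 z (\<tau> *\<^sub>R v) (\<tau> *\<^sub>R u)"]
      by (simp add: K_def power2_eq_square power3_eq_cube algebra_simps)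
    moreover have "\<phi>2 z (\<tau> *\<^sub>R v) (\<tau> *\<^sub>R u) - \<phi>2 z (\<tau> *\<^sub>R u) (\<tau> *\<^sub>R v) = \<tau>\<^sup>2 *\<^sub>R (\<phi>2 z v u - \<phi>2 z u v)"
      by (simp add: blinfun.scaleR_left blinfun.scaleR_right scaleR_diff_right power2_eq_square)
    ultimately have "\<tau>\<^sup>2 * norm (\<phi>2 z v u - \<phi>2 z u v) \<le> \<tau>\<^sup>2 * (\<tau> * K)"
      by (simp add: power2_eq_square power3_eq_cube)
    then show ?thesis
      using that by simp
  qed
  have "norm (\<phi>2 z v u - \<phi>2 z u v) \<le> 0"
  proof (rule tendsto_lowerbound)
    show "((\<lambda>\<tau>. \<tau> * K) \<longlongrightarrow> 0) (at_right 0)"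
      by (auto intro!: tendsto_eq_intros)
    show "\<forall>\<^sub>F \<tau> in at_right 0. norm (\<phi>2 z v u - \<phi>2 z u v) \<le> \<tau> * K"
      using * by (simp add: eventually_at_filter)
  qed simp
  then show ?thesis by simp
qed

section \<open>The midpoint argument\<close>

text \<open>The powers of the length of \<open>[s, t]\<close> with exponents \<open>\<alpha>\<close>, \<open>2\<alpha>\<close> and \<open>3\<alpha>\<close> become the first three powers of
one quantity, so that all estimates below are polynomial in it.\<close>

definition weight :: "real \<Rightarrow> real \<Rightarrow> real \<Rightarrow> real" where
  "weight \<alpha> s t = (t - s) powr \<alpha>"

lemma weight_nonneg [simp]: "0 \<le> weight \<alpha> s t"
  by (simp add: weight_def)

lemma weight_self [simp]: "weight \<alpha> s s = 0"
  by (simp add: weight_def)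

lemma weight_mono:
  "0 \<le> \<alpha> \<Longrightarrow> s \<le> s' \<Longrightarrow> s' \<le> t' \<Longrightarrow> t' \<le> t \<Longrightarrow> weight \<alpha> s' t' \<le> weight \<alpha> s t"
  by (simp add: weight_def powr_mono2)

lemma weight_midpoint:
  assumes "s \<le> t"
  shows "weight \<alpha> s ((s + t) / 2) = (1/2) powr \<alpha> * weight \<alpha> s t"
    and "weight \<alpha> ((s + t) / 2) t = (1/2) powr \<alpha> * weight \<alpha> s t"
proof -
  have "(s + t) / 2 - s = (1/2) * (t - s)" "t - (s + t) / 2 = (1/2) * (t - s)"
    by (simp_all add: field_simps)
  then show "weight \<alpha> s ((s + t) / 2) = (1/2) powr \<alpha> * weight \<alpha> s t"
    and "weight \<alpha> ((s + t) / 2) t = (1/2) powr \<alpha> * weight \<alpha> s t"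
    using assms powr_mult[of "1/2" "t - s" \<alpha>] by (simp_all only: weight_def)
qed

lemma weight_cube: "weight \<alpha> s t ^ 3 = (t - s) powr (3 * \<alpha>)"
  by (cases "t = s") (simp_all add: weight_def powr_power)

lemma weight_square: "(weight \<alpha> s t)\<^sup>2 = (t - s) powr (2 * \<alpha>)"
  by (cases "t = s") (simp_all add: weight_def powr_power)

lemma halving_cube:
  assumes "1/3 < \<alpha>"
  shows "2 * ((1/2) powr \<alpha>) ^ 3 < (1::real)"
proof -
  have "((1/2) powr \<alpha>) ^ 3 = (1/2::real) powr (3 * \<alpha>)"
    by (subst powr_power) (simp_all add: mult.commute[of \<alpha>])
  also have "\<dots> < (1/2) powr 1"
    using assms by (intro powr_less_mono') auto
  finally show ?thesis by simp
qed

text \<open>The factor \<open>2 + \<kappa>\<close> instead of \<open>2\<close> leaves room for the growth of a remainder when it is transported over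
half an interval.\<close>

lemma halving_contraction:
  assumes "1/3 < \<alpha>"
  obtains \<kappa> \<rho> :: real where "0 < \<kappa>" "\<kappa> \<le> 1" "0 < \<rho>" "\<rho> < 1" "(2 + \<kappa>) * ((1/2) powr \<alpha>) ^ 3 \<le> \<rho>"
proof
  define c :: real where "c = ((1/2) powr \<alpha>) ^ 3"
  have c: "0 < c" "2 * c < 1"
    using halving_cube[OF assms] by (simp_all add: c_def)
  show "0 < 1 - 2 * c" "1 - 2 * c \<le> 1" "0 < 1/2 + c" "1/2 + c < 1"
    using c by simp_all
  have "(2 + (1 - 2 * c)) * c \<le> 2 * c + (1 - 2 * c) * (1/2)"
    using c mult_left_mono[of c "1/2" "1 - 2 * c"] by (simp add: algebra_simps)
  also have "\<dots> = 1/2 + c"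
    by (simp add: field_simps)
  finally show "(2 + (1 - 2 * c)) * ((1/2) powr \<alpha>) ^ 3 \<le> 1/2 + c"
    by (simp add: c_def)
qed

text \<open>One application of \<open>split\<close> turns a bound \<open>c w\<^sup>3 + N w\<close>, with \<open>w\<close> the weight, into
\<open>(\<rho> c + B) w\<^sup>3 + 3 N w\<close>: the cubic part contracts towards the fixed point \<open>B / (1 - \<rho>)\<close>, while the linear
part, for which halving does not help, grows at most by the factor \<open>2 + \<kappa> \<le> 3\<close>.\<close>

lemma midpoint_iteration:
  fixes e :: "real \<Rightarrow> real \<Rightarrow> real"
  assumes "0 \<le> \<alpha>" "0 \<le> B" "0 \<le> M" "0 \<le> N" "0 \<le> \<kappa>" "\<kappa> \<le> 1"
    and contract: "(2 + \<kappa>) * ((1/2) powr \<alpha>) ^ 3 \<le> \<rho>" "\<rho> < 1"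
    and apriori: "\<And>s t. s0 \<le> s \<Longrightarrow> s \<le> t \<Longrightarrow> t \<le> t0 \<Longrightarrow>
      e s t \<le> M * weight \<alpha> s t ^ 3 + N * weight \<alpha> s t"
    and split: "\<And>s t. s0 \<le> s \<Longrightarrow> s \<le> t \<Longrightarrow> t \<le> t0 \<Longrightarrow>
      e s t \<le> e ((s + t) / 2) t + (1 + \<kappa>) * e s ((s + t) / 2) + B * weight \<alpha> s t ^ 3"
    and st: "s0 \<le> s" "s \<le> t" "t \<le> t0"
  shows "e s t \<le> (B / (1 - \<rho>) + \<rho> ^ n * M) * weight \<alpha> s t ^ 3 + 3 ^ n * N * weight \<alpha> s t"
  using st
proof (induction n arbitrary: s t)
  case 0
  have "0 \<le> B / (1 - \<rho>) * weight \<alpha> s t ^ 3"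
    using \<open>0 \<le> B\<close> contract(2) by simp
  then show ?case
    using apriori[OF 0] by (simp add: distrib_right)
next
  case (Suc n)
  define q where "q = (1/2::real) powr \<alpha>"
  define m where "m = (s + t) / 2"
  define c where "c = B / (1 - \<rho>) + \<rho> ^ n * M"
  define d where "d = weight \<alpha> s t"
  have d: "0 \<le> d" by (simp add: d_def)
  have q: "0 < q" "q \<le> 1"
    using \<open>0 \<le> \<alpha>\<close> powr_mono'[of 0 \<alpha> "1/2"] by (simp_all add: q_def)
  have "0 \<le> (2 + \<kappa>) * q ^ 3"
    using q \<open>0 \<le> \<kappa>\<close> by simp
  then have lam: "0 \<le> \<rho>"
    using contract(1) by (simp add: q_def)
  have c: "0 \<le> c"
    using assms lam by (simp add: c_def)
  have m: "s \<le> m" "m \<le> t"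
    using Suc.prems by (simp_all add: m_def)
  have weight_m: "weight \<alpha> s m = q * d" "weight \<alpha> m t = q * d"
    using weight_midpoint[OF Suc.prems(2)] by (simp_all add: q_def m_def d_def)
  have 1: "e s m \<le> c * (q * d) ^ 3 + 3 ^ n * N * (q * d)"
    using Suc.IH[of s m] Suc.prems m by (simp add: weight_m c_def)
  have 2: "e m t \<le> c * (q * d) ^ 3 + 3 ^ n * N * (q * d)"
    using Suc.IH[of m t] Suc.prems m by (simp add: weight_m c_def)
  have "e s t \<le> e m t + (1 + \<kappa>) * e s m + B * d ^ 3"
    using split[OF Suc.prems] by (simp add: m_def d_def)
  also have "\<dots> \<le> (2 + \<kappa>) * (c * (q * d) ^ 3 + 3 ^ n * N * (q * d)) + B * d ^ 3"
    using 2 mult_left_mono[OF 1, of "1 + \<kappa>"] \<open>0 \<le> \<kappa>\<close> by (simp add: algebra_simps)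
  also have "\<dots> = ((2 + \<kappa>) * q ^ 3) * (c * d ^ 3) + ((2 + \<kappa>) * q) * (3 ^ n * N * d) + B * d ^ 3"
    by (simp add: algebra_simps power_mult_distrib)
  also have "\<dots> \<le> \<rho> * (c * d ^ 3) + 3 * (3 ^ n * N * d) + B * d ^ 3"
  proof -
    have "(2 + \<kappa>) * q \<le> 3 * 1"
      using \<open>0 \<le> \<kappa>\<close> \<open>\<kappa> \<le> 1\<close> q by (intro mult_mono) auto
    then have "((2 + \<kappa>) * q) * (3 ^ n * N * d) \<le> 3 * (3 ^ n * N * d)"
      using d \<open>0 \<le> N\<close> by (intro mult_right_mono) auto
    moreover have "((2 + \<kappa>) * q ^ 3) * (c * d ^ 3) \<le> \<rho> * (c * d ^ 3)"
      using contract(1) c d by (intro mult_right_mono) (auto simp: q_def)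
    ultimately show ?thesis by linarith
  qed
  also have "\<dots> = (\<rho> * c + B) * d ^ 3 + 3 ^ Suc n * N * d"
    by (simp add: algebra_simps)
  also have "\<rho> * c + B = B / (1 - \<rho>) + \<rho> ^ Suc n * M"
    using contract(2) by (simp add: c_def field_simps)
  finally show ?case
    by (simp add: d_def)
qed

text \<open>Letting \<open>n\<close> tend to infinity removes the a priori constant \<open>M\<close>: it only has to exist. This replaces the
sewing lemma for quantities that already are known to be of order \<open>w\<^sup>3\<close>, but with an uncontrolled constant.\<close>

lemma midpoint_absorption:
  fixes e :: "real \<Rightarrow> real \<Rightarrow> real"
  assumes "0 \<le> \<alpha>" "0 \<le> B" "0 \<le> M" "0 \<le> \<kappa>" "\<kappa> \<le> 1"
    and contract: "(2 + \<kappa>) * ((1/2) powr \<alpha>) ^ 3 \<le> \<rho>" "0 < \<rho>" "\<rho> < 1"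
    and apriori: "\<And>s t. s0 \<le> s \<Longrightarrow> s \<le> t \<Longrightarrow> t \<le> t0 \<Longrightarrow> e s t \<le> M * weight \<alpha> s t ^ 3"
    and split: "\<And>s t. s0 \<le> s \<Longrightarrow> s \<le> t \<Longrightarrow> t \<le> t0 \<Longrightarrow>
      e s t \<le> e ((s + t) / 2) t + (1 + \<kappa>) * e s ((s + t) / 2) + B * weight \<alpha> s t ^ 3"
    and st: "s0 \<le> s" "s \<le> t" "t \<le> t0"
  shows "e s t \<le> B / (1 - \<rho>) * weight \<alpha> s t ^ 3"
proof (rule tendsto_lowerbound)
  have "(\<lambda>n. (B / (1 - \<rho>) + \<rho> ^ n * M) * weight \<alpha> s t ^ 3)
      \<longlonglongrightarrow> (B / (1 - \<rho>) + 0 * M) * weight \<alpha> s t ^ 3"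
    using contract by (intro tendsto_intros LIMSEQ_power_zero) auto
  then show "(\<lambda>n. (B / (1 - \<rho>) + \<rho> ^ n * M) * weight \<alpha> s t ^ 3) \<longlonglongrightarrow> B / (1 - \<rho>) * weight \<alpha> s t ^ 3"
    by simp
  show "\<forall>\<^sub>F n in sequentially. e s t \<le> (B / (1 - \<rho>) + \<rho> ^ n * M) * weight \<alpha> s t ^ 3"
  proof (rule always_eventually, rule allI)
    fix n
    show "e s t \<le> (B / (1 - \<rho>) + \<rho> ^ n * M) * weight \<alpha> s t ^ 3"
      using midpoint_iteration[OF \<open>0 \<le> \<alpha>\<close> \<open>0 \<le> B\<close> \<open>0 \<le> M\<close> order.refl \<open>0 \<le> \<kappa>\<close> \<open>\<kappa> \<le> 1\<close> contract(1,3), of s0 t0 e s t n]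
        apriori split st by simp
  qed
qed simp

text \<open>The same idea for a supremum: a bound in which half of the supremum appears on the right improves under
iteration to one without it.\<close>

lemma sup_absorption:
  fixes f :: "'i \<Rightarrow> real"
  assumes bound: "\<And>i. i \<in> I \<Longrightarrow> f i \<le> S0" and "0 \<le> S0" "0 \<le> B"
    and step: "\<And>S i. 0 \<le> S \<Longrightarrow> (\<And>j. j \<in> I \<Longrightarrow> f j \<le> S) \<Longrightarrow> i \<in> I \<Longrightarrow> f i \<le> B + S / 2"
    and i: "i \<in> I"
  shows "f i \<le> 2 * B"
proof (rule tendsto_lowerbound)
  have "(\<lambda>n. 2 * B + (1/2) ^ n * S0) \<longlonglongrightarrow> 2 * B + 0 * S0"
    by (intro tendsto_intros LIMSEQ_power_zero) auto
  then show "(\<lambda>n. 2 * B + (1/2) ^ n * S0) \<longlonglongrightarrow> 2 * B" by simp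
  have "f i \<le> 2 * B + (1/2) ^ n * S0" if "i \<in> I" for i n
    using that
  proof (induction n arbitrary: i)
    case 0
    then show ?case using bound[of i] \<open>0 \<le> B\<close> by simp
  next
    case (Suc n)
    have "f i \<le> B + (2 * B + (1/2) ^ n * S0) / 2"
      using step[of "2 * B + (1/2) ^ n * S0" i] Suc \<open>0 \<le> B\<close> \<open>0 \<le> S0\<close> by simp
    then show ?case
      by (simp add: field_simps)
  qed
  then show "\<forall>\<^sub>F n in sequentially. f i \<le> 2 * B + (1/2) ^ n * S0"
    using i by simp
qed simp

text \<open>Growth by a fixed factor over every interval of length \<open>h\<close> gives a bound on \<open>[a, b]\<close>, with a constant that
does not depend on the function.\<close>

lemma propagate_steps:
  fixes a b h A :: real
  assumes "0 < h" "1 \<le> A"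
  obtains A' where "1 \<le> A'" "\<And>(u :: real \<Rightarrow> real) (B :: real) t. 0 \<le> B \<Longrightarrow> 0 \<le> u a \<Longrightarrow> a \<le> t \<Longrightarrow> t \<le> b \<Longrightarrow>
    (\<And>s t. a \<le> s \<Longrightarrow> s \<le> t \<Longrightarrow> t \<le> b \<Longrightarrow> t - s \<le> h \<Longrightarrow> u t \<le> A * u s + B) \<Longrightarrow> u t \<le> A' * (u a + B)"
proof -
  obtain N :: nat where "(b - a) / h < N"
    using reals_Archimedean2 by blast
  then have N: "b - a \<le> N * h"
    using \<open>0 < h\<close> by (simp add: field_simps)
  have *: "u t \<le> A ^ n * (u a + n * B)"
    if B: "0 \<le> B" "0 \<le> u a" and t: "a \<le> t" "t \<le> b" "t - a \<le> n * h"
      and step: "\<And>s t. a \<le> s \<Longrightarrow> s \<le> t \<Longrightarrow> t \<le> b \<Longrightarrow> t - s \<le> h \<Longrightarrow> u t \<le> A * u s + B"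
    for u :: "real \<Rightarrow> real" and B t :: real and n :: nat
    using t
  proof (induction n arbitrary: t)
    case 0
    then show ?case by simp
  next
    case (Suc n)
    define s where "s = max a (t - h)"
    have s: "a \<le> s" "s \<le> t" "t - s \<le> h" "s - a \<le> n * h"
      using Suc.prems \<open>0 < h\<close> by (auto simp: s_def max_def algebra_simps)
    have "u t \<le> A * u s + B"
      using step[of s t] s Suc.prems by simp
    also have "\<dots> \<le> A * (A ^ n * (u a + n * B)) + A ^ Suc n * B"
    proof (intro add_mono mult_left_mono)
      show "u s \<le> A ^ n * (u a + n * B)"
        using Suc.IH[of s] s Suc.prems by simp
      show "B \<le> A ^ Suc n * B"
        using mult_right_mono[of 1 "A ^ Suc n" B] one_le_power[OF \<open>1 \<le> A\<close>, of "Suc n"] B(1) by simp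
    qed (use \<open>1 \<le> A\<close> in simp)
    also have "\<dots> = A ^ Suc n * (u a + Suc n * B)"
      by (simp add: algebra_simps)
    finally show ?case .
  qed
  show thesis
  proof (rule that[of "A ^ N * (real N + 1)"])
    show "1 \<le> A ^ N * (real N + 1)"
      using mult_mono[of 1 "A ^ N" 1 "real N + 1"] one_le_power[OF \<open>1 \<le> A\<close>, of N] by simp
    fix u :: "real \<Rightarrow> real" and B t :: real
    assume H: "0 \<le> B" "0 \<le> u a" "a \<le> t" "t \<le> b"
      and step: "\<And>s t. a \<le> s \<Longrightarrow> s \<le> t \<Longrightarrow> t \<le> b \<Longrightarrow> t - s \<le> h \<Longrightarrow> u t \<le> A * u s + B"
    have "u t \<le> A ^ N * (u a + N * B)"
      using *[of B u t N] H N step by force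
    also have "\<dots> \<le> A ^ N * ((real N + 1) * (u a + B))"
      using H \<open>1 \<le> A\<close> by (intro mult_left_mono) (auto simp: algebra_simps)
    finally show "u t \<le> A ^ N * (real N + 1) * (u a + B)"
      by (simp add: mult.assoc)
  qed
qed

section \<open>Stability of linear cocycles\<close>

lemma weight_le:
  assumes "0 < \<alpha>" "0 < \<delta>" "s \<le> t" "t - s \<le> \<delta> powr (1 / \<alpha>)"
  shows "weight \<alpha> s t \<le> \<delta>"
proof -
  have "weight \<alpha> s t \<le> (\<delta> powr (1 / \<alpha>)) powr \<alpha>"
    unfolding weight_def using assms by (intro powr_mono2) auto
  then show ?thesis
    using assms by (simp add: powr_powr)
qed

lemma cube_le_self: "0 \<le> (d::real) \<Longrightarrow> d \<le> 1 \<Longrightarrow> d ^ 3 \<le> d"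
  using power_decreasing[of 1 3 d] by simp

text \<open>The map \<open>V s t\<close> plays the role of the increment of a linear flow over \<open>[s, t]\<close>. The error
\<open>M\<close> comes from the order of the scheme, \<open>\<epsilon>\<close> from linearization.\<close>

definition approx_solution ::
    "real \<Rightarrow> real \<Rightarrow> real \<Rightarrow> real \<Rightarrow> (real \<Rightarrow> real \<Rightarrow> 'e::real_normed_vector \<Rightarrow> 'e) \<Rightarrow>
     real \<Rightarrow> real \<Rightarrow> (real \<Rightarrow> 'e) \<Rightarrow> bool" where
  "approx_solution \<alpha> \<delta> a b V M \<epsilon> \<zeta> \<longleftrightarrow>
     (\<forall>s t. a \<le> s \<longrightarrow> s \<le> t \<longrightarrow> t \<le> b \<longrightarrow> weight \<alpha> s t \<le> \<delta> \<longrightarrow>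
        norm (\<zeta> t - \<zeta> s - V s t (\<zeta> s)) \<le> M * weight \<alpha> s t ^ 3 + \<epsilon> * weight \<alpha> s t)"

text \<open>The remainder of an approximate solution over \<open>[s, t]\<close> is the remainder over the right half, plus the one over
the left half transported by \<open>V\<close>, plus the failure of \<open>V\<close> to be multiplicative, which is of order
\<open>w\<^sup>3\<close> times the size \<open>S\<close> of the path. Iterating the midpoint argument \<open>n\<close> times bounds the remainder; on a short
interval its part proportional to \<open>S\<close> is absorbed, and short intervals are then put together.\<close>

lemma linear_stability:
  fixes V :: "real \<Rightarrow> real \<Rightarrow> 'e::real_normed_vector \<Rightarrow> 'e"
  assumes exponent: "1/3 < \<alpha>" and "0 < \<delta>" and C: "1 \<le> C"
    and lin: "\<And>s t. a \<le> s \<Longrightarrow> s \<le> t \<Longrightarrow> t \<le> b \<Longrightarrow> linear (V s t)"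
    and bound: "\<And>s t h. a \<le> s \<Longrightarrow> s \<le> t \<Longrightarrow> t \<le> b \<Longrightarrow> norm (V s t h) \<le> C * weight \<alpha> s t * norm h"
    and cocycle: "\<And>s m t h. a \<le> s \<Longrightarrow> s \<le> m \<Longrightarrow> m \<le> t \<Longrightarrow> t \<le> b \<Longrightarrow> weight \<alpha> s t \<le> \<delta> \<Longrightarrow>
      norm (V s m h + V m t (h + V s m h) - V s t h) \<le> C * weight \<alpha> s t ^ 3 * norm h"
  obtains A \<rho> where "0 \<le> A" "\<rho> < 1" "0 \<le> \<rho>"
    "\<And>(\<zeta> :: real \<Rightarrow> 'e) (M :: real) (\<epsilon> :: real) n t. 0 \<le> M \<Longrightarrow> 0 \<le> \<epsilon> \<Longrightarrow>
      approx_solution \<alpha> \<delta> a b V M \<epsilon> \<zeta> \<Longrightarrow>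
      a \<le> t \<Longrightarrow> t \<le> b \<Longrightarrow> norm (\<zeta> t) \<le> A * (norm (\<zeta> a) + \<rho> ^ n * M + 3 ^ n * \<epsilon>)"
proof -
  obtain \<kappa> \<rho> :: real where \<kappa>: "0 < \<kappa>" "\<kappa> \<le> 1" and \<rho>: "0 < \<rho>" "\<rho> < 1"
    and contract: "(2 + \<kappa>) * ((1/2) powr \<alpha>) ^ 3 \<le> \<rho>"
    using halving_contraction[OF exponent] .
  \<comment> \<open>The bound \<open>\<kappa> / C\<close> makes the transport factor at most \<open>1 + \<kappa>\<close>; the bound
    \<open>(1 - \<rho>) / (2 C)\<close> makes the part of the remainder proportional to \<open>S\<close> at most \<open>S / 2\<close>.\<close>
  define \<delta>' where "\<delta>' = min \<delta> (min (\<kappa> / C) ((1 - \<rho>) / (2 * C)))"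
  have \<delta>': "0 < \<delta>'" "\<delta>' \<le> \<delta>" "C * \<delta>' \<le> \<kappa>" "2 * C * \<delta>' \<le> 1 - \<rho>"
  proof -
    show "0 < \<delta>'"
      using \<open>0 < \<delta>\<close> \<kappa> \<rho> C by (simp add: \<delta>'_def)
    have "\<delta>' \<le> \<kappa> / C" "\<delta>' \<le> (1 - \<rho>) / (2 * C)"
      by (simp_all add: \<delta>'_def)
    then show "C * \<delta>' \<le> \<kappa>" "2 * C * \<delta>' \<le> 1 - \<rho>"
      using C by (simp_all add: pos_le_divide_eq mult_ac)
  qed (simp add: \<delta>'_def)
  have \<delta>'_le_1: "\<delta>' \<le> 1"
    using \<delta>'(1,3) \<kappa>(2) C mult_right_mono[of 1 C \<delta>'] by linarith
  have "0 \<le> \<alpha>" using exponent by simp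
  have local_bound: "norm (\<zeta> t) \<le> 2 * (1 + C) * norm (\<zeta> s0) + 2 * (\<rho> ^ n * M + 3 ^ n * \<epsilon>)"
    if "0 \<le> M" "0 \<le> \<epsilon>"
      and approx: "\<And>s t. a \<le> s \<Longrightarrow> s \<le> t \<Longrightarrow> t \<le> b \<Longrightarrow> weight \<alpha> s t \<le> \<delta> \<Longrightarrow>
        norm (\<zeta> t - \<zeta> s - V s t (\<zeta> s)) \<le> M * weight \<alpha> s t ^ 3 + \<epsilon> * weight \<alpha> s t"
      and s0: "a \<le> s0" "s0 \<le> t" "t \<le> b" "weight \<alpha> s0 t \<le> \<delta>'"
    for \<zeta> :: "real \<Rightarrow> 'e" and M \<epsilon> s0 t :: real and n :: nat
  proof -
    define t0 where "t0 = t"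
    define e where "e s t = norm (\<zeta> t - \<zeta> s - V s t (\<zeta> s))" for s t
    have weight_small: "weight \<alpha> s t \<le> \<delta>'" if "s0 \<le> s" "s \<le> t" "t \<le> t0" for s t
      using weight_mono[OF \<open>0 \<le> \<alpha>\<close> that] s0 by (simp add: t0_def)
    have grow: "norm (\<zeta> s) \<le> (1 + C) * norm (\<zeta> s0) + e s0 s" if "s0 \<le> s" "s \<le> t0" for s
    proof -
      have "norm (\<zeta> s) \<le> norm (\<zeta> s0) + norm (V s0 s (\<zeta> s0)) + e s0 s"
        using norm_triangle_ineq[of "\<zeta> s0 + V s0 s (\<zeta> s0)" "\<zeta> s - \<zeta> s0 - V s0 s (\<zeta> s0)"]
          norm_triangle_ineq[of "\<zeta> s0" "V s0 s (\<zeta> s0)"] by (simp add: e_def)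
      also have "norm (V s0 s (\<zeta> s0)) \<le> C * 1 * norm (\<zeta> s0)"
      proof (rule order.trans[OF bound])
        have "weight \<alpha> s0 s \<le> 1"
          using weight_small[of s0 s] that \<delta>'_le_1 by simp
        then show "C * weight \<alpha> s0 s * norm (\<zeta> s0) \<le> C * 1 * norm (\<zeta> s0)"
          using C by (intro mult_right_mono mult_left_mono) auto
      qed (use that s0 in \<open>auto simp: t0_def\<close>)
      finally show ?thesis by (simp add: algebra_simps)
    qed
    have split: "e s t \<le> e ((s + t) / 2) t + (1 + \<kappa>) * e s ((s + t) / 2) + C * S * weight \<alpha> s t ^ 3"
      if st: "s0 \<le> s" "s \<le> t" "t \<le> t0" and S: "norm (\<zeta> s) \<le> S" for s t S
    proof -
      define m where "m = (s + t) / 2"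
      have m: "s \<le> m" "m \<le> t" using st by (simp_all add: m_def)
      define r where "r = \<zeta> m - \<zeta> s - V s m (\<zeta> s)"
      have ab: "a \<le> s" "a \<le> m" "t \<le> b" "m \<le> b"
        using st m s0 by (auto simp: t0_def)
      have "\<zeta> t - \<zeta> s - V s t (\<zeta> s) =
          (\<zeta> t - \<zeta> m - V m t (\<zeta> m)) + (r + V m t r) + (V s m (\<zeta> s) + V m t (\<zeta> s + V s m (\<zeta> s)) - V s t (\<zeta> s))"
      proof -
        have "\<zeta> m = (\<zeta> s + V s m (\<zeta> s)) + r" by (simp add: r_def)
        then have "V m t (\<zeta> m) = V m t (\<zeta> s + V s m (\<zeta> s)) + V m t r"
          using linear_add[OF lin[of m t]] ab m by metis
        then show ?thesis by (simp add: r_def)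
      qed
      then have "e s t \<le> e m t + (norm r + norm (V m t r)) +
          norm (V s m (\<zeta> s) + V m t (\<zeta> s + V s m (\<zeta> s)) - V s t (\<zeta> s))"
        unfolding e_def by (metis add_mono norm_triangle_ineq norm_triangle_mono order.refl)
      also have "norm (V m t r) \<le> \<kappa> * norm r"
      proof (rule order.trans[OF bound[OF ab(2) m(2) ab(3)]])
        have "C * weight \<alpha> m t \<le> C * \<delta>'"
          using weight_small[of m t] st m C by (intro mult_left_mono) auto
        then show "C * weight \<alpha> m t * norm r \<le> \<kappa> * norm r"
          using \<delta>'(3) by (intro mult_right_mono) auto
      qed
      also have "norm (V s m (\<zeta> s) + V m t (\<zeta> s + V s m (\<zeta> s)) - V s t (\<zeta> s)) \<le> C * weight \<alpha> s t ^ 3 * norm (\<zeta> s)"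
        using weight_small[OF st] \<delta>'(2) by (intro cocycle ab m) simp
      also have "\<dots> \<le> C * weight \<alpha> s t ^ 3 * S"
        using S C by (intro mult_left_mono) auto
      finally show ?thesis
        by (simp add: e_def r_def m_def algebra_simps)
    qed
    have apriori: "e s t \<le> M * weight \<alpha> s t ^ 3 + \<epsilon> * weight \<alpha> s t" if "s0 \<le> s" "s \<le> t" "t \<le> t0" for s t
      unfolding e_def using weight_small[OF that] \<delta>'(2) that s0 by (intro approx) (auto simp: t0_def)
    have err: "(c * weight \<alpha> s t ^ 3 + c' * weight \<alpha> s t) \<le> c * \<delta>' + c'"
      if "s0 \<le> s" "s \<le> t" "t \<le> t0" "0 \<le> c" "0 \<le> c'" for s t c c'
    proof (intro add_mono)
      have w: "weight \<alpha> s t \<le> \<delta>'" by (rule weight_small) (use that in auto)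
      then have "weight \<alpha> s t ^ 3 \<le> \<delta>'"
        using cube_le_self[of "weight \<alpha> s t"] \<delta>'_le_1 by simp
      then show "c * weight \<alpha> s t ^ 3 \<le> c * \<delta>'"
        using that by (intro mult_left_mono) auto
      show "c' * weight \<alpha> s t \<le> c'"
        using w \<delta>'_le_1 that mult_left_mono[of "weight \<alpha> s t" 1 c'] by simp
    qed
    have "norm (\<zeta> t) \<le> 2 * ((1 + C) * norm (\<zeta> s0) + \<rho> ^ n * M + 3 ^ n * \<epsilon>)"
    proof (rule sup_absorption[where f = "\<lambda>s. norm (\<zeta> s)" and i = t and I = "{s0..t0}"])
      show "norm (\<zeta> s) \<le> (1 + C) * norm (\<zeta> s0) + (M + \<epsilon>)" if "s \<in> {s0..t0}" for s
      proof -
        have "e s0 s \<le> M * \<delta>' + \<epsilon>"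
          using apriori[of s0 s] err[of s0 s M \<epsilon>] that \<open>0 \<le> M\<close> \<open>0 \<le> \<epsilon>\<close> by auto
        moreover have "M * \<delta>' \<le> M"
          using \<delta>'_le_1 \<open>0 \<le> M\<close> mult_left_mono[of \<delta>' 1 M] by simp
        ultimately show ?thesis
          using grow[of s] that by auto
      qed
      fix S s
      assume S: "0 \<le> S" "\<And>j. j \<in> {s0..t0} \<Longrightarrow> norm (\<zeta> j) \<le> S" and s: "s \<in> {s0..t0}"
      have "e s0 s \<le> (C * S / (1 - \<rho>) + \<rho> ^ n * M) * weight \<alpha> s0 s ^ 3 + 3 ^ n * \<epsilon> * weight \<alpha> s0 s"
      proof (rule midpoint_iteration[where e = e and s = s0 and t = s and \<kappa> = \<kappa> and ?s0.0 = s0 and ?t0.0 = t0])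
        show "e s t \<le> e ((s + t) / 2) t + (1 + \<kappa>) * e s ((s + t) / 2) + C * S * weight \<alpha> s t ^ 3"
          if "s0 \<le> s" "s \<le> t" "t \<le> t0" for s t
          using that by (intro split S) auto
      qed (use apriori s S(1) C \<open>0 \<le> M\<close> \<open>0 \<le> \<epsilon>\<close> \<open>0 \<le> \<alpha>\<close> \<kappa> \<rho> contract in auto)
      also have "\<dots> \<le> (C * S / (1 - \<rho>) + \<rho> ^ n * M) * \<delta>' + 3 ^ n * \<epsilon>"
        using s S(1) C \<rho> \<open>0 \<le> M\<close> \<open>0 \<le> \<epsilon>\<close> by (intro err) auto
      also have "\<dots> \<le> S / 2 + \<rho> ^ n * M + 3 ^ n * \<epsilon>"
      proof -
        have "(C * S / (1 - \<rho>)) * \<delta>' \<le> S / 2"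
          using mult_right_mono[OF \<delta>'(4) S(1)] \<rho> by (simp add: field_simps)
        moreover have "(\<rho> ^ n * M) * \<delta>' \<le> \<rho> ^ n * M"
          using \<delta>'_le_1 \<open>0 \<le> M\<close> \<rho> mult_left_mono[of \<delta>' 1 "\<rho> ^ n * M"] by simp
        ultimately show ?thesis
          unfolding distrib_right by linarith
      qed
      finally show "norm (\<zeta> s) \<le> (1 + C) * norm (\<zeta> s0) + \<rho> ^ n * M + 3 ^ n * \<epsilon> + S / 2"
        using grow[of s] s by simp
    qed (use s0 C \<rho> \<open>0 \<le> M\<close> \<open>0 \<le> \<epsilon>\<close> in \<open>auto simp: t0_def\<close>)
    then show ?thesis
      by (simp add: algebra_simps)
  qed
  have "0 < \<alpha>" using exponent by simp
  obtain A where A: "1 \<le> A"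
    and propagate: "\<And>(u :: real \<Rightarrow> real) (B :: real) t. 0 \<le> B \<Longrightarrow> 0 \<le> u a \<Longrightarrow> a \<le> t \<Longrightarrow> t \<le> b \<Longrightarrow>
      (\<And>s t. a \<le> s \<Longrightarrow> s \<le> t \<Longrightarrow> t \<le> b \<Longrightarrow> t - s \<le> \<delta>' powr (1 / \<alpha>) \<Longrightarrow> u t \<le> 2 * (1 + C) * u s + B) \<Longrightarrow> u t \<le> A * (u a + B)"
    using propagate_steps[of "\<delta>' powr (1 / \<alpha>)" "2 * (1 + C)" a b] \<delta>'(1) C by auto
  show thesis
  proof (rule that[of "2 * A" \<rho>])
    fix \<zeta> :: "real \<Rightarrow> 'e" and M \<epsilon> t :: real and n :: nat
    assume M: "0 \<le> M" "0 \<le> \<epsilon>" and t: "a \<le> t" "t \<le> b"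
      and "approx_solution \<alpha> \<delta> a b V M \<epsilon> \<zeta>"
    then have approx: "norm (\<zeta> t - \<zeta> s - V s t (\<zeta> s)) \<le> M * weight \<alpha> s t ^ 3 + \<epsilon> * weight \<alpha> s t"
      if "a \<le> s" "s \<le> t" "t \<le> b" "weight \<alpha> s t \<le> \<delta>" for s t
      using that by (simp add: approx_solution_def)
    have "norm (\<zeta> t) \<le> A * (norm (\<zeta> a) + 2 * (\<rho> ^ n * M + 3 ^ n * \<epsilon>))"
    proof (rule propagate[OF _ norm_ge_zero t])
      show "norm (\<zeta> t) \<le> 2 * (1 + C) * norm (\<zeta> s) + 2 * (\<rho> ^ n * M + 3 ^ n * \<epsilon>)"
        if "a \<le> s" "s \<le> t" "t \<le> b" "t - s \<le> \<delta>' powr (1 / \<alpha>)" for s t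
        using weight_le[OF \<open>0 < \<alpha>\<close> \<delta>'(1) that(2,4)] that by (intro local_bound M approx) auto
    qed (use M \<rho> in auto)
    also have "\<dots> \<le> A * (2 * (norm (\<zeta> a) + \<rho> ^ n * M + 3 ^ n * \<epsilon>))"
      using A by (intro mult_left_mono) auto
    finally show "norm (\<zeta> t) \<le> 2 * A * (norm (\<zeta> a) + \<rho> ^ n * M + 3 ^ n * \<epsilon>)"
      by (simp only: mult_ac)
  qed (use A \<rho> in auto)
qed

section \<open>Almost flows\<close>

text \<open>The map \<open>f s t\<close> is the increment of a one-step map, which sends \<open>z\<close> to \<open>z + f s t z\<close>. The last
two assumptions measure how far two steps are from one long step; the Lipschitz form of the defect is what makes
flow lines depend on their starting point in a Lipschitz way, and its derivative is the cocycle property needed for the linearization.\<close>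

locale almost_flow =
  fixes \<alpha> a b C :: real
    and f :: "real \<Rightarrow> real \<Rightarrow> 'e::euclidean_space \<Rightarrow> 'e"
    and Df :: "real \<Rightarrow> real \<Rightarrow> 'e \<Rightarrow> 'e \<Rightarrow> 'e"
  assumes exponent: "1/3 < \<alpha>" and C_ge_1: "1 \<le> C"
    and f_deriv: "\<And>s t z. a \<le> s \<Longrightarrow> s \<le> t \<Longrightarrow> t \<le> b \<Longrightarrow> (f s t has_derivative Df s t z) (at z)"
    and Df_bound: "\<And>s t z h. a \<le> s \<Longrightarrow> s \<le> t \<Longrightarrow> t \<le> b \<Longrightarrow>
      norm (Df s t z h) \<le> C * weight \<alpha> s t * norm h"
    and Df_lip: "\<And>s t z w h. a \<le> s \<Longrightarrow> s \<le> t \<Longrightarrow> t \<le> b \<Longrightarrow>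
      norm (Df s t z h - Df s t w h) \<le> C * weight \<alpha> s t * norm (z - w) * norm h"
    and defect_bound: "\<And>s m t z. a \<le> s \<Longrightarrow> s \<le> m \<Longrightarrow> m \<le> t \<Longrightarrow> t \<le> b \<Longrightarrow>
      norm (f s m z + f m t (z + f s m z) - f s t z) \<le> C * weight \<alpha> s t ^ 3"
    and defect_lip: "\<And>s m t z w. a \<le> s \<Longrightarrow> s \<le> m \<Longrightarrow> m \<le> t \<Longrightarrow> t \<le> b \<Longrightarrow>
      norm ((f s m z + f m t (z + f s m z) - f s t z) - (f s m w + f m t (w + f s m w) - f s t w))
        \<le> C * weight \<alpha> s t ^ 3 * norm (z - w)"
begin

definition remainder :: "(real \<Rightarrow> 'e) \<Rightarrow> real \<Rightarrow> real \<Rightarrow> 'e" where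
  "remainder y s t = y t - y s - f s t (y s)"

text \<open>The constant \<open>M\<close> may depend on \<open>y\<close>; that it can be chosen independently of \<open>y\<close> on short
intervals is \<open>uniform_remainder\<close>.\<close>

definition flow_line :: "(real \<Rightarrow> 'e) \<Rightarrow> bool" where
  "flow_line y \<longleftrightarrow> (\<exists>M. \<forall>s t. a \<le> s \<longrightarrow> s \<le> t \<longrightarrow> t \<le> b \<longrightarrow> norm (remainder y s t) \<le> M * weight \<alpha> s t ^ 3)"

lemma exponent_pos: "0 < \<alpha>" "0 \<le> \<alpha>"
  using exponent by simp_all

lemma f_lip:
  assumes "a \<le> s" "s \<le> t" "t \<le> b"
  shows "norm (f s t z - f s t w) \<le> C * weight \<alpha> s t * norm (z - w)"
  by (rule mean_value_bound[OF f_deriv[OF assms] Df_bound[OF assms]]) (use C_ge_1 in simp)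

lemma f_four_point:
  assumes "a \<le> s" "s \<le> t" "t \<le> b"
  shows "norm ((f s t (z + v) - f s t z) - (f s t (w + v') - f s t w))
    \<le> C * weight \<alpha> s t * (norm v * norm (z - w) + norm (v - v'))"
  by (rule four_point_bound[OF f_deriv[OF assms] Df_bound[OF assms] Df_lip[OF assms]]) (use C_ge_1 in simp)

lemma f_taylor:
  assumes "a \<le> s" "s \<le> t" "t \<le> b"
  shows "norm (f s t (z + k) - f s t z - Df s t z k) \<le> C * weight \<alpha> s t * (norm k)\<^sup>2"
  by (rule taylor_bound[OF f_deriv[OF assms] Df_lip[OF assms]]) (use C_ge_1 in simp)

text \<open>The remainder over the left half moves the starting point of the step over the right half; the last bracket is
the defect of the one-step maps.\<close>

lemma remainder_split:
  "remainder y s t = remainder y m t + remainder y s m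
     + (f m t ((y s + f s m (y s)) + remainder y s m) - f m t (y s + f s m (y s)))
     + (f s m (y s) + f m t (y s + f s m (y s)) - f s t (y s))"
  by (simp add: remainder_def)

lemma uniform_remainder:
  obtains \<delta> K where "0 < \<delta>" "\<delta> \<le> 1" "0 \<le> K"
    "\<And>y s t. flow_line y \<Longrightarrow> a \<le> s \<Longrightarrow> s \<le> t \<Longrightarrow> t \<le> b \<Longrightarrow> weight \<alpha> s t \<le> \<delta> \<Longrightarrow>
      norm (remainder y s t) \<le> K * weight \<alpha> s t ^ 3"
proof -
  obtain \<kappa> \<rho> :: real where \<kappa>: "0 < \<kappa>" "\<kappa> \<le> 1" and \<rho>: "0 < \<rho>" "\<rho> < 1"
    and contract: "(2 + \<kappa>) * ((1/2) powr \<alpha>) ^ 3 \<le> \<rho>"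
    using halving_contraction[OF exponent] .
  show thesis
  proof (rule that[of "\<kappa> / C" "C / (1 - \<rho>)"])
    fix y s0 t0
    assume "flow_line y" and st0: "a \<le> s0" "s0 \<le> t0" "t0 \<le> b" "weight \<alpha> s0 t0 \<le> \<kappa> / C"
    then obtain M where M: "\<And>s t. a \<le> s \<Longrightarrow> s \<le> t \<Longrightarrow> t \<le> b \<Longrightarrow> norm (remainder y s t) \<le> M * weight \<alpha> s t ^ 3"
      by (auto simp: flow_line_def)
    show "norm (remainder y s0 t0) \<le> C / (1 - \<rho>) * weight \<alpha> s0 t0 ^ 3"
    proof (rule midpoint_absorption[where e = "\<lambda>s t. norm (remainder y s t)" and s = s0 and t = t0 and \<kappa> = \<kappa> and M = "\<bar>M\<bar>" and ?s0.0 = s0 and ?t0.0 = t0])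
      fix s t assume st: "s0 \<le> s" "s \<le> t" "t \<le> t0"
      have "M * weight \<alpha> s t ^ 3 \<le> \<bar>M\<bar> * weight \<alpha> s t ^ 3"
        by (intro mult_right_mono) auto
      then show "norm (remainder y s t) \<le> \<bar>M\<bar> * weight \<alpha> s t ^ 3"
        using M[of s t] st st0 by simp
      define m where "m = (s + t) / 2"
      have m: "s \<le> m" "m \<le> t" using st by (simp_all add: m_def)
      have ab: "a \<le> s" "a \<le> m" "t \<le> b" "m \<le> b"
        using st m st0 by auto
      have w: "C * weight \<alpha> m t \<le> \<kappa>"
      proof (rule order.trans)
        show "C * weight \<alpha> m t \<le> C * weight \<alpha> s0 t0"
          using st m C_ge_1 exponent_pos by (intro mult_left_mono weight_mono) auto
        show "C * weight \<alpha> s0 t0 \<le> \<kappa>"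
          using st0(4) C_ge_1 by (simp add: pos_le_divide_eq mult.commute)
      qed
      have "norm (remainder y s t) \<le> norm (remainder y m t) + norm (remainder y s m)
          + norm (f m t ((y s + f s m (y s)) + remainder y s m) - f m t (y s + f s m (y s)))
          + norm (f s m (y s) + f m t (y s + f s m (y s)) - f s t (y s))"
        by (subst remainder_split[of y s t m]) (intro norm_triangle_mono order.refl)
      also have "norm (f s m (y s) + f m t (y s + f s m (y s)) - f s t (y s)) \<le> C * weight \<alpha> s t ^ 3"
        by (intro defect_bound ab m)
      also have "norm (f m t ((y s + f s m (y s)) + remainder y s m) - f m t (y s + f s m (y s)))
          \<le> \<kappa> * norm (remainder y s m)"
        using f_lip[OF ab(2) m(2) ab(3), of "(y s + f s m (y s)) + remainder y s m" "y s + f s m (y s)"]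
          mult_right_mono[OF w norm_ge_zero[of "remainder y s m"]] by simp
      finally show "norm (remainder y s t) \<le> norm (remainder y ((s + t) / 2) t)
          + (1 + \<kappa>) * norm (remainder y s ((s + t) / 2)) + C * weight \<alpha> s t ^ 3"
        by (simp add: m_def algebra_simps)
    qed (use exponent_pos C_ge_1 \<kappa> \<rho> contract st0 in auto)
  qed (use \<kappa> \<rho> C_ge_1 in \<open>auto simp: field_simps\<close>)
qed

text \<open>The difference of the remainders of two flow lines obeys the same midpoint recursion as a single remainder: the
four-point bound controls the difference of the two transported remainders, and the Lipschitz bound on the
defect contributes the distance of the flow lines. This distance, in turn, grows only by the one-step map and the
difference of the remainders, so its supremum is absorbed on a short interval.\<close>

lemma local_lipschitz:
  obtains \<delta> K where "0 < \<delta>" "\<delta> \<le> 1" "0 \<le> K"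
    "\<And>y s t. flow_line y \<Longrightarrow> a \<le> s \<Longrightarrow> s \<le> t \<Longrightarrow> t \<le> b \<Longrightarrow> weight \<alpha> s t \<le> \<delta> \<Longrightarrow>
      norm (remainder y s t) \<le> K * weight \<alpha> s t ^ 3"
    "\<And>y' y s t. flow_line y' \<Longrightarrow> flow_line y \<Longrightarrow> a \<le> s \<Longrightarrow> s \<le> t \<Longrightarrow> t \<le> b \<Longrightarrow> weight \<alpha> s t \<le> \<delta> \<Longrightarrow>
      norm (y' t - y t) \<le> 2 * (1 + C) * norm (y' s - y s)"
    "\<And>y' y s t. flow_line y' \<Longrightarrow> flow_line y \<Longrightarrow> a \<le> s \<Longrightarrow> s \<le> t \<Longrightarrow> t \<le> b \<Longrightarrow> weight \<alpha> s t \<le> \<delta> \<Longrightarrow>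
      norm (remainder y' s t - remainder y s t) \<le> K * norm (y' s - y s) * weight \<alpha> s t ^ 3"
proof -
  obtain \<kappa> \<rho> :: real where \<kappa>: "0 < \<kappa>" "\<kappa> \<le> 1" and \<rho>: "0 < \<rho>" "\<rho> < 1"
    and contract: "(2 + \<kappa>) * ((1/2) powr \<alpha>) ^ 3 \<le> \<rho>"
    using halving_contraction[OF exponent] .
  obtain \<delta>1 K1 where \<delta>1: "0 < \<delta>1" "\<delta>1 \<le> 1" and K1: "0 \<le> K1"
    and rem: "\<And>y s t. flow_line y \<Longrightarrow> a \<le> s \<Longrightarrow> s \<le> t \<Longrightarrow> t \<le> b \<Longrightarrow> weight \<alpha> s t \<le> \<delta>1 \<Longrightarrow>
      norm (remainder y s t) \<le> K1 * weight \<alpha> s t ^ 3"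
    using uniform_remainder by blast
  define c where "c = C * K1 * (1 + C) + C"
  define L where "L = c / (1 - \<rho>)"
  have c: "0 < c" "0 < L"
    using C_ge_1 K1 \<rho> by (auto simp: c_def L_def intro!: add_nonneg_pos divide_pos_pos)
  \<comment> \<open>As in the linear case: \<open>\<kappa> / C\<close> for the transport factor, \<open>1 / (2 L)\<close> for the absorption of the
    supremum of the distance.\<close>
  define \<delta> where "\<delta> = min \<delta>1 (min (\<kappa> / C) (1 / (2 * L)))"
  have \<delta>: "0 < \<delta>" "\<delta> \<le> \<delta>1" "C * \<delta> \<le> \<kappa>" "L * \<delta> \<le> 1 / 2"
  proof -
    show "0 < \<delta>"
      using \<delta>1 \<kappa> c C_ge_1 by (simp add: \<delta>_def)
    have "\<delta> \<le> \<kappa> / C" "\<delta> \<le> 1 / (2 * L)"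
      by (simp_all add: \<delta>_def)
    then show "C * \<delta> \<le> \<kappa>" "L * \<delta> \<le> 1 / 2"
      using C_ge_1 c by (simp_all add: pos_le_divide_eq mult_ac)
  qed (simp add: \<delta>_def)
  have \<delta>_le_1: "\<delta> \<le> 1" using \<delta> \<delta>1 by simp
  have diff_bound: "norm (remainder y' s t - remainder y s t) \<le> L * S * weight \<alpha> s t ^ 3"
    if fl: "flow_line y'" "flow_line y" and st0: "a \<le> s0" "t0 \<le> b" "weight \<alpha> s0 t0 \<le> \<delta>"
      and S: "\<And>s. s0 \<le> s \<Longrightarrow> s \<le> t0 \<Longrightarrow> norm (y' s - y s) \<le> S"
      and st: "s0 \<le> s" "s \<le> t" "t \<le> t0"
    for y' y s0 t0 S s t
  proof -
    have "0 \<le> S" using order.trans[OF norm_ge_zero S[of s]] st by simp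
    have small: "weight \<alpha> s t \<le> \<delta>" if "s0 \<le> s" "s \<le> t" "t \<le> t0" for s t
      using weight_mono[OF exponent_pos(2) that] st0 by simp
    have "norm (remainder y' s t - remainder y s t) \<le> (c * S) / (1 - \<rho>) * weight \<alpha> s t ^ 3"
    proof (rule midpoint_absorption[where e = "\<lambda>s t. norm (remainder y' s t - remainder y s t)" and s = s and t = t
          and \<kappa> = \<kappa> and M = "2 * K1" and ?s0.0 = s0 and ?t0.0 = t0])
      fix s t assume st: "s0 \<le> s" "s \<le> t" "t \<le> t0"
      have rems: "norm (remainder y' s t) \<le> K1 * weight \<alpha> s t ^ 3" "norm (remainder y s t) \<le> K1 * weight \<alpha> s t ^ 3"
        using small[OF st] \<delta>(2) st st0 fl by (auto intro!: rem)
      then show "norm (remainder y' s t - remainder y s t) \<le> 2 * K1 * weight \<alpha> s t ^ 3"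
        using norm_triangle_ineq4[of "remainder y' s t" "remainder y s t"] by simp
      define m where "m = (s + t) / 2"
      have m: "s \<le> m" "m \<le> t" using st by (simp_all add: m_def)
      have ab: "a \<le> s" "a \<le> m" "t \<le> b" "m \<le> b"
        using st m st0 by auto
      have wm: "weight \<alpha> m t \<le> \<delta>" "weight \<alpha> s m \<le> \<delta>" "weight \<alpha> s m \<le> weight \<alpha> s t"
        using small[of m t] small[of s m] weight_mono[OF exponent_pos(2), of s s m t] st m by auto
      have w: "C * weight \<alpha> m t \<le> \<kappa>"
        using order.trans[OF mult_left_mono[OF wm(1), of C] \<delta>(3)] C_ge_1 by simp
      define z w v v' where "z = y' s + f s m (y' s)" and "w = y s + f s m (y s)"
        and "v = remainder y' s m" and "v' = remainder y s m"
      have "remainder y' s t - remainder y s t = (remainder y' m t - remainder y m t) + (v - v')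
          + ((f m t (z + v) - f m t z) - (f m t (w + v') - f m t w))
          + ((f s m (y' s) + f m t (y' s + f s m (y' s)) - f s t (y' s)) - (f s m (y s) + f m t (y s + f s m (y s)) - f s t (y s)))"
        unfolding remainder_split[of y' s t m] remainder_split[of y s t m] z_def w_def v_def v'_def by simp
      then have "norm (remainder y' s t - remainder y s t) \<le> norm (remainder y' m t - remainder y m t) + norm (v - v')
          + norm ((f m t (z + v) - f m t z) - (f m t (w + v') - f m t w))
          + norm ((f s m (y' s) + f m t (y' s + f s m (y' s)) - f s t (y' s)) - (f s m (y s) + f m t (y s + f s m (y s)) - f s t (y s)))"
        by (simp only:) (intro norm_triangle_mono order.refl)
      also have "norm ((f s m (y' s) + f m t (y' s + f s m (y' s)) - f s t (y' s)) - (f s m (y s) + f m t (y s + f s m (y s)) - f s t (y s)))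
          \<le> C * weight \<alpha> s t ^ 3 * norm (y' s - y s)"
        by (intro defect_lip ab m)
      also have "\<dots> \<le> C * weight \<alpha> s t ^ 3 * S"
        using C_ge_1 S[of s] st by (intro mult_left_mono) auto
      also have "norm ((f m t (z + v) - f m t z) - (f m t (w + v') - f m t w))
          \<le> C * K1 * (1 + C) * S * weight \<alpha> s t ^ 3 + \<kappa> * norm (v - v')"
      proof -
        have "norm (z - w) \<le> norm (y' s - y s) + norm (f s m (y' s) - f s m (y s))"
          using norm_triangle_ineq[of "y' s - y s" "f s m (y' s) - f s m (y s)"] by (simp add: z_def w_def algebra_simps)
        moreover have "norm (f s m (y' s) - f s m (y s)) \<le> C * weight \<alpha> s m * norm (y' s - y s)"
          by (intro f_lip ab m)
        moreover have "C * weight \<alpha> s m * norm (y' s - y s) \<le> C * 1 * norm (y' s - y s)"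
          using C_ge_1 wm(2) \<delta>_le_1 by (intro mult_right_mono mult_left_mono) auto
        moreover have "(1 + C) * norm (y' s - y s) \<le> (1 + C) * S"
          using C_ge_1 S[of s] st by (intro mult_left_mono) auto
        ultimately have zw: "norm (z - w) \<le> (1 + C) * S"
          by (simp add: algebra_simps)
        have v: "norm v \<le> K1 * weight \<alpha> s t ^ 3"
        proof -
          have "norm v \<le> K1 * weight \<alpha> s m ^ 3"
            unfolding v_def using wm \<delta>(2) fl by (intro rem ab m) auto
          also have "\<dots> \<le> K1 * weight \<alpha> s t ^ 3"
            using K1 wm(3) by (intro mult_left_mono power_mono) auto
          finally show ?thesis .
        qed
        have prod: "norm v * norm (z - w) \<le> (K1 * weight \<alpha> s t ^ 3) * ((1 + C) * S)"
          using v zw K1 by (intro mult_mono) auto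
        have "C * weight \<alpha> m t \<le> C * 1"
          using C_ge_1 wm(1) \<delta>_le_1 by (intro mult_left_mono) auto
        from mult_mono[OF this prod] have "C * weight \<alpha> m t * (norm v * norm (z - w)) \<le> C * 1 * ((K1 * weight \<alpha> s t ^ 3) * ((1 + C) * S))"
          using C_ge_1 by simp
        moreover have "C * weight \<alpha> m t * norm (v - v') \<le> \<kappa> * norm (v - v')"
          using w by (intro mult_right_mono) auto
        ultimately show ?thesis
          using f_four_point[OF ab(2) m(2) ab(3), of z v w v'] by (simp add: algebra_simps)
      qed
      finally show "norm (remainder y' s t - remainder y s t) \<le> norm (remainder y' ((s + t) / 2) t - remainder y ((s + t) / 2) t)
          + (1 + \<kappa>) * norm (remainder y' s ((s + t) / 2) - remainder y s ((s + t) / 2)) + c * S * weight \<alpha> s t ^ 3"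
        by (simp add: m_def v_def v'_def c_def algebra_simps)
    qed (use exponent_pos c K1 \<kappa> \<rho> contract st \<open>0 \<le> S\<close> in auto)
    then show ?thesis by (simp add: L_def)
  qed
  have lip: "norm (y' t - y t) \<le> 2 * (1 + C) * norm (y' s - y s)"
    if fl: "flow_line y'" "flow_line y" and st: "a \<le> s" "s \<le> t" "t \<le> b" "weight \<alpha> s t \<le> \<delta>" for y' y s t
  proof -
    have grow: "norm (y' r - y r) \<le> (1 + C) * norm (y' s - y s) + norm (remainder y' s r - remainder y s r)"
      and small: "weight \<alpha> s r \<le> \<delta>" "weight \<alpha> s r ^ 3 \<le> \<delta>" if "r \<in> {s..t}" for r
    proof -
      show w: "weight \<alpha> s r \<le> \<delta>"
        using weight_mono[OF exponent_pos(2), of s s r t] that st by simp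
      then show "weight \<alpha> s r ^ 3 \<le> \<delta>"
        using cube_le_self[of "weight \<alpha> s r"] \<delta>_le_1 by simp
      have "y' r - y r = (y' s - y s) + (f s r (y' s) - f s r (y s)) + (remainder y' s r - remainder y s r)"
        by (simp add: remainder_def)
      then have "norm (y' r - y r) \<le> norm (y' s - y s) + norm (f s r (y' s) - f s r (y s)) + norm (remainder y' s r - remainder y s r)"
        by (simp only:) (intro norm_triangle_mono order.refl)
      also have "norm (f s r (y' s) - f s r (y s)) \<le> C * weight \<alpha> s r * norm (y' s - y s)"
        using that st by (intro f_lip) auto
      also have "\<dots> \<le> C * 1 * norm (y' s - y s)"
        using C_ge_1 w \<delta>_le_1 by (intro mult_right_mono mult_left_mono) auto
      finally show "norm (y' r - y r) \<le> (1 + C) * norm (y' s - y s) + norm (remainder y' s r - remainder y s r)"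
        by (simp add: algebra_simps)
    qed
    have "norm (y' t - y t) \<le> 2 * ((1 + C) * norm (y' s - y s))"
    proof (rule sup_absorption[where f = "\<lambda>r. norm (y' r - y r)" and i = t and I = "{s..t}"])
      show "norm (y' r - y r) \<le> (1 + C) * norm (y' s - y s) + 2 * K1" if "r \<in> {s..t}" for r
      proof -
        have "norm (remainder u s r) \<le> K1" if "flow_line u" for u
        proof -
          have "norm (remainder u s r) \<le> K1 * weight \<alpha> s r ^ 3"
            using that \<open>r \<in> {s..t}\<close> st small(1)[of r] \<delta>(2) by (intro rem) auto
          also have "\<dots> \<le> K1 * 1"
            using small(2)[OF \<open>r \<in> {s..t}\<close>] \<delta>_le_1 K1 by (intro mult_left_mono) auto
          finally show ?thesis by simp
        qed
        from this[OF fl(1)] this[OF fl(2)] show ?thesis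
          using grow[OF that] norm_triangle_ineq4[of "remainder y' s r" "remainder y s r"] by simp
      qed
      fix S r
      assume S: "0 \<le> S" "\<And>j. j \<in> {s..t} \<Longrightarrow> norm (y' j - y j) \<le> S" and r: "r \<in> {s..t}"
      have "norm (remainder y' s r - remainder y s r) \<le> L * S * weight \<alpha> s r ^ 3"
        using r st S by (intro diff_bound[OF fl, of s t]) auto
      also have "\<dots> \<le> L * S * \<delta>"
        using c S small(2)[OF r] by (intro mult_left_mono) auto
      also have "\<dots> \<le> S / 2"
        using mult_right_mono[OF \<delta>(4) S(1)] by (simp add: mult_ac)
      finally show "norm (y' r - y r) \<le> (1 + C) * norm (y' s - y s) + S / 2"
        using grow[OF r] by simp
    qed (use st C_ge_1 K1 in auto)
    then show ?thesis by (simp only: mult.assoc)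
  qed
  show thesis
  proof (rule that[of \<delta> "max K1 (L * (2 * (1 + C)))"])
    show "norm (remainder y s t) \<le> max K1 (L * (2 * (1 + C))) * weight \<alpha> s t ^ 3"
      if "flow_line y" "a \<le> s" "s \<le> t" "t \<le> b" "weight \<alpha> s t \<le> \<delta>" for y s t
    proof -
      have "norm (remainder y s t) \<le> K1 * weight \<alpha> s t ^ 3"
        using that \<delta>(2) by (intro rem) auto
      also have "\<dots> \<le> max K1 (L * (2 * (1 + C))) * weight \<alpha> s t ^ 3"
        by (intro mult_right_mono) auto
      finally show ?thesis .
    qed
    show "norm (remainder y' s t - remainder y s t) \<le> max K1 (L * (2 * (1 + C))) * norm (y' s - y s) * weight \<alpha> s t ^ 3"
      if fl: "flow_line y'" "flow_line y" and st: "a \<le> s" "s \<le> t" "t \<le> b" "weight \<alpha> s t \<le> \<delta>" for y' y s t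
    proof -
      have "norm (remainder y' s t - remainder y s t) \<le> L * (2 * (1 + C) * norm (y' s - y s)) * weight \<alpha> s t ^ 3"
      proof (rule diff_bound[OF fl, of s t])
        show "norm (y' r - y r) \<le> 2 * (1 + C) * norm (y' s - y s)" if "s \<le> r" "r \<le> t" for r
          using that st weight_mono[OF exponent_pos(2), of s s r t] by (intro lip[OF fl]) auto
      qed (use st in auto)
      also have "\<dots> = (L * (2 * (1 + C))) * (norm (y' s - y s) * weight \<alpha> s t ^ 3)"
        by (simp add: mult_ac)
      also have "\<dots> \<le> max K1 (L * (2 * (1 + C))) * (norm (y' s - y s) * weight \<alpha> s t ^ 3)"
        by (intro mult_right_mono) auto
      finally show ?thesis by (simp add: mult_ac)
    qed
    show "norm (y' t - y t) \<le> 2 * (1 + C) * norm (y' s - y s)"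
      if "flow_line y'" "flow_line y" "a \<le> s" "s \<le> t" "t \<le> b" "weight \<alpha> s t \<le> \<delta>" for y' y s t
      by (rule lip[OF that])
  qed (use \<delta>(1) \<delta>_le_1 K1 in \<open>auto simp: le_max_iff_disj\<close>)
qed

lemma global_lipschitz:
  obtains A where "1 \<le> A" "\<And>y' y t. flow_line y' \<Longrightarrow> flow_line y \<Longrightarrow> a \<le> t \<Longrightarrow> t \<le> b \<Longrightarrow>
    norm (y' t - y t) \<le> A * norm (y' a - y a)"
proof -
  obtain \<delta> where \<delta>: "0 < \<delta>"
    and lip: "\<And>y' y s t. flow_line y' \<Longrightarrow> flow_line y \<Longrightarrow> a \<le> s \<Longrightarrow> s \<le> t \<Longrightarrow> t \<le> b \<Longrightarrow> weight \<alpha> s t \<le> \<delta> \<Longrightarrow>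
      norm (y' t - y t) \<le> 2 * (1 + C) * norm (y' s - y s)"
    by (rule local_lipschitz) (rule that)
  obtain A where A: "1 \<le> A"
    and propagate: "\<And>(u :: real \<Rightarrow> real) (B :: real) t. 0 \<le> B \<Longrightarrow> 0 \<le> u a \<Longrightarrow> a \<le> t \<Longrightarrow> t \<le> b \<Longrightarrow>
      (\<And>s t. a \<le> s \<Longrightarrow> s \<le> t \<Longrightarrow> t \<le> b \<Longrightarrow> t - s \<le> \<delta> powr (1 / \<alpha>) \<Longrightarrow> u t \<le> 2 * (1 + C) * u s + B) \<Longrightarrow> u t \<le> A * (u a + B)"
    using propagate_steps[of "\<delta> powr (1 / \<alpha>)" "2 * (1 + C)" a b] \<delta> C_ge_1 by auto
  show thesis
  proof (rule that[OF A])
    fix y' y t assume fl: "flow_line y'" "flow_line y" and t: "a \<le> t" "t \<le> b"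
    have "norm (y' t - y t) \<le> A * (norm (y' a - y a) + 0)"
    proof (rule propagate[of 0 "\<lambda>t. norm (y' t - y t)", OF _ _ t])
      show "norm (y' t - y t) \<le> 2 * (1 + C) * norm (y' s - y s) + 0"
        if "a \<le> s" "s \<le> t" "t \<le> b" "t - s \<le> \<delta> powr (1 / \<alpha>)" for s t
        using lip[OF fl that(1-3) weight_le[OF exponent_pos(1) \<delta> that(2,4)]] by simp
    qed auto
    then show "norm (y' t - y t) \<le> A * norm (y' a - y a)" by simp
  qed
qed

text \<open>The difference of two flow lines is an approximate solution of the linearization along one of them: the
remainders differ by a cubic term, and replacing the increment of \<open>f s t\<close> by its derivative costs a term that
is quadratic in the distance but only linear in the weight.\<close>

lemma difference_expansion:
  obtains \<delta> K where "0 < \<delta>" "0 \<le> K"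
    "\<And>y' y s t. flow_line y' \<Longrightarrow> flow_line y \<Longrightarrow> a \<le> s \<Longrightarrow> s \<le> t \<Longrightarrow> t \<le> b \<Longrightarrow> weight \<alpha> s t \<le> \<delta> \<Longrightarrow>
      norm ((y' t - y t) - (y' s - y s) - Df s t (y s) (y' s - y s))
        \<le> K * norm (y' a - y a) * weight \<alpha> s t ^ 3 + K * (norm (y' a - y a))\<^sup>2 * weight \<alpha> s t"
proof -
  obtain \<delta> K where \<delta>: "0 < \<delta>" and K: "0 \<le> K"
    and rem: "\<And>y' y s t. flow_line y' \<Longrightarrow> flow_line y \<Longrightarrow> a \<le> s \<Longrightarrow> s \<le> t \<Longrightarrow> t \<le> b \<Longrightarrow> weight \<alpha> s t \<le> \<delta> \<Longrightarrow>
      norm (remainder y' s t - remainder y s t) \<le> K * norm (y' s - y s) * weight \<alpha> s t ^ 3"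
    by (rule local_lipschitz) (rule that)
  obtain A where A: "1 \<le> A" and lip: "\<And>y' y t. flow_line y' \<Longrightarrow> flow_line y \<Longrightarrow> a \<le> t \<Longrightarrow> t \<le> b \<Longrightarrow>
    norm (y' t - y t) \<le> A * norm (y' a - y a)"
    by (rule global_lipschitz) (rule that)
  show thesis
  proof (rule that[of \<delta> "K * A + C * A\<^sup>2"])
    fix y' y s t
    assume fl: "flow_line y'" "flow_line y" and st: "a \<le> s" "s \<le> t" "t \<le> b" "weight \<alpha> s t \<le> \<delta>"
    define k where "k = y' s - y s"
    define w where "w = weight \<alpha> s t"
    have w: "0 \<le> w" by (simp add: w_def)
    have k: "norm k \<le> A * norm (y' a - y a)"
      unfolding k_def using st by (intro lip fl) auto
    have "(y' t - y t) - k - Df s t (y s) k = (remainder y' s t - remainder y s t) + (f s t (y s + k) - f s t (y s) - Df s t (y s) k)"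
      by (simp add: remainder_def k_def)
    then have "norm ((y' t - y t) - k - Df s t (y s) k)
        \<le> norm (remainder y' s t - remainder y s t) + norm (f s t (y s + k) - f s t (y s) - Df s t (y s) k)"
      by (simp only: norm_triangle_ineq)
    also have "\<dots> \<le> K * norm k * w ^ 3 + C * w * (norm k)\<^sup>2"
      unfolding k_def w_def by (intro add_mono rem fl st f_taylor)
    also have "\<dots> \<le> K * (A * norm (y' a - y a)) * w ^ 3 + C * w * (A * norm (y' a - y a))\<^sup>2"
      using k K C_ge_1 w by (intro add_mono mult_left_mono mult_right_mono power_mono) auto
    also have "\<dots> = (K * A) * (norm (y' a - y a) * w ^ 3) + (C * A\<^sup>2) * ((norm (y' a - y a))\<^sup>2 * w)"
      by (simp add: power_mult_distrib algebra_simps)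
    also have "\<dots> \<le> (K * A + C * A\<^sup>2) * (norm (y' a - y a) * w ^ 3) + (K * A + C * A\<^sup>2) * ((norm (y' a - y a))\<^sup>2 * w)"
      using K A C_ge_1 w by (intro add_mono mult_right_mono) auto
    finally show "norm ((y' t - y t) - (y' s - y s) - Df s t (y s) (y' s - y s))
        \<le> (K * A + C * A\<^sup>2) * norm (y' a - y a) * weight \<alpha> s t ^ 3 + (K * A + C * A\<^sup>2) * (norm (y' a - y a))\<^sup>2 * weight \<alpha> s t"
      by (simp only: k_def w_def mult.assoc)
  qed (use \<delta> K A C_ge_1 in auto)
qed

text \<open>Differentiating the defect at the point \<open>y s\<close> of a flow line gives the cocycle property of
\<open>Df s t (y s)\<close>, except that the second step is linearized at the endpoint \<open>w\<close> of the first step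
instead of at \<open>y m\<close>; these points differ by a remainder.\<close>

lemma variation_stability:
  assumes fl: "flow_line y" and "0 < \<delta>"
  obtains A \<rho> where "0 \<le> A" "\<rho> < 1" "0 \<le> \<rho>"
    "\<And>(\<zeta> :: real \<Rightarrow> 'e) (M :: real) (\<epsilon> :: real) n t. 0 \<le> M \<Longrightarrow> 0 \<le> \<epsilon> \<Longrightarrow>
      approx_solution \<alpha> \<delta> a b (\<lambda>s t. Df s t (y s)) M \<epsilon> \<zeta> \<Longrightarrow>
      a \<le> t \<Longrightarrow> t \<le> b \<Longrightarrow> norm (\<zeta> t) \<le> A * (norm (\<zeta> a) + \<rho> ^ n * M + 3 ^ n * \<epsilon>)"
proof -
  obtain \<delta>1 K where \<delta>1: "0 < \<delta>1" "\<delta>1 \<le> 1" and K: "0 \<le> K"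
    and rem: "\<And>y s t. flow_line y \<Longrightarrow> a \<le> s \<Longrightarrow> s \<le> t \<Longrightarrow> t \<le> b \<Longrightarrow> weight \<alpha> s t \<le> \<delta>1 \<Longrightarrow>
      norm (remainder y s t) \<le> K * weight \<alpha> s t ^ 3"
    by (rule uniform_remainder) (rule that)
  define V where "V s t = Df s t (y s)" for s t
  define C' where "C' = C + C * K * (1 + C)"
  have C': "1 \<le> C'" "C \<le> C'"
    using C_ge_1 K by (auto simp: C'_def intro: add_increasing2)
  have cocycle: "norm (V s m h + V m t (h + V s m h) - V s t h) \<le> C' * weight \<alpha> s t ^ 3 * norm h"
    if st: "a \<le> s" "s \<le> m" "m \<le> t" "t \<le> b" "weight \<alpha> s t \<le> \<delta>1" for s m t h
  proof -
    have ab: "s \<le> t" "m \<le> b" "a \<le> m" using st by auto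
    have wm: "weight \<alpha> s m \<le> weight \<alpha> s t" "weight \<alpha> m t \<le> 1" "weight \<alpha> s m \<le> 1"
      using weight_mono[OF exponent_pos(2), of s s m t] weight_mono[OF exponent_pos(2), of s m t t] st \<delta>1 by auto
    define w where "w = y s + f s m (y s)"
    have "((\<lambda>z. f s m z + f m t (z + f s m z) - f s t z) has_derivative
        (\<lambda>h. Df s m (y s) h + Df m t w (h + Df s m (y s) h) - Df s t (y s) h)) (at (y s))"
      unfolding w_def
      by (intro has_derivative_diff has_derivative_add f_deriv st ab has_derivative_ident
          has_derivative_compose[OF _ f_deriv, of "\<lambda>z. z + f s m z" "\<lambda>h. h + Df s m (y s) h"])
    then have 1: "norm (Df s m (y s) h + Df m t w (h + Df s m (y s) h) - Df s t (y s) h) \<le> C * weight \<alpha> s t ^ 3 * norm h"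
      by (rule derivative_bound_of_lipschitz) (intro defect_lip st)
    define k where "k = h + Df s m (y s) h"
    have k: "norm k \<le> (1 + C) * norm h"
    proof -
      have "norm k \<le> norm h + C * weight \<alpha> s m * norm h"
        unfolding k_def using Df_bound[OF st(1,2) ab(2)] by (intro norm_triangle_mono) auto
      also have "\<dots> \<le> norm h + C * 1 * norm h"
        using wm C_ge_1 by (intro add_mono mult_right_mono mult_left_mono) auto
      finally show ?thesis by (simp add: algebra_simps)
    qed
    have ym: "norm (y m - w) \<le> K * weight \<alpha> s t ^ 3"
    proof -
      have "norm (y m - w) = norm (remainder y s m)"
        by (simp add: w_def remainder_def algebra_simps)
      also have "\<dots> \<le> K * weight \<alpha> s m ^ 3"
        using st wm(1) ab by (intro rem fl) auto
      also have "\<dots> \<le> K * weight \<alpha> s t ^ 3"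
        using wm(1) K by (intro mult_left_mono power_mono) auto
      finally show ?thesis .
    qed
    have "norm (Df m t (y m) k - Df m t w k) \<le> C * weight \<alpha> m t * norm (y m - w) * norm k"
      by (intro Df_lip ab st)
    also have "\<dots> \<le> C * 1 * (K * weight \<alpha> s t ^ 3) * ((1 + C) * norm h)"
      using ym k wm C_ge_1 K by (intro mult_mono) auto
    finally have 2: "norm (Df m t (y m) k - Df m t w k) \<le> C * K * (1 + C) * weight \<alpha> s t ^ 3 * norm h"
      by (simp add: mult_ac)
    have "V s m h + V m t (h + V s m h) - V s t h =
        (Df s m (y s) h + Df m t w (h + Df s m (y s) h) - Df s t (y s) h) + (Df m t (y m) k - Df m t w k)"
      by (simp add: V_def k_def)
    then have "norm (V s m h + V m t (h + V s m h) - V s t h)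
        \<le> C * weight \<alpha> s t ^ 3 * norm h + C * K * (1 + C) * weight \<alpha> s t ^ 3 * norm h"
      using norm_triangle_mono[OF 1 2] by simp
    then show ?thesis by (simp add: C'_def distrib_right)
  qed
  obtain A \<rho> where A: "0 \<le> A" "\<rho> < 1" "0 \<le> \<rho>"
    and stab: "\<And>(\<zeta> :: real \<Rightarrow> 'e) (M :: real) (\<epsilon> :: real) n t. 0 \<le> M \<Longrightarrow> 0 \<le> \<epsilon> \<Longrightarrow>
      approx_solution \<alpha> (min \<delta> \<delta>1) a b V M \<epsilon> \<zeta> \<Longrightarrow>
      a \<le> t \<Longrightarrow> t \<le> b \<Longrightarrow> norm (\<zeta> t) \<le> A * (norm (\<zeta> a) + \<rho> ^ n * M + 3 ^ n * \<epsilon>)"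
  proof (rule linear_stability[of \<alpha> "min \<delta> \<delta>1" C' a b V])
    show "linear (V s t)" if "a \<le> s" "s \<le> t" "t \<le> b" for s t
      unfolding V_def by (rule has_derivative_linear[OF f_deriv[OF that]])
    show "norm (V s t h) \<le> C' * weight \<alpha> s t * norm h" if "a \<le> s" "s \<le> t" "t \<le> b" for s t h
    proof (rule order.trans)
      show "norm (V s t h) \<le> C * weight \<alpha> s t * norm h"
        unfolding V_def by (rule Df_bound[OF that])
      show "C * weight \<alpha> s t * norm h \<le> C' * weight \<alpha> s t * norm h"
        using C' by (intro mult_right_mono) auto
    qed
  qed (use exponent \<open>0 < \<delta>\<close> \<delta>1 C' cocycle in auto)
  show thesis
    proof (rule that[OF A])
    show "norm (\<zeta> t) \<le> A * (norm (\<zeta> a) + \<rho> ^ n * M + 3 ^ n * \<epsilon>)"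
      if "0 \<le> M" "0 \<le> \<epsilon>" "approx_solution \<alpha> \<delta> a b (\<lambda>s t. Df s t (y s)) M \<epsilon> \<zeta>" "a \<le> t" "t \<le> b"
      for \<zeta> :: "real \<Rightarrow> 'e" and M \<epsilon> t :: real and n
      using that by (intro stab) (auto simp: approx_solution_def V_def)
  qed
qed

lemma linearized_unique:
  assumes fl: "flow_line y"
    and \<zeta>: "\<And>s t. a \<le> s \<Longrightarrow> s \<le> t \<Longrightarrow> t \<le> b \<Longrightarrow> norm (\<zeta> t - \<zeta> s - Df s t (y s) (\<zeta> s)) \<le> M * weight \<alpha> s t ^ 3"
    and \<xi>: "\<And>s t. a \<le> s \<Longrightarrow> s \<le> t \<Longrightarrow> t \<le> b \<Longrightarrow> norm (\<xi> t - \<xi> s - Df s t (y s) (\<xi> s)) \<le> N * weight \<alpha> s t ^ 3"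
    and init: "\<zeta> a = \<xi> a" and t: "a \<le> t" "t \<le> b"
  shows "\<zeta> t = \<xi> t"
proof -
  obtain A \<rho> where A: "0 \<le> A" "\<rho> < 1" "0 \<le> \<rho>"
    and stab: "\<And>(\<zeta> :: real \<Rightarrow> 'e) (M :: real) (\<epsilon> :: real) n t. 0 \<le> M \<Longrightarrow> 0 \<le> \<epsilon> \<Longrightarrow>
      approx_solution \<alpha> 1 a b (\<lambda>s t. Df s t (y s)) M \<epsilon> \<zeta> \<Longrightarrow>
      a \<le> t \<Longrightarrow> t \<le> b \<Longrightarrow> norm (\<zeta> t) \<le> A * (norm (\<zeta> a) + \<rho> ^ n * M + 3 ^ n * \<epsilon>)"
    by (rule variation_stability[OF fl zero_less_one]) (rule that)
  have bound: "norm (\<zeta> t - \<xi> t) \<le> A * (\<rho> ^ n * (\<bar>M\<bar> + \<bar>N\<bar>))" for n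
  proof -
    have "norm (\<zeta> t - \<xi> t) \<le> A * (norm (\<zeta> a - \<xi> a) + \<rho> ^ n * (\<bar>M\<bar> + \<bar>N\<bar>) + 3 ^ n * 0)"
    proof (rule stab[of _ _ "\<lambda>t. \<zeta> t - \<xi> t", OF _ _ _ t])
      show "approx_solution \<alpha> 1 a b (\<lambda>s t. Df s t (y s)) (\<bar>M\<bar> + \<bar>N\<bar>) 0 (\<lambda>t. \<zeta> t - \<xi> t)"
        unfolding approx_solution_def
      proof (intro allI impI)
      fix s t assume st: "a \<le> s" "s \<le> t" "t \<le> b"
      have "linear (Df s t (y s))"
        by (rule has_derivative_linear[OF f_deriv[OF st]])
      then have eq: "(\<zeta> t - \<xi> t) - (\<zeta> s - \<xi> s) - Df s t (y s) (\<zeta> s - \<xi> s) =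
          (\<zeta> t - \<zeta> s - Df s t (y s) (\<zeta> s)) - (\<xi> t - \<xi> s - Df s t (y s) (\<xi> s))"
        by (simp add: linear_diff)
      have "norm ((\<zeta> t - \<xi> t) - (\<zeta> s - \<xi> s) - Df s t (y s) (\<zeta> s - \<xi> s)) \<le> M * weight \<alpha> s t ^ 3 + N * weight \<alpha> s t ^ 3"
        using norm_triangle_ineq4[of "\<zeta> t - \<zeta> s - Df s t (y s) (\<zeta> s)" "\<xi> t - \<xi> s - Df s t (y s) (\<xi> s)"] \<zeta>[OF st] \<xi>[OF st]
        unfolding eq by linarith
      also have "\<dots> \<le> (\<bar>M\<bar> + \<bar>N\<bar>) * weight \<alpha> s t ^ 3"
        unfolding distrib_right by (intro add_mono mult_right_mono) auto
      finally show "norm ((\<zeta> t - \<xi> t) - (\<zeta> s - \<xi> s) - Df s t (y s) (\<zeta> s - \<xi> s))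
          \<le> (\<bar>M\<bar> + \<bar>N\<bar>) * weight \<alpha> s t ^ 3 + 0 * weight \<alpha> s t"
        by simp
      qed
    qed auto
    then show ?thesis using init by simp
  qed
  have "norm (\<zeta> t - \<xi> t) \<le> 0"
  proof (rule tendsto_lowerbound)
    have "(\<lambda>n. A * (\<rho> ^ n * (\<bar>M\<bar> + \<bar>N\<bar>))) \<longlonglongrightarrow> A * (0 * (\<bar>M\<bar> + \<bar>N\<bar>))"
      using A by (intro tendsto_intros LIMSEQ_power_zero) auto
    then show "(\<lambda>n. A * (\<rho> ^ n * (\<bar>M\<bar> + \<bar>N\<bar>))) \<longlonglongrightarrow> 0" by simp
  qed (use bound in auto)
  then show ?thesis by simp
qed

text \<open>The difference \<open>\<eta> k\<close> is compared with the linear combination of the differences \<open>\<eta> (\<tau> i)\<close> along basis vectors \<open>i\<close>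
that starts from the same vector \<open>k\<close>. Both are approximate solutions; the error of third
order in the weight is proportional to \<open>\<bar>k\<bar>\<close>, the one of first order to \<open>\<bar>k\<bar> \<tau>\<close>, so stability bounds their distance by
\<open>(\<rho>\<^sup>n + 3\<^sup>n \<tau>) \<bar>k\<bar>\<close> up to a constant; \<open>n\<close> is chosen before \<open>\<tau>\<close>.\<close>

theorem flow_differentiable:
  assumes fl: "\<And>z. flow_line (Y z)" and init: "\<And>z. Y z a = z" and t: "a \<le> t" "t \<le> b"
  shows "(\<lambda>z. Y z t) differentiable (at z0)"
proof (rule differentiable_of_approx_linear)
  fix e :: real assume "0 < e"
  obtain \<delta> K where \<delta>: "0 < \<delta>" and K: "0 \<le> K"
    and expansion: "\<And>y' y s t. flow_line y' \<Longrightarrow> flow_line y \<Longrightarrow> a \<le> s \<Longrightarrow> s \<le> t \<Longrightarrow> t \<le> b \<Longrightarrow> weight \<alpha> s t \<le> \<delta> \<Longrightarrow>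
      norm ((y' t - y t) - (y' s - y s) - Df s t (y s) (y' s - y s))
        \<le> K * norm (y' a - y a) * weight \<alpha> s t ^ 3 + K * (norm (y' a - y a))\<^sup>2 * weight \<alpha> s t"
    by (rule difference_expansion) (rule that)
  obtain A \<rho> where A: "0 \<le> A" and \<rho>: "\<rho> < 1" "0 \<le> \<rho>"
    and stab: "\<And>(\<zeta> :: real \<Rightarrow> 'e) (M :: real) (\<epsilon> :: real) n t. 0 \<le> M \<Longrightarrow> 0 \<le> \<epsilon> \<Longrightarrow>
      approx_solution \<alpha> \<delta> a b (\<lambda>s t. Df s t (Y z0 s)) M \<epsilon> \<zeta> \<Longrightarrow>
      a \<le> t \<Longrightarrow> t \<le> b \<Longrightarrow> norm (\<zeta> t) \<le> A * (norm (\<zeta> a) + \<rho> ^ n * M + 3 ^ n * \<epsilon>)"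
    by (rule variation_stability[OF fl[of z0] \<delta>]) (rule that)
  \<comment> \<open>The number of differences \<open>\<eta>\<close> that are combined below.\<close>
  define N where "N = 1 + real DIM('e)"
  have N: "1 \<le> N" by (simp add: N_def)
  have "(\<lambda>n. A * (K * N) * \<rho> ^ n) \<longlonglongrightarrow> A * (K * N) * 0"
    using \<rho> by (intro tendsto_intros LIMSEQ_power_zero) auto
  then have "\<forall>\<^sub>F n in sequentially. A * (K * N) * \<rho> ^ n < e / 2"
    using \<open>0 < e\<close> by (intro order_tendstoD(2)[of _ 0]) auto
  then obtain n where n: "A * (K * N) * \<rho> ^ n < e / 2"
    using eventually_happens' sequentially_bot by blast
  \<comment> \<open>With \<open>n\<close> fixed, \<open>\<tau>\<close> makes the linear error contribute the other half of \<open>e\<close>; it is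
    also the radius within which \<open>k\<close> is allowed to vary.\<close>
  define \<tau> where "\<tau> = e / (2 * (A * 3 ^ n * (K * N) + 1))"
  have D: "0 \<le> A * 3 ^ n * (K * N)"
    using A K N by simp
  then have \<tau>: "0 < \<tau>" "(A * 3 ^ n * (K * N)) * \<tau> \<le> e / 2"
    using \<open>0 < e\<close> by (auto simp: \<tau>_def field_simps)
  define \<eta> where "\<eta> k u = Y (z0 + k) u - Y z0 u" for k u
  define W where "W k = (\<Sum>i\<in>Basis. ((k \<bullet> i) / \<tau>) *\<^sub>R \<eta> (\<tau> *\<^sub>R i) t)" for k
  have E: "norm (\<eta> k t - \<eta> k s - Df s t (Y z0 s) (\<eta> k s)) \<le> K * norm k * weight \<alpha> s t ^ 3 + K * (norm k)\<^sup>2 * weight \<alpha> s t"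
    if "a \<le> s" "s \<le> t" "t \<le> b" "weight \<alpha> s t \<le> \<delta>" for k s t
    using expansion[OF fl fl that, of "z0 + k" z0] by (simp add: \<eta>_def init)
  have main: "norm (Y (z0 + k) t - Y z0 t - W k) \<le> e * norm k" if k: "norm k < \<tau>" for k
  proof -
    define \<zeta> where "\<zeta> u = \<eta> k u - (\<Sum>i\<in>Basis. ((k \<bullet> i) / \<tau>) *\<^sub>R \<eta> (\<tau> *\<^sub>R i) u)" for u
    have "norm (\<zeta> t) \<le> A * (norm (\<zeta> a) + \<rho> ^ n * (K * N * norm k) + 3 ^ n * (K * N * norm k * \<tau>))"
    proof (rule stab[OF _ _ _ t])
      show "approx_solution \<alpha> \<delta> a b (\<lambda>s t. Df s t (Y z0 s)) (K * N * norm k) (K * N * norm k * \<tau>) \<zeta>"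
        unfolding approx_solution_def
      proof (intro allI impI)
      fix s t assume st: "a \<le> s" "s \<le> t" "t \<le> b" "weight \<alpha> s t \<le> \<delta>"
      have lin: "linear (Df s t (Y z0 s))"
        by (rule has_derivative_linear[OF f_deriv[OF st(1-3)]])
      define w where "w = weight \<alpha> s t"
      have w: "0 \<le> w" by (simp add: w_def)
      define E where "E k = \<eta> k t - \<eta> k s - Df s t (Y z0 s) (\<eta> k s)" for k
      have "\<zeta> t - \<zeta> s - Df s t (Y z0 s) (\<zeta> s) = E k - (\<Sum>i\<in>Basis. ((k \<bullet> i) / \<tau>) *\<^sub>R E (\<tau> *\<^sub>R i))"
        by (simp add: \<zeta>_def E_def linear_diff[OF lin] linear_sum[OF lin] linear_scale[OF lin]
            scaleR_diff_right sum_subtractf)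
      then have "norm (\<zeta> t - \<zeta> s - Df s t (Y z0 s) (\<zeta> s)) \<le> norm (E k) + norm (\<Sum>i\<in>Basis. ((k \<bullet> i) / \<tau>) *\<^sub>R E (\<tau> *\<^sub>R i))"
        by (simp only: norm_triangle_ineq4)
      also have "norm (\<Sum>i\<in>Basis. ((k \<bullet> i) / \<tau>) *\<^sub>R E (\<tau> *\<^sub>R i)) \<le> (\<Sum>i\<in>(Basis :: 'e set). K * norm k * w ^ 3 + K * norm k * \<tau> * w)"
      proof (rule sum_norm_le)
        fix i :: 'e assume i: "i \<in> Basis"
        have "norm (((k \<bullet> i) / \<tau>) *\<^sub>R E (\<tau> *\<^sub>R i)) = \<bar>k \<bullet> i\<bar> / \<tau> * norm (E (\<tau> *\<^sub>R i))"
          using \<tau>(1) by simp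
        also have "\<dots> \<le> norm k / \<tau> * (K * \<tau> * w ^ 3 + K * \<tau>\<^sup>2 * w)"
        proof (intro mult_mono divide_right_mono)
          show "\<bar>k \<bullet> i\<bar> \<le> norm k"
            using i by (rule Basis_le_norm)
          show "norm (E (\<tau> *\<^sub>R i)) \<le> K * \<tau> * w ^ 3 + K * \<tau>\<^sup>2 * w"
            using E[OF st, of "\<tau> *\<^sub>R i"] i \<tau>(1) by (simp add: E_def w_def)
        qed (use \<tau>(1) in auto)
        also have "\<dots> = K * norm k * w ^ 3 + K * norm k * \<tau> * w"
          using \<tau>(1) by (simp add: field_simps power2_eq_square)
        finally show "norm (((k \<bullet> i) / \<tau>) *\<^sub>R E (\<tau> *\<^sub>R i)) \<le> K * norm k * w ^ 3 + K * norm k * \<tau> * w" .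
      qed
      also have "norm (E k) \<le> K * norm k * w ^ 3 + K * norm k * \<tau> * w"
      proof -
        have "K * (norm k)\<^sup>2 * w \<le> K * norm k * \<tau> * w"
          using k K w by (simp add: power2_eq_square mult_left_mono mult_right_mono mult.assoc)
        then show ?thesis
          using E[OF st, of k] by (simp add: E_def w_def)
      qed
      finally show "norm (\<zeta> t - \<zeta> s - Df s t (Y z0 s) (\<zeta> s))
          \<le> (K * N * norm k) * weight \<alpha> s t ^ 3 + (K * N * norm k * \<tau>) * weight \<alpha> s t"
        by (simp add: w_def N_def algebra_simps)
      qed
    qed (use K N \<tau> in auto)
    also have "\<zeta> a = 0"
      using \<tau>(1) by (simp add: \<zeta>_def \<eta>_def init euclidean_representation)
    also have "A * (norm (0 :: 'e) + \<rho> ^ n * (K * N * norm k) + 3 ^ n * (K * N * norm k * \<tau>))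
        = (A * (K * N) * \<rho> ^ n + A * 3 ^ n * (K * N) * \<tau>) * norm k"
      by (simp add: algebra_simps)
    also have "\<dots> \<le> e * norm k"
      using n \<tau>(2) by (intro mult_right_mono) auto
    finally show ?thesis
      by (simp add: \<zeta>_def W_def \<eta>_def)
  qed
  have "bounded_linear W"
    unfolding W_def by (intro bounded_linear_sum bounded_linear_scaleR_const
        bounded_linear_compose[OF bounded_linear_divide] bounded_linear_inner_left)
  then show "\<exists>W r. bounded_linear W \<and> 0 < r \<and>
      (\<forall>k. norm k < r \<longrightarrow> norm (Y (z0 + k) t - Y z0 t - W k) \<le> e * norm k)"
    using \<tau>(1) main by blast
qed

text \<open>In the expansion of a difference quotient with step \<open>\<tau>\<close> the error linear in the weight carries a factor \<open>\<tau>\<close> and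
disappears in the limit. The expansion is only available for intervals of weight at most \<open>\<delta>\<close>; for the
others the left-hand side is bounded and the weight is bounded below.\<close>

theorem derivative_solves_linearized:
  assumes fl: "\<And>z. flow_line (Y z)" and init: "\<And>z. Y z a = z"
    and deriv: "\<And>t. a \<le> t \<Longrightarrow> t \<le> b \<Longrightarrow> ((\<lambda>z. Y z t) has_derivative D t) (at z0)"
  obtains M where "\<And>s t. a \<le> s \<Longrightarrow> s \<le> t \<Longrightarrow> t \<le> b \<Longrightarrow>
    norm (D t v - D s v - Df s t (Y z0 s) (D s v)) \<le> M * weight \<alpha> s t ^ 3"
proof -
  obtain \<delta> K where \<delta>: "0 < \<delta>" and K: "0 \<le> K"
    and expansion: "\<And>y' y s t. flow_line y' \<Longrightarrow> flow_line y \<Longrightarrow> a \<le> s \<Longrightarrow> s \<le> t \<Longrightarrow> t \<le> b \<Longrightarrow> weight \<alpha> s t \<le> \<delta> \<Longrightarrow>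
      norm ((y' t - y t) - (y' s - y s) - Df s t (y s) (y' s - y s))
        \<le> K * norm (y' a - y a) * weight \<alpha> s t ^ 3 + K * (norm (y' a - y a))\<^sup>2 * weight \<alpha> s t"
    by (rule difference_expansion) (rule that)
  obtain A where A: "1 \<le> A" and lip: "\<And>y' y t. flow_line y' \<Longrightarrow> flow_line y \<Longrightarrow> a \<le> t \<Longrightarrow> t \<le> b \<Longrightarrow>
    norm (y' t - y t) \<le> A * norm (y' a - y a)"
    by (rule global_lipschitz) (rule that)
  have D_bound: "norm (D t v) \<le> A * norm v" if "a \<le> t" "t \<le> b" for t
    by (rule derivative_bound_of_lipschitz[OF deriv[OF that]]) (use lip[OF fl fl that] init in auto)
  define q where "q t \<tau> = (Y (z0 + \<tau> *\<^sub>R v) t - Y z0 t) /\<^sub>R \<tau>" for t \<tau>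
  have q: "(q t \<longlongrightarrow> D t v) (at 0)" if "a \<le> t" "t \<le> b" for t
    unfolding q_def by (rule has_derivative_tendsto_quotient[OF deriv[OF that]])
  have near: "norm (D t v - D s v - Df s t (Y z0 s) (D s v)) \<le> K * norm v * weight \<alpha> s t ^ 3"
    if st: "a \<le> s" "s \<le> t" "t \<le> b" "weight \<alpha> s t \<le> \<delta>" for s t
  proof (rule tendsto_le)
    have blin: "bounded_linear (Df s t (Y z0 s))"
      by (rule has_derivative_bounded_linear[OF f_deriv[OF st(1-3)]])
    show "((\<lambda>\<tau>. norm (q t \<tau> - q s \<tau> - Df s t (Y z0 s) (q s \<tau>)))
        \<longlongrightarrow> norm (D t v - D s v - Df s t (Y z0 s) (D s v))) (at 0)"
      using st by (intro tendsto_norm tendsto_diff q bounded_linear.tendsto[OF blin]) auto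
    have "((\<lambda>\<tau>. K * norm v * weight \<alpha> s t ^ 3 + \<bar>\<tau>\<bar> * (K * (norm v)\<^sup>2 * weight \<alpha> s t))
        \<longlongrightarrow> K * norm v * weight \<alpha> s t ^ 3 + \<bar>0\<bar> * (K * (norm v)\<^sup>2 * weight \<alpha> s t)) (at 0)"
      by (intro tendsto_intros)
    then show "((\<lambda>\<tau>. K * norm v * weight \<alpha> s t ^ 3 + \<bar>\<tau>\<bar> * (K * (norm v)\<^sup>2 * weight \<alpha> s t))
        \<longlongrightarrow> K * norm v * weight \<alpha> s t ^ 3) (at 0)"
      by simp
    have "norm (q t \<tau> - q s \<tau> - Df s t (Y z0 s) (q s \<tau>))
        \<le> K * norm v * weight \<alpha> s t ^ 3 + \<bar>\<tau>\<bar> * (K * (norm v)\<^sup>2 * weight \<alpha> s t)" if "\<tau> \<noteq> 0" for \<tau>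
    proof -
      define \<eta> where "\<eta> u = Y (z0 + \<tau> *\<^sub>R v) u - Y z0 u" for u
      have "q t \<tau> - q s \<tau> - Df s t (Y z0 s) (q s \<tau>) = (\<eta> t - \<eta> s - Df s t (Y z0 s) (\<eta> s)) /\<^sub>R \<tau>"
      proof -
        have "q u \<tau> = \<eta> u /\<^sub>R \<tau>" for u
          by (simp add: q_def \<eta>_def)
        then show ?thesis
          using linear_scale[OF bounded_linear.linear[OF blin]] by (simp add: scaleR_diff_right)
      qed
      then have "norm (q t \<tau> - q s \<tau> - Df s t (Y z0 s) (q s \<tau>)) = norm (\<eta> t - \<eta> s - Df s t (Y z0 s) (\<eta> s)) / \<bar>\<tau>\<bar>"
        by (simp add: divide_inverse_commute)
      also have "\<dots> \<le> (K * (\<bar>\<tau>\<bar> * norm v) * weight \<alpha> s t ^ 3 + K * (\<bar>\<tau>\<bar> * norm v)\<^sup>2 * weight \<alpha> s t) / \<bar>\<tau>\<bar>"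
        using expansion[OF fl fl st, of "z0 + \<tau> *\<^sub>R v" z0] by (intro divide_right_mono) (auto simp: \<eta>_def init)
      also have "\<dots> = K * norm v * weight \<alpha> s t ^ 3 + \<bar>\<tau>\<bar> * (K * (norm v)\<^sup>2 * weight \<alpha> s t)"
        using that by (simp add: add_divide_distrib power2_eq_square)
      finally show ?thesis .
    qed
    then show "\<forall>\<^sub>F \<tau> in at 0. norm (q t \<tau> - q s \<tau> - Df s t (Y z0 s) (q s \<tau>))
        \<le> K * norm v * weight \<alpha> s t ^ 3 + \<bar>\<tau>\<bar> * (K * (norm v)\<^sup>2 * weight \<alpha> s t)"
      by (simp add: eventually_at_filter)
  qed simp
  define B where "B = A * norm v + A * norm v + C * weight \<alpha> a b * (A * norm v)"
  have "0 \<le> B" using A C_ge_1 by (simp add: B_def)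
  have far: "norm (D t v - D s v - Df s t (Y z0 s) (D s v)) \<le> B / \<delta> ^ 3 * weight \<alpha> s t ^ 3"
    if st: "a \<le> s" "s \<le> t" "t \<le> b" "\<delta> \<le> weight \<alpha> s t" for s t
  proof -
    have "norm (Df s t (Y z0 s) (D s v)) \<le> C * weight \<alpha> s t * norm (D s v)"
      by (intro Df_bound st)
    also have "\<dots> \<le> C * weight \<alpha> a b * (A * norm v)"
      using C_ge_1 st D_bound[of s] weight_mono[OF exponent_pos(2), of a s t b] by (intro mult_mono) auto
    finally have "norm (D t v - D s v - Df s t (Y z0 s) (D s v)) \<le> B"
      using norm_triangle_ineq4[of "D t v - D s v" "Df s t (Y z0 s) (D s v)"] norm_triangle_ineq4[of "D t v" "D s v"]
        D_bound[of s] D_bound[of t] st by (simp add: B_def)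
    also have "B = B / \<delta> ^ 3 * \<delta> ^ 3"
      using \<delta> by simp
    also have "\<dots> \<le> B / \<delta> ^ 3 * weight \<alpha> s t ^ 3"
      using \<delta> st \<open>0 \<le> B\<close> by (intro mult_left_mono power_mono) auto
    finally show ?thesis .
  qed
  show thesis
  proof (rule that[of "max (K * norm v) (B / \<delta> ^ 3)"])
    fix s t assume st: "a \<le> s" "s \<le> t" "t \<le> b"
    have "norm (D t v - D s v - Df s t (Y z0 s) (D s v)) \<le> max (K * norm v * weight \<alpha> s t ^ 3) (B / \<delta> ^ 3 * weight \<alpha> s t ^ 3)"
      using near[OF st] far[OF st] by linarith
    also have "\<dots> \<le> max (K * norm v) (B / \<delta> ^ 3) * weight \<alpha> s t ^ 3"
      by (intro max.boundedI mult_right_mono) auto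
    finally show "norm (D t v - D s v - Df s t (Y z0 s) (D s v)) \<le> max (K * norm v) (B / \<delta> ^ 3) * weight \<alpha> s t ^ 3" .
  qed
qed

end

section \<open>Partitions and the rough integral\<close>

lemma intervals_append:
  assumes "p \<noteq> []" "q \<noteq> []" "last p = hd q"
  shows "intervals (p @ tl q) = intervals p @ intervals q"
  using assms
proof (induction p rule: list_nonempty_induct)
  case (single u)
  then show ?case
    by (cases q) (auto simp: intervals_def)
next
  case (cons u p)
  then show ?case
    by (cases p) (auto simp: intervals_def)
qed

lemma interval_bounds:
  assumes "sorted_wrt (<) p" "(u, v) \<in> set (intervals p)"
  shows "hd p \<le> u \<and> u < v \<and> v \<le> last (p :: real list)"
  using assms
proof (induction p)
  case (Cons w p)
  show ?case
  proof (cases p)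
    case Nil
    then show ?thesis using Cons.prems by (simp add: intervals_def)
  next
    case (Cons w' q)
    have "(u, v) = (w, w') \<or> (u, v) \<in> set (intervals p)"
      using Cons.prems(2) Cons by (auto simp: intervals_def)
    moreover have "w < w'"
      using Cons.prems(1) Cons by auto
    moreover have "w' \<le> last p"
      using Cons.prems(1) Cons last_in_set[of q] by (cases "q = []") (auto intro: less_imp_le)
    ultimately show ?thesis
      using Cons.IH Cons.prems(1) Cons by auto
  qed
qed (simp add: intervals_def)

lemma partition_of_append:
  assumes p: "partition_of s u p" and q: "partition_of u t q"
  shows "partition_of s t (p @ tl q)"
proof -
  obtain q' where q': "q = u # q'"
    using q by (cases q) (auto simp: partition_of_def)
  obtain p' where p': "p = p' @ [u]"
    using p by (cases p rule: rev_cases) (auto simp: partition_of_def)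
  have "sorted_wrt (<) (p' @ u # q')"
    using p q by (auto simp: p' q' partition_of_def sorted_wrt_append)
      (meson less_trans)+
  then show ?thesis
    using p q by (auto simp: p' q' partition_of_def hd_append split: if_splits)
qed

text \<open>Along dyadic partitions the sewing estimate is an induction on the level, and they suffice to identify the
limit of the compensated sums.\<close>

fun dyadic :: "nat \<Rightarrow> real \<Rightarrow> real \<Rightarrow> real list" where
  "dyadic 0 s t = [s, t]"
| "dyadic (Suc n) s t = dyadic n s ((s + t) / 2) @ tl (dyadic n ((s + t) / 2) t)"

fun dyadic_sum :: "(real \<Rightarrow> real \<Rightarrow> 'w::real_normed_vector) \<Rightarrow> nat \<Rightarrow> real \<Rightarrow> real \<Rightarrow> 'w" where
  "dyadic_sum G 0 s t = G s t"
| "dyadic_sum G (Suc n) s t = dyadic_sum G n s ((s + t) / 2) + dyadic_sum G n ((s + t) / 2) t"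

lemma partition_of_dyadic:
  "s < t \<Longrightarrow> partition_of s t (dyadic n s t)"
proof (induction n arbitrary: s t)
  case 0
  then show ?case by (simp add: partition_of_def)
next
  case (Suc n)
  then show ?case
    by (auto intro!: partition_of_append[where u = "(s + t) / 2"])
qed

lemma intervals_dyadic_Suc:
  assumes "s < t"
  shows "intervals (dyadic (Suc n) s t) =
    intervals (dyadic n s ((s + t) / 2)) @ intervals (dyadic n ((s + t) / 2) t)"
proof -
  have "partition_of s ((s + t) / 2) (dyadic n s ((s + t) / 2))"
    "partition_of ((s + t) / 2) t (dyadic n ((s + t) / 2) t)"
    using assms by (intro partition_of_dyadic; simp)+
  then show ?thesis
    by (simp add: intervals_append partition_of_def)
qed

lemma dyadic_mesh:
  "s < t \<Longrightarrow> (u, v) \<in> set (intervals (dyadic n s t)) \<Longrightarrow> v - u \<le> (t - s) / 2 ^ n"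
proof (induction n arbitrary: s t)
  case 0
  then show ?case by (simp add: intervals_def)
next
  case (Suc n)
  have "(t - s) / 2 ^ Suc n = ((s + t) / 2 - s) / 2 ^ n" "(t - s) / 2 ^ Suc n = (t - (s + t) / 2) / 2 ^ n"
    by (simp_all add: field_simps)
  then show ?case
    using Suc.IH[of s "(s + t) / 2"] Suc.IH[of "(s + t) / 2" t] Suc.prems
    unfolding intervals_dyadic_Suc[OF Suc.prems(1)] by auto
qed

lemma sum_dyadic:
  "s < t \<Longrightarrow> (\<Sum>(u, v)\<leftarrow>intervals (dyadic n s t). G u v) = dyadic_sum G n s t"
proof (induction n arbitrary: s t)
  case 0
  then show ?case by (simp add: intervals_def)
next
  case (Suc n)
  then show ?case
    unfolding intervals_dyadic_Suc[OF Suc.prems] by simp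
qed

text \<open>The bound \<open>c w\<^sup>3\<close> for both halves plus \<open>\<bar>K\<bar> w\<^sup>3\<close> for the defect is again \<open>c w\<^sup>3\<close>; the constant is the
solution of \<open>2 q\<^sup>3 c + \<bar>K\<bar> = c\<close>, where \<open>q\<close> is the factor by which the weight shrinks.\<close>

lemma dyadic_sum_close:
  assumes exponent: "1/3 < \<alpha>"
    and defect: "\<And>s m t. a \<le> s \<Longrightarrow> s \<le> m \<Longrightarrow> m \<le> t \<Longrightarrow> t \<le> b \<Longrightarrow>
      norm (G s m + G m t - G s t) \<le> K * weight \<alpha> s t ^ 3"
    and st: "a \<le> s" "s \<le> t" "t \<le> b"
  shows "norm (dyadic_sum G n s t - G s t) \<le> \<bar>K\<bar> / (1 - 2 * ((1/2) powr \<alpha>) ^ 3) * weight \<alpha> s t ^ 3"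
  using st
proof (induction n arbitrary: s t)
  case 0
  then show ?case
    using halving_cube[OF exponent] by simp
next
  case (Suc n)
  define q where "q = (1/2::real) powr \<alpha>"
  define c where "c = \<bar>K\<bar> / (1 - 2 * q ^ 3)"
  define m where "m = (s + t) / 2"
  have m: "s \<le> m" "m \<le> t" using Suc.prems by (simp_all add: m_def)
  define d where "d = weight \<alpha> s t"
  have d: "0 \<le> d" by (simp add: d_def)
  have weight_m: "weight \<alpha> s m = q * d" "weight \<alpha> m t = q * d"
    using weight_midpoint[OF Suc.prems(2)] by (simp_all add: q_def m_def d_def)
  have "norm (dyadic_sum G n s m - G s m) \<le> c * (q * d) ^ 3" "norm (dyadic_sum G n m t - G m t) \<le> c * (q * d) ^ 3"
    using Suc.IH[of s m] Suc.IH[of m t] Suc.prems m by (simp_all add: c_def q_def weight_m[unfolded q_def])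
  moreover have "norm (G s m + G m t - G s t) \<le> \<bar>K\<bar> * d ^ 3"
    using defect[OF Suc.prems(1) m Suc.prems(3)] mult_right_mono[OF abs_ge_self[of K], of "d ^ 3"] d
    by (simp add: d_def)
  moreover have "dyadic_sum G (Suc n) s t - G s t =
      (dyadic_sum G n s m - G s m) + (dyadic_sum G n m t - G m t) + (G s m + G m t - G s t)"
    by (simp add: m_def)
  ultimately have "norm (dyadic_sum G (Suc n) s t - G s t) \<le> c * (q * d) ^ 3 + c * (q * d) ^ 3 + \<bar>K\<bar> * d ^ 3"
    by (simp only:) (intro norm_triangle_mono)
  also have "\<dots> = (2 * q ^ 3 * c + \<bar>K\<bar>) * d ^ 3"
    by (simp add: algebra_simps power_mult_distrib)
  also have "2 * q ^ 3 * c + \<bar>K\<bar> = c"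
    using halving_cube[OF exponent] by (simp add: c_def q_def[symmetric] field_simps)
  finally show ?case
    by (simp add: c_def q_def d_def)
qed

lemma filterlim_mesh_to_0:
  assumes "\<And>n. partition_of s t (P n)"
    and mesh: "\<And>n u v. (u, v) \<in> set (intervals (P n)) \<Longrightarrow> v - u \<le> c / 2 ^ n"
  shows "filterlim P (mesh_to_0 s t) sequentially"
  unfolding mesh_to_0_def filterlim_INF filterlim_principal
proof
  fix \<delta> :: real assume "\<delta> \<in> {0<..}"
  have "(\<lambda>n. c * (1/2) ^ n) \<longlonglongrightarrow> c * 0"
    by (intro tendsto_intros LIMSEQ_power_zero) auto
  then have "\<forall>\<^sub>F n in sequentially. c * (1/2) ^ n < \<delta>"
    using \<open>\<delta> \<in> {0<..}\<close> by (intro order_tendstoD(2)[of _ 0]) auto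
  then show "\<forall>\<^sub>F n in sequentially. P n \<in> {p. partition_of s t p \<and> (\<forall>(u, v)\<in>set (intervals p). v - u < \<delta>)}"
  proof (rule eventually_mono)
    fix n assume "c * (1/2) ^ n < \<delta>"
    then have "c / 2 ^ n < \<delta>"
      by (simp add: power_divide)
    then show "P n \<in> {p. partition_of s t p \<and> (\<forall>(u, v)\<in>set (intervals p). v - u < \<delta>)}"
      using assms(1) mesh[of _ _ n] by fastforce
  qed
qed

text \<open>The summand of the compensated Riemann sums that define the rough integral.\<close>

definition germ ::
    "(real \<Rightarrow> real ^ 'm) \<Rightarrow> (real \<Rightarrow> real \<Rightarrow> real ^ 'm ^ 'm) \<Rightarrow>
     (real \<Rightarrow> ((real ^ 'm) \<Rightarrow>\<^sub>L 'w::real_normed_vector)) \<Rightarrow>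
     (real \<Rightarrow> ((real ^ 'm) \<Rightarrow>\<^sub>L ((real ^ 'm) \<Rightarrow>\<^sub>L 'w))) \<Rightarrow> real \<Rightarrow> real \<Rightarrow> 'w" where
  "germ x X Y Y' s t = Y s (x t - x s) + tensor_apply (Y' s) (X s t)"

lemma has_rough_integral_germ:
  "has_rough_integral x X s t Y Y' J \<longleftrightarrow>
     ((\<lambda>p. \<Sum>(u, v)\<leftarrow>intervals p. germ x X Y Y' u v) \<longlongrightarrow> J) (mesh_to_0 s t)"
  by (simp add: has_rough_integral_def germ_def)

text \<open>The hypothesis concerns integrals from \<open>a\<close> only. The sums over dyadic partitions of \<open>[s, t]\<close> still converge, to the
increment of \<open>z\<close>, since they can be continued by dyadic partitions of \<open>[a, s]\<close> to partitions of \<open>[a, t]\<close>.\<close>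

lemma integral_imp_expansion:
  fixes z :: "real \<Rightarrow> 'w::real_normed_vector"
  assumes exponent: "1/3 < \<alpha>"
    and integral: "\<And>t. a \<le> t \<Longrightarrow> t \<le> b \<Longrightarrow> has_rough_integral x X a t Y Y' (z t - z a)"
    and defect: "\<And>s m t. a \<le> s \<Longrightarrow> s \<le> m \<Longrightarrow> m \<le> t \<Longrightarrow> t \<le> b \<Longrightarrow>
      norm (germ x X Y Y' s m + germ x X Y Y' m t - germ x X Y Y' s t) \<le> K * weight \<alpha> s t ^ 3"
    and diagonal: "\<And>s. a \<le> s \<Longrightarrow> s \<le> b \<Longrightarrow> X s s = 0"
    and st: "a \<le> s" "s \<le> t" "t \<le> b"
  shows "norm (z t - z s - germ x X Y Y' s t) \<le> \<bar>K\<bar> / (1 - 2 * ((1/2) powr \<alpha>) ^ 3) * weight \<alpha> s t ^ 3"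
proof (cases "s = t")
  case True
  have "tensor_apply (Y' t) 0 = 0"
    by (simp add: tensor_apply_def)
  then show ?thesis
    using True diagonal[of t] st by (simp add: germ_def)
next
  case False
  then have "s < t" using st by simp
  define G where "G = germ x X Y Y'"
  have from_a: "(\<lambda>n. dyadic_sum G n a u) \<longlonglongrightarrow> z u - z a" if "a < u" "u \<le> b" for u
  proof -
    have "filterlim (\<lambda>n. dyadic n a u) (mesh_to_0 a u) sequentially"
      using that by (intro filterlim_mesh_to_0[where c = "u - a"] partition_of_dyadic dyadic_mesh) auto
    from filterlim_compose[OF integral[of u, unfolded has_rough_integral_germ] this] show ?thesis
      using that by (simp add: sum_dyadic G_def)
  qed
  have "(\<lambda>n. dyadic_sum G n s t) \<longlonglongrightarrow> z t - z s"
  proof (cases "s = a")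
    case True
    then show ?thesis using from_a[of t] \<open>s < t\<close> st by simp
  next
    case False
    then have "a < s" using st by simp
    define P where "P n = dyadic n a s @ tl (dyadic n s t)" for n
    have parts: "partition_of a s (dyadic n a s)" "partition_of s t (dyadic n s t)" for n
      using \<open>a < s\<close> \<open>s < t\<close> by (simp_all add: partition_of_dyadic)
    have intervals_P: "intervals (P n) = intervals (dyadic n a s) @ intervals (dyadic n s t)" for n
      unfolding P_def using parts[of n] by (intro intervals_append) (auto simp: partition_of_def)
    have "filterlim P (mesh_to_0 a t) sequentially"
    proof (rule filterlim_mesh_to_0)
      show "partition_of a t (P n)" for n
        unfolding P_def by (rule partition_of_append) (rule parts)+
      show "v - u \<le> (t - a) / 2 ^ n" if "(u, v) \<in> set (intervals (P n))" for n u v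
      proof -
        have "v - u \<le> (s - a) / 2 ^ n \<or> v - u \<le> (t - s) / 2 ^ n"
          using that dyadic_mesh[OF \<open>a < s\<close>, of u v n] dyadic_mesh[OF \<open>s < t\<close>, of u v n]
          by (auto simp: intervals_P)
        moreover have "(s - a) / 2 ^ n \<le> (t - a) / 2 ^ n" "(t - s) / 2 ^ n \<le> (t - a) / 2 ^ n"
          using st by (auto intro!: divide_right_mono)
        ultimately show ?thesis by linarith
      qed
    qed
    from filterlim_compose[OF integral[of t, unfolded has_rough_integral_germ] this]
    have "(\<lambda>n. dyadic_sum G n a s + dyadic_sum G n s t) \<longlonglongrightarrow> z t - z a"
      using st by (simp add: intervals_P sum_dyadic[OF \<open>a < s\<close>] sum_dyadic[OF \<open>s < t\<close>] G_def)
    from tendsto_diff[OF this from_a[OF \<open>a < s\<close>]] show ?thesis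
      using st by simp
  qed
  then have "(\<lambda>n. norm (dyadic_sum G n s t - G s t)) \<longlonglongrightarrow> norm (z t - z s - G s t)"
    by (intro tendsto_intros)
  then show ?thesis
    unfolding G_def[symmetric]
  proof (rule tendsto_upperbound)
    show "\<forall>\<^sub>F n in sequentially. norm (dyadic_sum G n s t - G s t)
        \<le> \<bar>K\<bar> / (1 - 2 * ((1/2) powr \<alpha>) ^ 3) * weight \<alpha> s t ^ 3"
      using dyadic_sum_close[OF exponent, of a b G K] defect st by (simp add: G_def)
  qed simp
qed

lemma telescoping_error:
  fixes z :: "real \<Rightarrow> 'w::real_normed_vector"
  assumes "p \<noteq> []" "\<And>u v. (u, v) \<in> set (intervals p) \<Longrightarrow> norm (z v - z u - G u v) \<le> c * (v - u)"
  shows "norm ((\<Sum>(u, v)\<leftarrow>intervals p. G u v) - (z (last p) - z (hd p))) \<le> c * (last p - hd p)"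
  using assms
proof (induction p rule: list_nonempty_induct)
  case (single u)
  then show ?case by (simp add: intervals_def)
next
  case (cons u p)
  obtain v q where p: "p = v # q"
    using cons(1) by (cases p) auto
  have intervals: "intervals (u # p) = (u, v) # intervals p"
    by (simp add: intervals_def p)
  have "norm ((\<Sum>(u, v)\<leftarrow>intervals p. G u v) - (z (last p) - z (hd p))) \<le> c * (last p - hd p)"
    by (rule cons(2)) (use cons(3) in \<open>auto simp: intervals\<close>)
  moreover have "norm (z v - z u - G u v) \<le> c * (v - u)"
    using cons(3) by (auto simp: intervals)
  moreover have "(\<Sum>(u, v)\<leftarrow>intervals (u # p). G u v) - (z (last (u # p)) - z u) =
      ((\<Sum>(u, v)\<leftarrow>intervals p. G u v) - (z (last p) - z (hd p))) - (z v - z u - G u v)"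
    unfolding intervals by (simp add: p)
  ultimately have "norm ((\<Sum>(u, v)\<leftarrow>intervals (u # p). G u v) - (z (last (u # p)) - z u))
      \<le> c * (last p - hd p) + c * (v - u)"
    by (simp only:) (rule order.trans[OF norm_triangle_ineq4 add_mono])
  then show ?case
    by (simp add: p algebra_simps)
qed

text \<open>Increments of \<open>z\<close> telescope, and the errors of order \<open>(v - u)\<^sup>3\<^sup>\<alpha>\<close> sum up to at most a constant times the length of
the interval times the mesh to the power \<open>3\<alpha> - 1 > 0\<close>.\<close>

lemma expansion_imp_integral:
  fixes z :: "real \<Rightarrow> 'w::real_normed_vector"
  assumes exponent: "1/3 < \<alpha>"
    and expansion: "\<And>s t. a \<le> s \<Longrightarrow> s \<le> t \<Longrightarrow> t \<le> b \<Longrightarrow>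
      norm (z t - z s - germ x X Y Y' s t) \<le> K * weight \<alpha> s t ^ 3"
    and t: "a \<le> t" "t \<le> b"
  shows "has_rough_integral x X a t Y Y' (z t - z a)"
  unfolding has_rough_integral_germ
proof (rule tendstoI)
  fix e :: real assume "0 < e"
  define \<gamma> where "\<gamma> = 3 * \<alpha> - 1"
  \<comment> \<open>The summand \<open>1\<close> keeps \<open>k\<close> positive, and makes the final estimate strict.\<close>
  define k where "k = \<bar>K\<bar> * (t - a) + 1"
  define \<delta> where "\<delta> = (e / k) powr (1 / \<gamma>)"
  have pos: "0 < \<gamma>" "0 < k"
    using exponent t by (auto simp: \<gamma>_def k_def intro!: add_nonneg_pos)
  have \<delta>: "0 < \<delta>" "\<delta> powr \<gamma> = e / k"
    using pos \<open>0 < e\<close> by (simp_all add: \<delta>_def powr_powr)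
  have "dist (\<Sum>(u, v)\<leftarrow>intervals p. germ x X Y Y' u v) (z t - z a) < e"
    if p: "partition_of a t p" "\<forall>(u, v)\<in>set (intervals p). v - u < \<delta>" for p
  proof -
    have ends: "p \<noteq> []" "hd p = a" "last p = t" "sorted_wrt (<) p"
      using p by (auto simp: partition_of_def)
    have "norm ((\<Sum>(u, v)\<leftarrow>intervals p. germ x X Y Y' u v) - (z (last p) - z (hd p)))
        \<le> (\<bar>K\<bar> * (e / k)) * (last p - hd p)"
    proof (rule telescoping_error[OF ends(1)])
      fix u v assume uv: "(u, v) \<in> set (intervals p)"
      then have order: "a \<le> u" "u < v" "v \<le> t"
        using interval_bounds[OF ends(4) uv] ends by auto
      have "norm (z v - z u - germ x X Y Y' u v) \<le> K * weight \<alpha> u v ^ 3"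
        using order t by (intro expansion) auto
      also have "\<dots> \<le> \<bar>K\<bar> * weight \<alpha> u v ^ 3"
        by (intro mult_right_mono) auto
      also have "weight \<alpha> u v ^ 3 = (v - u) powr \<gamma> * (v - u)"
        using order by (simp add: weight_cube \<gamma>_def powr_diff)
      also have "\<dots> \<le> \<delta> powr \<gamma> * (v - u)"
        using order pos p(2) uv by (intro mult_right_mono powr_mono2) auto
      finally show "norm (z v - z u - germ x X Y Y' u v) \<le> (\<bar>K\<bar> * (e / k)) * (v - u)"
        using \<delta>(2) by (simp add: mult_left_mono mult.assoc)
    qed
    also have "(\<bar>K\<bar> * (e / k)) * (last p - hd p) = e * ((k - 1) / k)"
      by (simp add: ends k_def)
    also have "\<dots> < e * 1"
      using pos \<open>0 < e\<close> by (intro mult_strict_left_mono) auto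
    finally show ?thesis
      by (simp add: dist_norm ends)
  qed
  then have "\<forall>\<^sub>F p in principal {p. partition_of a t p \<and> (\<forall>(u, v)\<in>set (intervals p). v - u < \<delta>)}.
      dist (\<Sum>(u, v)\<leftarrow>intervals p. germ x X Y Y' u v) (z t - z a) < e"
    by (auto simp: eventually_principal)
  then show "\<forall>\<^sub>F p in mesh_to_0 a t. dist (\<Sum>(u, v)\<leftarrow>intervals p. germ x X Y Y' u v) (z t - z a) < e"
    unfolding mesh_to_0_def using \<delta>(1) by (intro eventually_INF1[of \<delta>]) auto
qed

section \<open>Controlled paths\<close>

lemma hoelder_path_iff:
  "hoelder_path \<alpha> {a..b} y \<longleftrightarrow> (\<exists>C. \<forall>s t. a \<le> s \<longrightarrow> s \<le> t \<longrightarrow> t \<le> b \<longrightarrow> norm (y t - y s) \<le> C * weight \<alpha> s t)"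
proof
  assume "hoelder_path \<alpha> {a..b} y"
  then obtain C where "\<forall>s\<in>{a..b}. \<forall>t\<in>{a..b}. norm (y t - y s) \<le> C * \<bar>t - s\<bar> powr \<alpha>"
    by (auto simp: hoelder_path_def)
  then show "\<exists>C. \<forall>s t. a \<le> s \<longrightarrow> s \<le> t \<longrightarrow> t \<le> b \<longrightarrow> norm (y t - y s) \<le> C * weight \<alpha> s t"
  proof (intro exI[of _ C] allI impI)
    fix s t assume *: "\<forall>s\<in>{a..b}. \<forall>t\<in>{a..b}. norm (y t - y s) \<le> C * \<bar>t - s\<bar> powr \<alpha>"
      and st: "a \<le> s" "s \<le> t" "t \<le> b"
    show "norm (y t - y s) \<le> C * weight \<alpha> s t"
      using *[rule_format, of s t] st by (simp add: weight_def)
  qed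
next
  assume "\<exists>C. \<forall>s t. a \<le> s \<longrightarrow> s \<le> t \<longrightarrow> t \<le> b \<longrightarrow> norm (y t - y s) \<le> C * weight \<alpha> s t"
  then obtain C where C: "\<And>s t. a \<le> s \<Longrightarrow> s \<le> t \<Longrightarrow> t \<le> b \<Longrightarrow> norm (y t - y s) \<le> C * weight \<alpha> s t"
    by blast
  have "norm (y t - y s) \<le> C * \<bar>t - s\<bar> powr \<alpha>" if "s \<in> {a..b}" "t \<in> {a..b}" for s t
    using C[of s t] C[of t s] that by (cases "s \<le> t") (auto simp: weight_def norm_minus_commute)
  then show "hoelder_path \<alpha> {a..b} y"
    unfolding hoelder_path_def by blast
qed

lemma hoelder_path_continuous:
  assumes "hoelder_path \<alpha> I y" "0 < \<alpha>"
  shows "continuous_on I y"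
proof -
  obtain C where C: "\<And>s t. s \<in> I \<Longrightarrow> t \<in> I \<Longrightarrow> norm (y t - y s) \<le> C * \<bar>t - s\<bar> powr \<alpha>"
    using assms by (auto simp: hoelder_path_def)
  show ?thesis
    unfolding continuous_on
  proof
    fix s assume "s \<in> I"
    have "((\<lambda>t. C * \<bar>t - s\<bar> powr \<alpha>) \<longlongrightarrow> C * \<bar>s - s\<bar> powr \<alpha>) (at s within I)"
      using \<open>0 < \<alpha>\<close> by (intro tendsto_mult_left tendsto_powr') (auto intro!: tendsto_eq_intros)
    then have "((\<lambda>t. C * \<bar>t - s\<bar> powr \<alpha>) \<longlongrightarrow> 0) (at s within I)"
      by simp
    then have "((\<lambda>t. y t - y s) \<longlongrightarrow> 0) (at s within I)"
      by (rule Lim_null_comparison[rotated]) (use C \<open>s \<in> I\<close> in \<open>auto simp: eventually_at_filter\<close>)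
    then show "(y \<longlongrightarrow> y s) (at s within I)"
      by (simp add: LIM_zero_iff)
  qed
qed

lemma controlled_path_bounds:
  assumes "controlled_path \<alpha> x {a..b} y y'"
  obtains C where "0 \<le> C"
    "\<And>s t. a \<le> s \<Longrightarrow> s \<le> t \<Longrightarrow> t \<le> b \<Longrightarrow> norm (y t - y s) \<le> C * weight \<alpha> s t"
    "\<And>s t. a \<le> s \<Longrightarrow> s \<le> t \<Longrightarrow> t \<le> b \<Longrightarrow> norm (y' t - y' s) \<le> C * weight \<alpha> s t"
    "\<And>s t. a \<le> s \<Longrightarrow> s \<le> t \<Longrightarrow> t \<le> b \<Longrightarrow>
      norm (y t - y s - y' s (x t - x s)) \<le> C * (weight \<alpha> s t)\<^sup>2"
proof -
  have hoelder: "hoelder_path \<alpha> {a..b} y" "hoelder_path \<alpha> {a..b} y'"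
    using assms by (simp_all add: controlled_path_def)
  obtain C1 where 1: "\<And>s t. a \<le> s \<Longrightarrow> s \<le> t \<Longrightarrow> t \<le> b \<Longrightarrow> norm (y t - y s) \<le> C1 * weight \<alpha> s t"
    using hoelder(1) unfolding hoelder_path_iff by blast
  obtain C2 where 2: "\<And>s t. a \<le> s \<Longrightarrow> s \<le> t \<Longrightarrow> t \<le> b \<Longrightarrow> norm (y' t - y' s) \<le> C2 * weight \<alpha> s t"
    using hoelder(2) unfolding hoelder_path_iff by blast
  obtain R C3 where R: "\<And>s t. a \<le> s \<Longrightarrow> s \<le> t \<Longrightarrow> t \<le> b \<Longrightarrow> y t - y s = y' s (x t - x s) + R s t"
    and C3: "\<And>s t. s \<in> {a..b} \<Longrightarrow> t \<in> {a..b} \<Longrightarrow> s < t \<Longrightarrow> norm (R s t) \<le> C3 * \<bar>t - s\<bar> powr (2 * \<alpha>)"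
    using assms by (fastforce simp: controlled_path_def hoelder2_def)
  have 3: "norm (y t - y s - y' s (x t - x s)) \<le> C3 * (weight \<alpha> s t)\<^sup>2" if "a \<le> s" "s \<le> t" "t \<le> b" for s t
    using R[OF that] C3[of s t] that by (cases "s = t") (auto simp: weight_square)
  define C where "C = \<bar>C1\<bar> + \<bar>C2\<bar> + \<bar>C3\<bar>"
  have C: "C1 * r \<le> C * r" "C2 * r \<le> C * r" "C3 * r \<le> C * r" if "0 \<le> r" for r
    using that by (intro mult_right_mono; simp add: C_def)+
  show thesis
  proof (rule that[of C])
    fix s t assume st: "a \<le> s" "s \<le> t" "t \<le> b"
    show "norm (y t - y s) \<le> C * weight \<alpha> s t"
      using 1[OF st] C(1)[of "weight \<alpha> s t"] by simp
    show "norm (y' t - y' s) \<le> C * weight \<alpha> s t"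
      using 2[OF st] C(2)[of "weight \<alpha> s t"] by simp
    show "norm (y t - y s - y' s (x t - x s)) \<le> C * (weight \<alpha> s t)\<^sup>2"
      using 3[OF st] C(3)[of "(weight \<alpha> s t)\<^sup>2"] by simp
  qed (simp add: C_def)
qed

lemma controlled_pathI:
  fixes y :: "real \<Rightarrow> 'w::real_normed_vector" and y' :: "real \<Rightarrow> (real ^ 'm) \<Rightarrow>\<^sub>L 'w"
  assumes "0 < \<alpha>"
    and 1: "\<And>s t. a \<le> s \<Longrightarrow> s \<le> t \<Longrightarrow> t \<le> b \<Longrightarrow> norm (y t - y s) \<le> C * weight \<alpha> s t"
    and 2: "\<And>s t. a \<le> s \<Longrightarrow> s \<le> t \<Longrightarrow> t \<le> b \<Longrightarrow> norm (y' t - y' s) \<le> C * weight \<alpha> s t"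
    and 3: "\<And>s t. a \<le> s \<Longrightarrow> s \<le> t \<Longrightarrow> t \<le> b \<Longrightarrow>
      norm (y t - y s - y' s (x t - x s)) \<le> C * (weight \<alpha> s t)\<^sup>2"
    and x: "continuous_on {a..b} x"
  shows "controlled_path \<alpha> x {a..b} y y'"
proof -
  have hoelder: "hoelder_path \<alpha> {a..b} y" "hoelder_path \<alpha> {a..b} y'"
    unfolding hoelder_path_iff using 1 2 by blast+
  note cont = hoelder_path_continuous[OF hoelder(1) \<open>0 < \<alpha>\<close>] hoelder_path_continuous[OF hoelder(2) \<open>0 < \<alpha>\<close>]
  define R where "R s t = y t - y s - y' s (x t - x s)" for s t
  have fst: "continuous_on ({a..b} \<times> {a..b}) (\<lambda>p. u (fst p))" "continuous_on ({a..b} \<times> {a..b}) (\<lambda>p. u (snd p))"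
    if "continuous_on {a..b} u" for u :: "real \<Rightarrow> 'c::topological_space"
    by (auto intro!: continuous_on_compose2[OF that] continuous_on_fst continuous_on_snd continuous_on_id)
  have "continuous_on ({a..b} \<times> {a..b}) (\<lambda>p. y (snd p) - y (fst p) - y' (fst p) (x (snd p) - x (fst p)))"
    by (intro continuous_on_diff blinfun.continuous_on fst cont x)
  then have "continuous_on ({a..b} \<times> {a..b}) (\<lambda>(s, t). R s t)"
    by (simp add: R_def case_prod_beta')
  then have "hoelder2 (2 * \<alpha>) {a..b} R"
    using 3 by (auto simp: hoelder2_def R_def weight_square intro!: exI[of _ C])
  then show ?thesis
    unfolding controlled_path_def using hoelder by (intro conjI exI[of _ R]) (auto simp: R_def)
qed

section \<open>Estimates for the germ\<close>

lemma bounded_bilinear_tensor_apply: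
  "bounded_bilinear (tensor_apply ::
    ((real ^ 'm) \<Rightarrow>\<^sub>L ((real ^ 'm) \<Rightarrow>\<^sub>L 'w::real_normed_vector)) \<Rightarrow> real ^ 'm ^ 'm \<Rightarrow> 'w)"
proof
  fix A A' :: "(real ^ 'm) \<Rightarrow>\<^sub>L ((real ^ 'm) \<Rightarrow>\<^sub>L 'w)" and M M' :: "real ^ 'm ^ 'm" and r :: real
  show "tensor_apply (A + A') M = tensor_apply A M + tensor_apply A' M"
    by (simp add: tensor_apply_def blinfun.add_left scaleR_add_right sum.distrib)
  show "tensor_apply A (M + M') = tensor_apply A M + tensor_apply A M'"
    by (simp add: tensor_apply_def scaleR_add_left sum.distrib)
  show "tensor_apply (r *\<^sub>R A) M = r *\<^sub>R tensor_apply A M"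
    by (simp add: tensor_apply_def blinfun.scaleR_left scaleR_sum_right mult.commute)
  show "tensor_apply A (r *\<^sub>R M) = r *\<^sub>R tensor_apply A M"
    by (simp add: tensor_apply_def scaleR_sum_right)
  show "\<exists>K. \<forall>(A :: (real ^ 'm) \<Rightarrow>\<^sub>L ((real ^ 'm) \<Rightarrow>\<^sub>L 'w)) M :: real ^ 'm ^ 'm.
      norm (tensor_apply A M) \<le> norm A * norm M * K"
  proof (intro exI allI)
    fix A :: "(real ^ 'm) \<Rightarrow>\<^sub>L ((real ^ 'm) \<Rightarrow>\<^sub>L 'w)" and M :: "real ^ 'm ^ 'm"
    have entry: "norm (M $ i $ j *\<^sub>R A (axis i 1) (axis j 1)) \<le> norm A * norm M" for i j
    proof -
      have "\<bar>M $ i $ j\<bar> \<le> norm M"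
        using Finite_Cartesian_Product.norm_nth_le[of "M $ i" j] Finite_Cartesian_Product.norm_nth_le[of M i] by simp
      moreover have "norm (A (axis i 1) (axis j 1)) \<le> norm A"
        using norm_blinfun[of "A (axis i 1)" "axis j 1"] norm_blinfun[of A "axis i 1"] by simp
      ultimately show ?thesis
        by (simp add: mult.commute[of "norm A"] mult_mono)
    qed
    have "norm (tensor_apply A M) \<le> (\<Sum>i\<in>(UNIV :: 'm set). \<Sum>j\<in>(UNIV :: 'm set). norm A * norm M)"
      unfolding tensor_apply_def by (intro sum_norm_le entry)
    then show "norm (tensor_apply A M) \<le> norm A * norm M * (real CARD('m) * real CARD('m))"
      by (simp add: mult_ac)
  qed
qed

text \<open>Chen's relation cancels the terms of lower order: what is left are the remainder and the increment of the
controlled integrand, each paired with an increment that brings the total order to \<open>3\<alpha>\<close>.\<close>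

lemma germ_defect:
  assumes chen: "X s t - X s m - X m t = tensor (x m - x s) (x t - x m)"
  shows "germ x X Y Y' s m + germ x X Y Y' m t - germ x X Y Y' s t =
    (Y m - Y s - Y' s (x m - x s)) (x t - x m) + tensor_apply (Y' m - Y' s) (X m t)"
proof -
  interpret T: bounded_bilinear "tensor_apply ::
    ((real ^ 'a) \<Rightarrow>\<^sub>L ((real ^ 'a) \<Rightarrow>\<^sub>L 'b)) \<Rightarrow> real ^ 'a ^ 'a \<Rightarrow> 'b"
    by (rule bounded_bilinear_tensor_apply)
  have "X s t = X s m + X m t + tensor (x m - x s) (x t - x m)"
    using chen by (simp add: algebra_simps)
  then have "tensor_apply (Y' s) (X s t) =
      tensor_apply (Y' s) (X s m) + tensor_apply (Y' s) (X m t) + Y' s (x m - x s) (x t - x m)"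
    by (simp add: T.add_right tensor_apply_tensor)
  moreover have "Y s (x t - x s) = Y s (x m - x s) + Y s (x t - x m)"
    by (simp add: blinfun.add_right[symmetric])
  ultimately show ?thesis
    by (simp add: germ_def T.diff_left blinfun.diff_left)
qed

section \<open>The one-step map of a rough differential equation\<close>

lemma norm_blinfun_le:
  assumes "norm f \<le> c" "norm h \<le> d" "0 \<le> c"
  shows "norm (blinfun_apply f h) \<le> c * d"
  using assms by (intro order.trans[OF norm_blinfun] mult_mono) auto

lemma norm_blinfun_compose_le:
  assumes "norm f \<le> c" "norm h \<le> d" "0 \<le> c"
  shows "norm (f o\<^sub>L h) \<le> c * d"
  using assms by (intro order.trans[OF norm_blinfun_compose] mult_mono) auto

text \<open>A single constant \<open>B\<close> bounds everything, including the weight of the whole interval; then every power of the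
weight is bounded by \<open>B\<close> times the previous one, and the estimates below only involve powers of \<open>B\<close>.\<close>

locale rough_equation =
  fixes \<alpha> a b B :: real
    and g :: "real ^ 'd \<Rightarrow> ((real ^ 'm) \<Rightarrow>\<^sub>L (real ^ 'd))"
    and x :: "real \<Rightarrow> real ^ 'm"
    and X :: "real \<Rightarrow> real \<Rightarrow> real ^ 'm ^ 'm"
  assumes exponent: "1/3 < \<alpha>" and B_ge_1: "1 \<le> B"
    and g_deriv: "\<And>z. (g has_derivative fderiv g z) (at z)"
    and g1_deriv: "\<And>z. (fderiv g has_derivative fderiv (fderiv g) z) (at z)"
    and g_bound: "\<And>z. norm (g z) \<le> B" and g1_bound: "\<And>z. norm (fderiv g z) \<le> B"
    and g2_bound: "\<And>z. norm (fderiv (fderiv g) z) \<le> B"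
    and g2_lip: "\<And>z w. norm (fderiv (fderiv g) z - fderiv (fderiv g) w) \<le> B * norm (z - w)"
    and x_bound: "\<And>s t. a \<le> s \<Longrightarrow> s \<le> t \<Longrightarrow> t \<le> b \<Longrightarrow> norm (x t - x s) \<le> B * weight \<alpha> s t"
    and X_bound: "\<And>s t. a \<le> s \<Longrightarrow> s \<le> t \<Longrightarrow> t \<le> b \<Longrightarrow> norm (X s t) \<le> B * (weight \<alpha> s t)\<^sup>2"
    and chen: "\<And>s m t. a \<le> s \<Longrightarrow> s \<le> m \<Longrightarrow> m \<le> t \<Longrightarrow> t \<le> b \<Longrightarrow>
      X s t - X s m - X m t = tensor (x m - x s) (x t - x m)"
    and weight_bound: "weight \<alpha> a b \<le> B"
    and tensor_bound: "\<And>(A :: (real ^ 'm) \<Rightarrow>\<^sub>L ((real ^ 'm) \<Rightarrow>\<^sub>L (real ^ 'd))) M.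
      norm (tensor_apply A M) \<le> B * norm A * norm M"
begin

abbreviation "g1 \<equiv> fderiv g"
abbreviation "g2 \<equiv> fderiv (fderiv g)"

definition F :: "real ^ 'd \<Rightarrow> ((real ^ 'm) \<Rightarrow>\<^sub>L ((real ^ 'm) \<Rightarrow>\<^sub>L (real ^ 'd)))" where
  "F z = g1 z o\<^sub>L g z"

definition DF :: "real ^ 'd \<Rightarrow> real ^ 'd \<Rightarrow> ((real ^ 'm) \<Rightarrow>\<^sub>L ((real ^ 'm) \<Rightarrow>\<^sub>L (real ^ 'd)))" where
  "DF z h = (g1 z o\<^sub>L g1 z h) + (g2 z h o\<^sub>L g z)"

definition step :: "real \<Rightarrow> real \<Rightarrow> real ^ 'd \<Rightarrow> real ^ 'd" where
  "step s t z = g z (x t - x s) + tensor_apply (F z) (X s t)"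

definition Dstep :: "real \<Rightarrow> real \<Rightarrow> real ^ 'd \<Rightarrow> real ^ 'd \<Rightarrow> real ^ 'd" where
  "Dstep s t z h = g1 z h (x t - x s) + tensor_apply (DF z h) (X s t)"

interpretation T: bounded_bilinear "tensor_apply ::
    ((real ^ 'm) \<Rightarrow>\<^sub>L ((real ^ 'm) \<Rightarrow>\<^sub>L (real ^ 'd))) \<Rightarrow> real ^ 'm ^ 'm \<Rightarrow> real ^ 'd"
  by (rule bounded_bilinear_tensor_apply)

lemma B_nonneg: "0 \<le> B"
  using B_ge_1 by simp

lemma exponent_nonneg: "0 < \<alpha>" "0 \<le> \<alpha>"
  using exponent by simp_all

lemma tensor_le:
  fixes A :: "(real ^ 'm) \<Rightarrow>\<^sub>L ((real ^ 'm) \<Rightarrow>\<^sub>L (real ^ 'd))"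
  assumes "norm A \<le> c" "norm M \<le> d"
  shows "norm (tensor_apply A M) \<le> B * c * d"
proof (rule order.trans[OF tensor_bound])
  have "0 \<le> c" using assms(1) norm_ge_zero[of A] by linarith
  then show "B * norm A * norm M \<le> B * c * d"
    using assms B_nonneg by (intro mult_mono mult_nonneg_nonneg) auto
qed

lemma weight_le_B: "a \<le> s \<Longrightarrow> s \<le> t \<Longrightarrow> t \<le> b \<Longrightarrow> weight \<alpha> s t \<le> B"
  using weight_mono[OF exponent_nonneg(2), of a s t b] weight_bound by simp

lemma g_lip: "norm (g z - g w) \<le> B * norm (z - w)"
  by (rule mean_value_bound[OF g_deriv]) (auto intro!: norm_blinfun_le g1_bound B_nonneg)

lemma g1_lip: "norm (g1 z - g1 w) \<le> B * norm (z - w)"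
  by (rule mean_value_bound[OF g1_deriv]) (auto intro!: norm_blinfun_le g2_bound B_nonneg)

lemma g1_lip_apply: "norm (g1 z h - g1 w h) \<le> B * norm (z - w) * norm h"
  using norm_blinfun_le[OF g1_lip order.refl, of z w h] B_nonneg by (simp add: blinfun.diff_left)

lemma g2_lip_apply: "norm (g2 z h - g2 w h) \<le> B * norm (z - w) * norm h"
  using norm_blinfun_le[OF g2_lip order.refl, of z w h] B_nonneg by (simp add: blinfun.diff_left)

lemma g_taylor: "norm (g (z + k) - g z - g1 z k) \<le> B * (norm k)\<^sup>2"
  by (rule taylor_bound[OF g_deriv g1_lip_apply B_nonneg])

lemma g1_taylor: "norm (g1 (z + k) - g1 z - g2 z k) \<le> B * (norm k)\<^sup>2"
  by (rule taylor_bound[OF g1_deriv g2_lip_apply B_nonneg])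

lemma g2_symmetric: "g2 z u v = g2 z v u"
  by (rule second_derivative_symmetric[OF g_deriv g1_deriv g2_lip B_nonneg])

text \<open>Here the symmetry of the second derivative enters: the derivative of \<open>Dg g\<close> in the direction \<open>h\<close> contains
\<open>D\<^sup>2g[h, g u]\<close>, where the Gubinelli derivative of the linearized integrand has \<open>D\<^sup>2g[g u, h]\<close>.\<close>

lemma DF_eq: "DF z h = lin_integrand_deriv g z h (g1 z h)"
  by (rule blinfun_eqI) (simp add: lin_integrand_deriv_apply DF_def blinfun.add_left g2_symmetric[of z h])

lemma F_deriv: "(F has_derivative DF z) (at z)"
  unfolding F_def[abs_def] DF_def[abs_def]
  by (rule bounded_bilinear.FDERIV[OF bounded_bilinear_blinfun_compose g1_deriv g_deriv])

lemma F_bound: "norm (F z) \<le> B * B"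
  unfolding F_def by (intro norm_blinfun_compose_le g1_bound g_bound B_nonneg)

lemma DF_bound: "norm (DF z h) \<le> 2 * B * B * norm h"
proof -
  have "norm (DF z h) \<le> B * (B * norm h) + (B * norm h) * B"
    unfolding DF_def using B_nonneg
    by (intro norm_triangle_mono norm_blinfun_compose_le norm_blinfun_le g1_bound g2_bound g_bound) auto
  then show ?thesis by simp
qed

lemma DF_lip: "norm (DF z h - DF w h) \<le> 4 * B * B * norm (z - w) * norm h"
proof -
  have "DF z h - DF w h = ((g1 z - g1 w) o\<^sub>L g1 z h) + (g1 w o\<^sub>L (g1 z h - g1 w h))
      + ((g2 z h - g2 w h) o\<^sub>L g z) + (g2 w h o\<^sub>L (g z - g w))"
    by (rule blinfun_eqI) (simp add: DF_def blinfun.add_left blinfun.diff_left blinfun.diff_right)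
  moreover have "norm (((g1 z - g1 w) o\<^sub>L g1 z h) + (g1 w o\<^sub>L (g1 z h - g1 w h))
      + ((g2 z h - g2 w h) o\<^sub>L g z) + (g2 w h o\<^sub>L (g z - g w)))
    \<le> (B * norm (z - w)) * (B * norm h) + B * (B * norm (z - w) * norm h)
      + (B * norm (z - w) * norm h) * B + (B * norm h) * (B * norm (z - w))"
    using B_nonneg
    by (intro norm_triangle_mono norm_blinfun_compose_le norm_blinfun_le[where c = B] g1_bound g2_bound g_bound
        g_lip g1_lip g1_lip_apply g2_lip_apply mult_nonneg_nonneg) auto
  ultimately show ?thesis by (simp add: mult_ac)
qed

lemma F_lip: "norm (F z - F w) \<le> 2 * B * B * norm (z - w)"
  by (rule mean_value_bound[OF F_deriv DF_bound]) (use B_nonneg in simp)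

lemma F_four_point:
  "norm ((F (z + v) - F z) - (F (w + v') - F w)) \<le> 4 * B * B * (norm v * norm (z - w) + norm (v - v'))"
proof (rule four_point_bound[OF F_deriv _ DF_lip])
  fix z h :: "real ^ 'd"
  have "2 * B * B * norm h \<le> 4 * B * B * norm h"
    using B_nonneg by (intro mult_right_mono) auto
  then show "norm (DF z h) \<le> 4 * B * B * norm h"
    using DF_bound[of z h] by linarith
qed (use B_nonneg in simp)

text \<open>Moving the base point is controlled by the Taylor expansion of \<open>Dg\<close>, that is, by the Lipschitz bound on
\<open>D\<^sup>2g\<close>; moving the increment is controlled by the Taylor expansion of \<open>g\<close>.\<close>

lemma taylor_remainder_lip:
  "norm ((g (z + v) - g z - g1 z v) - (g (w + v') - g w - g1 w v'))
    \<le> B * (norm v)\<^sup>2 * norm (z - w) + B * norm (v - v') * (norm v + 2 * norm v')"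
proof -
  have 1: "norm ((g (z + v) - g z - g1 z v) - (g (w + v) - g w - g1 w v)) \<le> B * (norm v)\<^sup>2 * norm (z - w)"
  proof (rule mean_value_bound[of "\<lambda>z. g (z + v) - g z - g1 z v" "\<lambda>z h. g1 (z + v) h - g1 z h - g2 z h v"])
    fix z
    have "((\<lambda>z. g (z + v)) has_derivative g1 (z + v)) (at z)"
      by (rule has_derivative_compose[OF _ g_deriv, of "\<lambda>z. z + v" "\<lambda>h. h"]) (auto intro!: derivative_eq_intros)
    moreover have "((\<lambda>z. g1 z v) has_derivative (\<lambda>h. g2 z h v)) (at z)"
      by (rule bounded_linear.has_derivative[OF blinfun.bounded_linear_left g1_deriv])
    ultimately show "((\<lambda>z. g (z + v) - g z - g1 z v) has_derivative (\<lambda>h. g1 (z + v) h - g1 z h - g2 z h v)) (at z)"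
      by (intro has_derivative_diff g_deriv)
    fix h
    have "g1 (z + v) h - g1 z h - g2 z h v = (g1 (z + v) - g1 z - g2 z v) h"
      by (simp add: blinfun.diff_left g2_symmetric[of z h])
    then show "norm (g1 (z + v) h - g1 z h - g2 z h v) \<le> B * (norm v)\<^sup>2 * norm h"
      using norm_blinfun_le[OF g1_taylor order.refl, of v z h] B_nonneg by simp
  qed (use B_nonneg in simp)
  have "(g (w + v) - g w - g1 w v) - (g (w + v') - g w - g1 w v') =
      (g ((w + v') + (v - v')) - g (w + v') - g1 (w + v') (v - v')) + (g1 (w + v') (v - v') - g1 w (v - v'))"
    by (simp add: blinfun.diff_right)
  then have "norm ((g (w + v) - g w - g1 w v) - (g (w + v') - g w - g1 w v'))
      \<le> B * (norm (v - v'))\<^sup>2 + B * norm (w + v' - w) * norm (v - v')"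
    by (simp only:) (intro norm_triangle_mono g_taylor g1_lip_apply)
  also have "\<dots> \<le> B * norm (v - v') * (norm v + 2 * norm v')"
    using mult_left_mono[OF norm_triangle_ineq4[of v v'], of "B * norm (v - v')"] B_nonneg
    by (simp add: power2_eq_square algebra_simps)
  finally have 2: "norm ((g (w + v) - g w - g1 w v) - (g (w + v') - g w - g1 w v'))
      \<le> B * norm (v - v') * (norm v + 2 * norm v')" .
  have telescope: "p - q + (q - r) = p - r" for p q r :: "(real ^ 'm) \<Rightarrow>\<^sub>L (real ^ 'd)"
    by simp
  show ?thesis
    using norm_triangle_mono[OF 1 2] unfolding telescope .
qed

definition c_step :: real where "c_step = B * B + 4 * B ^ 5"

definition c_defect :: real where "c_defect = (4 * B * c_step\<^sup>2 + 3 * B ^ 5) * B + 8 * B ^ 4 * c_step"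

lemma c_nonneg: "0 \<le> c_step" "0 \<le> c_defect"
  using B_nonneg by (simp_all add: c_step_def c_defect_def)

lemma X_bound_linear:
  assumes "a \<le> s" "s \<le> t" "t \<le> b"
  shows "norm (X s t) \<le> B * B * weight \<alpha> s t"
proof (rule order.trans[OF X_bound[OF assms]])
  show "B * (weight \<alpha> s t)\<^sup>2 \<le> B * B * weight \<alpha> s t"
    using weight_le_B[OF assms] B_nonneg
    by (simp add: power2_eq_square mult_left_mono mult_right_mono mult.assoc)
qed

lemma step_deriv: "(step s t has_derivative Dstep s t z) (at z)"
  unfolding step_def[abs_def] Dstep_def[abs_def]
  by (intro has_derivative_add bounded_linear.has_derivative[OF blinfun.bounded_linear_left g_deriv]
      bounded_linear.has_derivative[OF T.bounded_linear_left F_deriv])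

lemma step_bound:
  assumes "a \<le> s" "s \<le> t" "t \<le> b"
  shows "norm (step s t z) \<le> c_step * weight \<alpha> s t"
proof -
  have "norm (step s t z) \<le> B * (B * weight \<alpha> s t) + B * (B * B) * (B * B * weight \<alpha> s t)"
    unfolding step_def
    by (intro norm_triangle_mono norm_blinfun_le tensor_le g_bound F_bound x_bound X_bound_linear assms B_nonneg)
  also have "\<dots> = (B * B + B ^ 5) * weight \<alpha> s t"
    by (simp add: algebra_simps eval_nat_numeral)
  also have "\<dots> \<le> c_step * weight \<alpha> s t"
    using B_nonneg by (intro mult_right_mono) (auto simp: c_step_def)
  finally show ?thesis .
qed

lemma Dstep_bound:
  assumes "a \<le> s" "s \<le> t" "t \<le> b"
  shows "norm (Dstep s t z h) \<le> c_step * weight \<alpha> s t * norm h"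
proof -
  have "norm (Dstep s t z h) \<le> (B * norm h) * (B * weight \<alpha> s t) + B * (2 * B * B * norm h) * (B * B * weight \<alpha> s t)"
    unfolding Dstep_def using B_nonneg
    by (intro norm_triangle_mono norm_blinfun_le[where c = "B * norm h"] norm_blinfun_le[where c = B] tensor_le
        g1_bound DF_bound x_bound X_bound_linear assms) auto
  also have "\<dots> = (B * B + 2 * B ^ 5) * (weight \<alpha> s t * norm h)"
    by (simp add: algebra_simps eval_nat_numeral)
  also have "\<dots> \<le> c_step * (weight \<alpha> s t * norm h)"
    using B_nonneg by (intro mult_right_mono) (auto simp: c_step_def)
  finally show ?thesis by (simp add: mult.assoc)
qed

lemma Dstep_lip:
  assumes "a \<le> s" "s \<le> t" "t \<le> b"
  shows "norm (Dstep s t z h - Dstep s t w h) \<le> c_step * weight \<alpha> s t * norm (z - w) * norm h"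
proof -
  have "Dstep s t z h - Dstep s t w h = (g1 z h - g1 w h) (x t - x s) + tensor_apply (DF z h - DF w h) (X s t)"
    by (simp add: Dstep_def blinfun.diff_left T.diff_left)
  then have "norm (Dstep s t z h - Dstep s t w h)
      \<le> (B * norm (z - w) * norm h) * (B * weight \<alpha> s t) + B * (4 * B * B * norm (z - w) * norm h) * (B * B * weight \<alpha> s t)"
    using B_nonneg by (simp only:) (intro norm_triangle_mono norm_blinfun_le[where c = "B * norm (z - w) * norm h"]
        tensor_le g1_lip_apply DF_lip x_bound X_bound_linear assms mult_nonneg_nonneg norm_ge_zero)
  also have "\<dots> = c_step * weight \<alpha> s t * norm (z - w) * norm h"
    by (simp add: c_step_def algebra_simps eval_nat_numeral)
  finally show ?thesis .
qed

lemma step_lip: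
  assumes "a \<le> s" "s \<le> t" "t \<le> b"
  shows "norm (step s t z - step s t w) \<le> c_step * weight \<alpha> s t * norm (z - w)"
  by (rule mean_value_bound[OF step_deriv Dstep_bound[OF assms]]) (use c_nonneg in simp)

text \<open>By Chen's relation the term \<open>Dg(z) g(z)\<close> applied to \<open>tensor (x m - x s) (x t - x m)\<close> completes \<open>g (z + step s m z) - g z\<close>
to a Taylor remainder, which is of second order.\<close>

lemma step_defect:
  assumes "a \<le> s" "s \<le> m" "m \<le> t" "t \<le> b"
  shows "step s m z + step m t (z + step s m z) - step s t z =
    ((g (z + step s m z) - g z - g1 z (step s m z)) + g1 z (tensor_apply (F z) (X s m))) (x t - x m)
      + tensor_apply (F (z + step s m z) - F z) (X m t)"
proof -
  define v where "v = step s m z"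
  have X: "X s t = X s m + X m t + tensor (x m - x s) (x t - x m)"
    using chen[OF assms] by (simp add: algebra_simps)
  have "tensor_apply (F z) (X s t) =
      tensor_apply (F z) (X s m) + tensor_apply (F z) (X m t) + g1 z (g z (x m - x s)) (x t - x m)"
    by (simp add: X T.add_right tensor_apply_tensor F_def)
  moreover have "g z (x t - x s) = g z (x m - x s) + g z (x t - x m)"
    by (simp add: blinfun.add_right[symmetric])
  moreover have "g1 z (tensor_apply (F z) (X s m)) = g1 z v - g1 z (g z (x m - x s))"
    by (simp add: v_def step_def blinfun.add_right)
  ultimately have "v + step m t (z + v) - step s t z =
      ((g (z + v) - g z - g1 z v) + g1 z (tensor_apply (F z) (X s m))) (x t - x m)
        + tensor_apply (F (z + v) - F z) (X m t)"
    by (simp add: step_def v_def[unfolded step_def] blinfun.add_left blinfun.diff_left T.diff_left)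
  then show ?thesis by (simp add: v_def)
qed

lemma sub_weights:
  assumes "a \<le> s" "s \<le> m" "m \<le> t" "t \<le> b"
  shows "weight \<alpha> s m \<le> weight \<alpha> s t" "weight \<alpha> m t \<le> weight \<alpha> s t"
  using weight_mono[OF exponent_nonneg(2), of s s m t] weight_mono[OF exponent_nonneg(2), of s m t t] assms by auto

lemma sub_bounds:
  assumes st: "a \<le> s" "s \<le> m" "m \<le> t" "t \<le> b"
  shows "norm (x m - x s) \<le> B * weight \<alpha> s t" "norm (x t - x m) \<le> B * weight \<alpha> s t"
    "norm (X s m) \<le> B * (weight \<alpha> s t)\<^sup>2" "norm (X m t) \<le> B * (weight \<alpha> s t)\<^sup>2"
    "norm (step s m z) \<le> c_step * weight \<alpha> s t"
    "norm (step s m z - step s m w) \<le> c_step * weight \<alpha> s t * norm (z - w)"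
proof -
  note w = sub_weights[OF st]
  have ab: "m \<le> b" "a \<le> m" using st by auto
  show "norm (x m - x s) \<le> B * weight \<alpha> s t"
    using x_bound[OF st(1,2) ab(1)] mult_left_mono[OF w(1) B_nonneg] by linarith
  show "norm (x t - x m) \<le> B * weight \<alpha> s t"
    using x_bound[OF ab(2) st(3,4)] mult_left_mono[OF w(2) B_nonneg] by linarith
  show "norm (X s m) \<le> B * (weight \<alpha> s t)\<^sup>2"
    using X_bound[OF st(1,2) ab(1)] mult_left_mono[OF power_mono[OF w(1) weight_nonneg, of 2] B_nonneg] by linarith
  show "norm (X m t) \<le> B * (weight \<alpha> s t)\<^sup>2"
    using X_bound[OF ab(2) st(3,4)] mult_left_mono[OF power_mono[OF w(2) weight_nonneg, of 2] B_nonneg] by linarith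
  show "norm (step s m z) \<le> c_step * weight \<alpha> s t"
    using step_bound[OF st(1,2) ab(1), of z] mult_left_mono[OF w(1) c_nonneg(1)] by linarith
  show "norm (step s m z - step s m w) \<le> c_step * weight \<alpha> s t * norm (z - w)"
    using step_lip[OF st(1,2) ab(1), of z w] mult_right_mono[OF mult_left_mono[OF w(1) c_nonneg(1)] norm_ge_zero[of "z - w"]] by linarith
qed

lemma step_defect_bound:
  assumes st: "a \<le> s" "s \<le> m" "m \<le> t" "t \<le> b"
  shows "norm (step s m z + step m t (z + step s m z) - step s t z) \<le> c_defect * weight \<alpha> s t ^ 3"
proof -
  define r where "r = weight \<alpha> s t"
  have r: "0 \<le> r" by (simp add: r_def)
  note sub = sub_bounds[OF st, folded r_def]
  define v where "v = step s m z"
  have v: "norm v \<le> c_step * r" unfolding v_def by (rule sub)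
  have rem: "norm (g (z + v) - g z - g1 z v) \<le> B * (c_step * r)\<^sup>2"
    using mult_left_mono[OF power_mono[OF v norm_ge_zero, of 2] B_nonneg] g_taylor[of z v] by linarith
  have F: "norm (F (z + v) - F z) \<le> 2 * B * B * (c_step * r)"
    using mult_left_mono[OF v, of "2 * B * B"] F_lip[of "z + v" z] B_nonneg by simp
  have "norm (v + step m t (z + v) - step s t z)
      \<le> (B * (c_step * r)\<^sup>2 + B * (B * (B * B) * (B * r\<^sup>2))) * (B * r) + B * (2 * B * B * (c_step * r)) * (B * r\<^sup>2)"
    unfolding v_def step_defect[OF st] unfolding v_def[symmetric]
  proof (rule norm_triangle_mono[OF norm_blinfun_le[OF norm_triangle_mono] tensor_le])
    show "norm (g1 z (tensor_apply (F z) (X s m))) \<le> B * (B * (B * B) * (B * r\<^sup>2))"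
      by (intro norm_blinfun_le tensor_le g1_bound F_bound sub B_nonneg)
    show "0 \<le> B * (c_step * r)\<^sup>2 + B * (B * (B * B) * (B * r\<^sup>2))"
      using B_nonneg by simp
  qed (intro rem F sub)+
  also have "\<dots> = ((B * c_step\<^sup>2 + B ^ 5) * B + 2 * B ^ 4 * c_step) * r ^ 3"
    by (simp add: algebra_simps eval_nat_numeral)
  also have "\<dots> \<le> c_defect * r ^ 3"
    unfolding c_defect_def using B_nonneg c_nonneg(1) r
    by (intro mult_right_mono add_mono) auto
  finally show ?thesis by (simp add: v_def r_def)
qed

lemma step_defect_lip:
  assumes st: "a \<le> s" "s \<le> m" "m \<le> t" "t \<le> b"
  shows "norm ((step s m z + step m t (z + step s m z) - step s t z) - (step s m w + step m t (w + step s m w) - step s t w))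
    \<le> c_defect * weight \<alpha> s t ^ 3 * norm (z - w)"
proof -
  define r where "r = weight \<alpha> s t"
  have r: "0 \<le> r" by (simp add: r_def)
  note sub = sub_bounds[OF st, folded r_def]
  define k where "k = norm (z - w)"
  have k: "0 \<le> k" by (simp add: k_def)
  define v v' where "v = step s m z" and "v' = step s m w"
  have v: "norm v \<le> c_step * r" "norm v' \<le> c_step * r" "norm (v - v') \<le> c_step * r * k"
    unfolding v_def v'_def k_def by (rule sub)+
  define J where "J z = tensor_apply (F z) (X s m)" for z
  have rem: "norm ((g (z + v) - g z - g1 z v) - (g (w + v') - g w - g1 w v')) \<le> 4 * B * c_step\<^sup>2 * r\<^sup>2 * k"
  proof -
    have "norm ((g (z + v) - g z - g1 z v) - (g (w + v') - g w - g1 w v'))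
        \<le> B * (norm v)\<^sup>2 * k + B * norm (v - v') * (norm v + 2 * norm v')"
      unfolding k_def by (rule taylor_remainder_lip)
    also have "\<dots> \<le> B * (c_step * r)\<^sup>2 * k + B * (c_step * r * k) * (c_step * r + 2 * (c_step * r))"
      using v B_nonneg k r c_nonneg
      by (intro add_mono mult_mono mult_left_mono mult_right_mono power_mono mult_nonneg_nonneg) auto
    also have "\<dots> = 4 * B * c_step\<^sup>2 * r\<^sup>2 * k"
      by (simp add: algebra_simps power2_eq_square)
    finally show ?thesis .
  qed
  have J: "norm (g1 z (J z) - g1 w (J w)) \<le> 3 * B ^ 5 * r\<^sup>2 * k"
  proof -
    have "g1 z (J z) - g1 w (J w) = (g1 z - g1 w) (J z) + g1 w (tensor_apply (F z - F w) (X s m))"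
      by (simp add: J_def blinfun.diff_left blinfun.diff_right T.diff_left)
    then have "norm (g1 z (J z) - g1 w (J w)) \<le> (B * k) * (B * (B * B) * (B * r\<^sup>2)) + B * (B * (2 * B * B * k) * (B * r\<^sup>2))"
      unfolding J_def k_def using B_nonneg
      by (simp only:) (intro norm_triangle_mono norm_blinfun_le tensor_le g1_bound g1_lip F_bound F_lip sub
          mult_nonneg_nonneg norm_ge_zero)
    then show ?thesis
      by (simp add: algebra_simps eval_nat_numeral)
  qed
  have F4: "norm ((F (z + v) - F z) - (F (w + v') - F w)) \<le> 8 * B * B * c_step * r * k"
  proof -
    have "norm ((F (z + v) - F z) - (F (w + v') - F w)) \<le> 4 * B * B * (norm v * k + norm (v - v'))"
      unfolding k_def by (rule F_four_point)
    also have "\<dots> \<le> 4 * B * B * ((c_step * r) * k + c_step * r * k)"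
      using v B_nonneg k by (intro mult_left_mono add_mono mult_right_mono) auto
    finally show ?thesis by (simp add: algebra_simps)
  qed
  have "(v + step m t (z + v) - step s t z) - (v' + step m t (w + v') - step s t w) =
      (((g (z + v) - g z - g1 z v) - (g (w + v') - g w - g1 w v')) + (g1 z (J z) - g1 w (J w))) (x t - x m)
      + tensor_apply ((F (z + v) - F z) - (F (w + v') - F w)) (X m t)"
    unfolding v_def v'_def step_defect[OF st] unfolding v_def[symmetric] v'_def[symmetric] J_def[symmetric]
    by (simp add: blinfun.add_left blinfun.diff_left T.diff_left)
  also have "norm \<dots> \<le> (4 * B * c_step\<^sup>2 * r\<^sup>2 * k + 3 * B ^ 5 * r\<^sup>2 * k) * (B * r) + B * (8 * B * B * c_step * r * k) * (B * r\<^sup>2)"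
    using B_nonneg k
    by (intro norm_triangle_mono norm_blinfun_le[where c = "4 * B * c_step\<^sup>2 * r\<^sup>2 * k + 3 * B ^ 5 * r\<^sup>2 * k"]
        tensor_le rem J F4 sub add_nonneg_nonneg mult_nonneg_nonneg) auto
  also have "\<dots> = c_defect * r ^ 3 * k"
    by (simp add: c_defect_def algebra_simps eval_nat_numeral)
  finally show ?thesis
    by (simp add: v_def v'_def r_def k_def)
qed

definition C :: real where "C = 1 + c_step + c_defect"

sublocale almost_flow \<alpha> a b C step Dstep
proof
  have C: "1 \<le> C" "c_step \<le> C" "c_defect \<le> C"
    using c_nonneg by (auto simp: C_def)
  show "1 \<le> C" "1/3 < \<alpha>"
    using C exponent by auto
  show "(step s t has_derivative Dstep s t z) (at z)" for s t z
    by (rule step_deriv)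
  fix s t z w h assume st: "a \<le> s" "s \<le> t" "t \<le> b"
  show "norm (Dstep s t z h) \<le> C * weight \<alpha> s t * norm h"
    by (rule order.trans[OF Dstep_bound[OF st]]) (intro mult_right_mono C weight_nonneg norm_ge_zero)
  show "norm (Dstep s t z h - Dstep s t w h) \<le> C * weight \<alpha> s t * norm (z - w) * norm h"
    by (rule order.trans[OF Dstep_lip[OF st]]) (intro mult_right_mono C weight_nonneg norm_ge_zero)
next
  have C: "c_defect \<le> C"
    using c_nonneg by (auto simp: C_def)
  fix s m t z w assume st: "a \<le> s" "s \<le> m" "m \<le> t" "t \<le> b"
  show "norm (step s m z + step m t (z + step s m z) - step s t z) \<le> C * weight \<alpha> s t ^ 3"
    by (rule order.trans[OF step_defect_bound[OF st]]) (intro mult_right_mono C zero_le_power weight_nonneg)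
  show "norm ((step s m z + step m t (z + step s m z) - step s t z) - (step s m w + step m t (w + step s m w) - step s t w))
      \<le> C * weight \<alpha> s t ^ 3 * norm (z - w)"
    by (rule order.trans[OF step_defect_lip[OF st]]) (intro mult_right_mono C zero_le_power weight_nonneg norm_ge_zero)
qed

lemma diagonal: "a \<le> s \<Longrightarrow> s \<le> b \<Longrightarrow> X s s = 0"
  using X_bound[of s s] by simp

lemma x_continuous: "continuous_on {a..b} x"
  by (rule hoelder_path_continuous[of \<alpha>]) (use x_bound exponent_nonneg in \<open>auto simp: hoelder_path_iff\<close>)

lemma controlled_germ_defect:
  fixes Y :: "real \<Rightarrow> (real ^ 'm) \<Rightarrow>\<^sub>L (real ^ 'd)"
    and Y' :: "real \<Rightarrow> (real ^ 'm) \<Rightarrow>\<^sub>L ((real ^ 'm) \<Rightarrow>\<^sub>L (real ^ 'd))"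
  assumes Y: "\<And>s m. a \<le> s \<Longrightarrow> s \<le> m \<Longrightarrow> m \<le> b \<Longrightarrow> norm (Y m - Y s - Y' s (x m - x s)) \<le> c * (weight \<alpha> s m)\<^sup>2"
    and Y': "\<And>s m. a \<le> s \<Longrightarrow> s \<le> m \<Longrightarrow> m \<le> b \<Longrightarrow> norm (Y' m - Y' s) \<le> c * weight \<alpha> s m"
    and "0 \<le> c" and st: "a \<le> s" "s \<le> m" "m \<le> t" "t \<le> b"
  shows "norm (germ x X Y Y' s m + germ x X Y Y' m t - germ x X Y Y' s t) \<le> (c * B + B * c * B) * weight \<alpha> s t ^ 3"
proof -
  define r where "r = weight \<alpha> s t"
  have r: "0 \<le> r" by (simp add: r_def)
  note sub = sub_bounds[OF st, folded r_def] and w = sub_weights[OF st, folded r_def]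
  have 1: "norm (Y m - Y s - Y' s (x m - x s)) \<le> c * r\<^sup>2"
    using Y[of s m] mult_left_mono[OF power_mono[OF w(1) weight_nonneg, of 2] \<open>0 \<le> c\<close>] st by simp
  have 2: "norm (Y' m - Y' s) \<le> c * r"
    using Y'[of s m] mult_left_mono[OF w(1) \<open>0 \<le> c\<close>] st by simp
  have "norm (germ x X Y Y' s m + germ x X Y Y' m t - germ x X Y Y' s t) \<le> (c * r\<^sup>2) * (B * r) + B * (c * r) * (B * r\<^sup>2)"
    unfolding germ_defect[OF chen[OF st]] using \<open>0 \<le> c\<close>
    by (intro norm_triangle_mono norm_blinfun_le[OF 1] tensor_le 2 sub) auto
  then show ?thesis
    by (simp add: r_def algebra_simps eval_nat_numeral)
qed

lemma solution_germ:
  "germ x X (\<lambda>u. g (y u)) (\<lambda>u. fderiv g (y u) o\<^sub>L g (y u)) s t = step s t (y s)"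
  by (simp add: germ_def step_def F_def)

lemma linear_germ:
  "germ x X (\<lambda>u. fderiv g (y u) (\<xi> u)) (\<lambda>u. lin_integrand_deriv g (y u) (\<xi> u) (fderiv g (y u) (\<xi> u))) s t
    = Dstep s t (y s) (\<xi> s)"
  by (simp add: germ_def Dstep_def DF_eq)

text \<open>The integrand \<open>g(y)\<close> is controlled with derivative \<open>Dg(y) g(y)\<close> by Taylor's formula, so the sewing estimate applies
to its germ, which is the increment of the one-step map along \<open>y\<close>.\<close>

lemma rde_solution_flow_line:
  assumes "rde_solution \<alpha> g x X a b y0 y"
  shows "flow_line y"
proof -
  have contr: "controlled_path \<alpha> x {a..b} y (\<lambda>t. g (y t))"
    and integral: "\<And>t. t \<in> {a..b} \<Longrightarrow> has_rough_integral x X a t (\<lambda>u. g (y u)) (\<lambda>u. fderiv g (y u) o\<^sub>L g (y u)) (y t - y a)"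
    using assms by (auto simp: rde_solution_def)
  obtain c where c: "0 \<le> c"
    and y: "\<And>s t. a \<le> s \<Longrightarrow> s \<le> t \<Longrightarrow> t \<le> b \<Longrightarrow> norm (y t - y s) \<le> c * weight \<alpha> s t"
    and R: "\<And>s t. a \<le> s \<Longrightarrow> s \<le> t \<Longrightarrow> t \<le> b \<Longrightarrow>
      norm (y t - y s - g (y s) (x t - x s)) \<le> c * (weight \<alpha> s t)\<^sup>2"
    by (rule controlled_path_bounds[OF contr]) (rule that)
  define k where "k = B * c\<^sup>2 + B * c + 2 * B * B * c"
  have k: "0 \<le> k" using B_nonneg c by (simp add: k_def)
  have 1: "norm (g (y m) - g (y s) - (fderiv g (y s) o\<^sub>L g (y s)) (x m - x s)) \<le> k * (weight \<alpha> s m)\<^sup>2"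
    if st: "a \<le> s" "s \<le> m" "m \<le> b" for s m
  proof -
    have "g (y m) - g (y s) - (fderiv g (y s) o\<^sub>L g (y s)) (x m - x s) =
        (g (y s + (y m - y s)) - g (y s) - g1 (y s) (y m - y s)) + g1 (y s) (y m - y s - g (y s) (x m - x s))"
      by (simp add: blinfun.diff_right)
    then have "norm (g (y m) - g (y s) - (fderiv g (y s) o\<^sub>L g (y s)) (x m - x s))
        \<le> B * (norm (y m - y s))\<^sup>2 + B * (c * (weight \<alpha> s m)\<^sup>2)"
      by (simp only:) (intro norm_triangle_mono g_taylor norm_blinfun_le g1_bound R st B_nonneg)
    also have "\<dots> \<le> B * (c * weight \<alpha> s m)\<^sup>2 + B * (c * (weight \<alpha> s m)\<^sup>2)"
      using B_nonneg c by (intro add_mono mult_left_mono power_mono y st) auto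
    also have "\<dots> = (B * c\<^sup>2 + B * c) * (weight \<alpha> s m)\<^sup>2"
      by (simp add: algebra_simps power_mult_distrib)
    also have "\<dots> \<le> k * (weight \<alpha> s m)\<^sup>2"
      using B_nonneg c by (intro mult_right_mono) (auto simp: k_def)
    finally show ?thesis .
  qed
  have 2: "norm ((fderiv g (y m) o\<^sub>L g (y m)) - (fderiv g (y s) o\<^sub>L g (y s))) \<le> k * weight \<alpha> s m"
    if st: "a \<le> s" "s \<le> m" "m \<le> b" for s m
  proof -
    have "norm (F (y m) - F (y s)) \<le> 2 * B * B * norm (y m - y s)"
      by (rule F_lip)
    also have "\<dots> \<le> 2 * B * B * (c * weight \<alpha> s m)"
      using B_nonneg by (intro mult_left_mono y st) auto
    also have "\<dots> \<le> k * weight \<alpha> s m"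
      using B_nonneg c mult_right_mono[of "2 * B * B * c" k "weight \<alpha> s m"] by (simp add: k_def mult.assoc)
    finally show ?thesis by (simp add: F_def)
  qed
  note expansion = integral_imp_expansion[OF exponent integral controlled_germ_defect[OF 1 2 k] diagonal, unfolded solution_germ]
  show ?thesis
    unfolding flow_line_def remainder_def using expansion by fastforce
qed

text \<open>The product rule for controlled paths: \<open>Dg(y) \<xi>\<close> is controlled, with Gubinelli derivative \<open>DF (y s) (\<xi> s)\<close>.\<close>

lemma linear_integrand_bounds:
  fixes y \<xi> :: "real \<Rightarrow> real ^ 'd"
  assumes "0 \<le> c"
    and y: "\<And>s t. a \<le> s \<Longrightarrow> s \<le> t \<Longrightarrow> t \<le> b \<Longrightarrow> norm (y t - y s) \<le> c * weight \<alpha> s t"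
    and Ry: "\<And>s t. a \<le> s \<Longrightarrow> s \<le> t \<Longrightarrow> t \<le> b \<Longrightarrow>
      norm (y t - y s - g (y s) (x t - x s)) \<le> c * (weight \<alpha> s t)\<^sup>2"
    and \<xi>: "\<And>s t. a \<le> s \<Longrightarrow> s \<le> t \<Longrightarrow> t \<le> b \<Longrightarrow> norm (\<xi> t - \<xi> s) \<le> c * weight \<alpha> s t"
    and R\<xi>: "\<And>s t. a \<le> s \<Longrightarrow> s \<le> t \<Longrightarrow> t \<le> b \<Longrightarrow>
      norm (\<xi> t - \<xi> s - g1 (y s) (\<xi> s) (x t - x s)) \<le> c * (weight \<alpha> s t)\<^sup>2"
    and E: "\<And>t. a \<le> t \<Longrightarrow> t \<le> b \<Longrightarrow> norm (\<xi> t) \<le> E"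
    and st: "a \<le> s" "s \<le> m" "m \<le> b"
  shows "norm (g1 (y m) (\<xi> m) - g1 (y s) (\<xi> s) - DF (y s) (\<xi> s) (x m - x s))
      \<le> (B * c\<^sup>2 * E + B * c * E + B * c + B * c\<^sup>2) * (weight \<alpha> s m)\<^sup>2"
    and "norm (DF (y m) (\<xi> m) - DF (y s) (\<xi> s)) \<le> (4 * B * B * c * E + 2 * B * B * c) * weight \<alpha> s m"
proof -
  define r where "r = weight \<alpha> s m"
  have r: "0 \<le> r" by (simp add: r_def)
  have "0 \<le> E" using E[of s] st norm_ge_zero[of "\<xi> s"] by linarith
  note y' = y[OF st, folded r_def] and Ry' = Ry[OF st, folded r_def]
    and \<xi>' = \<xi>[OF st, folded r_def] and R\<xi>' = R\<xi>[OF st, folded r_def]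
  have E': "norm (\<xi> s) \<le> E" "norm (\<xi> m) \<le> E"
    using st by (auto intro!: E)
  have cr: "0 \<le> c * r" using \<open>0 \<le> c\<close> r by simp
  have lip: "norm (g1 (y m) - g1 (y s)) \<le> B * (c * r)"
    using g1_lip[of "y m" "y s"] mult_left_mono[OF y' B_nonneg] by linarith
  have taylor: "norm (g1 (y s + (y m - y s)) - g1 (y s) - g2 (y s) (y m - y s)) \<le> B * (c * r)\<^sup>2"
    using g1_taylor[of "y s" "y m - y s"] mult_left_mono[OF power_mono[OF y' norm_ge_zero, of 2] B_nonneg] by linarith
  have "g1 (y m) (\<xi> m) - g1 (y s) (\<xi> s) - DF (y s) (\<xi> s) (x m - x s) =
      (g1 (y s + (y m - y s)) - g1 (y s) - g2 (y s) (y m - y s)) (\<xi> s)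
      + g2 (y s) (y m - y s - g (y s) (x m - x s)) (\<xi> s)
      + g1 (y s) (\<xi> m - \<xi> s - g1 (y s) (\<xi> s) (x m - x s))
      + (g1 (y m) - g1 (y s)) (\<xi> m - \<xi> s)"
    by (simp add: DF_def blinfun.add_left blinfun.diff_left blinfun.diff_right g2_symmetric[of "y s" "\<xi> s"])
  then have "norm (g1 (y m) (\<xi> m) - g1 (y s) (\<xi> s) - DF (y s) (\<xi> s) (x m - x s))
      \<le> (B * (c * r)\<^sup>2) * E + (B * (c * r\<^sup>2)) * E + B * (c * r\<^sup>2) + (B * (c * r)) * (c * r)"
    using B_nonneg cr r \<open>0 \<le> c\<close>
    by (simp only:) (intro norm_triangle_mono norm_blinfun_le[OF taylor] norm_blinfun_le[OF norm_blinfun_le[OF g2_bound Ry']]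
        norm_blinfun_le[OF g1_bound R\<xi>'] norm_blinfun_le[OF lip \<xi>'] E'; simp)
  then show "norm (g1 (y m) (\<xi> m) - g1 (y s) (\<xi> s) - DF (y s) (\<xi> s) (x m - x s))
      \<le> (B * c\<^sup>2 * E + B * c * E + B * c + B * c\<^sup>2) * (weight \<alpha> s m)\<^sup>2"
    by (simp add: r_def algebra_simps power2_eq_square)
  have "linear (DF (y s))"
    by (rule has_derivative_linear[OF F_deriv])
  then have "DF (y m) (\<xi> m) - DF (y s) (\<xi> s) = (DF (y m) (\<xi> m) - DF (y s) (\<xi> m)) + DF (y s) (\<xi> m - \<xi> s)"
    by (simp add: linear_diff)
  then have "norm (DF (y m) (\<xi> m) - DF (y s) (\<xi> s))
      \<le> 4 * B * B * norm (y m - y s) * norm (\<xi> m) + 2 * B * B * norm (\<xi> m - \<xi> s)"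
    by (simp only:) (intro norm_triangle_mono DF_lip DF_bound)
  also have "\<dots> \<le> 4 * B * B * (c * r) * E + 2 * B * B * (c * r)"
    using y' \<xi>' E' B_nonneg cr \<open>0 \<le> c\<close> r by (intro add_mono mult_mono mult_left_mono mult_nonneg_nonneg) auto
  finally show "norm (DF (y m) (\<xi> m) - DF (y s) (\<xi> s)) \<le> (4 * B * B * c * E + 2 * B * B * c) * weight \<alpha> s m"
    by (simp add: r_def algebra_simps)
qed

lemma lin_rde_solution_imp_expansion:
  assumes sol: "rde_solution \<alpha> g x X a b y0 y" and lin: "lin_rde_solution \<alpha> g x X a b y \<xi>0 \<xi>"
  obtains M where "\<And>s t. a \<le> s \<Longrightarrow> s \<le> t \<Longrightarrow> t \<le> b \<Longrightarrow>
    norm (\<xi> t - \<xi> s - Dstep s t (y s) (\<xi> s)) \<le> M * weight \<alpha> s t ^ 3"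
proof -
  have contr: "controlled_path \<alpha> x {a..b} y (\<lambda>t. g (y t))"
    and contr': "controlled_path \<alpha> x {a..b} \<xi> (\<lambda>t. fderiv g (y t) (\<xi> t))"
    and integral: "\<And>t. t \<in> {a..b} \<Longrightarrow> has_rough_integral x X a t (\<lambda>u. fderiv g (y u) (\<xi> u))
        (\<lambda>u. lin_integrand_deriv g (y u) (\<xi> u) (fderiv g (y u) (\<xi> u))) (\<xi> t - \<xi> a)"
    using sol lin by (auto simp: rde_solution_def lin_rde_solution_def)
  obtain c where c: "0 \<le> c"
    and y: "\<And>s t. a \<le> s \<Longrightarrow> s \<le> t \<Longrightarrow> t \<le> b \<Longrightarrow> norm (y t - y s) \<le> c * weight \<alpha> s t"
    and Ry: "\<And>s t. a \<le> s \<Longrightarrow> s \<le> t \<Longrightarrow> t \<le> b \<Longrightarrow>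
      norm (y t - y s - g (y s) (x t - x s)) \<le> c * (weight \<alpha> s t)\<^sup>2"
    by (rule controlled_path_bounds[OF contr]) (rule that)
  obtain c' where c': "0 \<le> c'"
    and \<xi>: "\<And>s t. a \<le> s \<Longrightarrow> s \<le> t \<Longrightarrow> t \<le> b \<Longrightarrow> norm (\<xi> t - \<xi> s) \<le> c' * weight \<alpha> s t"
    and R\<xi>: "\<And>s t. a \<le> s \<Longrightarrow> s \<le> t \<Longrightarrow> t \<le> b \<Longrightarrow>
      norm (\<xi> t - \<xi> s - g1 (y s) (\<xi> s) (x t - x s)) \<le> c' * (weight \<alpha> s t)\<^sup>2"
    by (rule controlled_path_bounds[OF contr']) (rule that)
  define k where "k = c + c'"
  have k: "0 \<le> k" using c c' by (simp add: k_def)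
  have up: "u \<le> k * r" if "u \<le> c * r \<or> u \<le> c' * r" "0 \<le> r" for u r
    using that c c' mult_right_mono[of c k r] mult_right_mono[of c' k r] by (auto simp: k_def)
  define E where "E = norm (\<xi> a) + c' * B"
  have E: "norm (\<xi> t) \<le> E" if "a \<le> t" "t \<le> b" for t
  proof -
    have "c' * weight \<alpha> a t \<le> c' * B"
      using c' that by (intro mult_left_mono weight_le_B) auto
    then show ?thesis
      using \<xi>[of a t] that norm_triangle_sub[of "\<xi> t" "\<xi> a"] by (simp add: E_def)
  qed
  note bounds = linear_integrand_bounds[OF k, of y \<xi> E]
  define K where "K = (B * k\<^sup>2 * E + B * k * E + B * k + B * k\<^sup>2) + (4 * B * B * k * E + 2 * B * B * k)"
  have "0 \<le> E" using c' B_nonneg by (simp add: E_def)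
  then have K: "0 \<le> K" "B * k\<^sup>2 * E + B * k * E + B * k + B * k\<^sup>2 \<le> K" "4 * B * B * k * E + 2 * B * B * k \<le> K"
    using k B_nonneg by (simp_all add: K_def)
  have 1: "norm (g1 (y m) (\<xi> m) - g1 (y s) (\<xi> s) -
      lin_integrand_deriv g (y s) (\<xi> s) (g1 (y s) (\<xi> s)) (x m - x s)) \<le> K * (weight \<alpha> s m)\<^sup>2"
    if st: "a \<le> s" "s \<le> m" "m \<le> b" for s m
    unfolding DF_eq[symmetric]
  proof (rule order.trans[OF bounds(1)])
    show "(B * k\<^sup>2 * E + B * k * E + B * k + B * k\<^sup>2) * (weight \<alpha> s m)\<^sup>2 \<le> K * (weight \<alpha> s m)\<^sup>2"
      using K by (intro mult_right_mono) auto
  qed (use y Ry \<xi> R\<xi> E st in \<open>auto intro!: up\<close>)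
  have 2: "norm (lin_integrand_deriv g (y m) (\<xi> m) (g1 (y m) (\<xi> m)) -
      lin_integrand_deriv g (y s) (\<xi> s) (g1 (y s) (\<xi> s))) \<le> K * weight \<alpha> s m"
    if st: "a \<le> s" "s \<le> m" "m \<le> b" for s m
    unfolding DF_eq[symmetric]
  proof (rule order.trans[OF bounds(2)])
    show "(4 * B * B * k * E + 2 * B * B * k) * weight \<alpha> s m \<le> K * weight \<alpha> s m"
      using K by (intro mult_right_mono) auto
  qed (use y Ry \<xi> R\<xi> E st in \<open>auto intro!: up\<close>)
  note expansion = integral_imp_expansion[OF exponent integral controlled_germ_defect[OF 1 2 K(1)] diagonal, unfolded linear_germ]
  show thesis
    by (rule that, rule expansion) auto
qed

text \<open>The expansion contains all the information: it bounds \<open>\<xi>\<close>, then its increments to first order and, after removing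
the term with \<open>X\<close>, its remainder to second order, so \<open>\<xi>\<close> is controlled; the integral equation follows by
summing the expansion over partitions.\<close>

lemma expansion_imp_lin_rde_solution:
  assumes sol: "rde_solution \<alpha> g x X a b y0 y"
    and expansion: "\<And>s t. a \<le> s \<Longrightarrow> s \<le> t \<Longrightarrow> t \<le> b \<Longrightarrow>
      norm (\<xi> t - \<xi> s - Dstep s t (y s) (\<xi> s)) \<le> M * weight \<alpha> s t ^ 3"
  shows "lin_rde_solution \<alpha> g x X a b y (\<xi> a) \<xi>"
proof -
  have contr: "controlled_path \<alpha> x {a..b} y (\<lambda>t. g (y t))"
    using sol by (simp add: rde_solution_def)
  obtain c where c: "0 \<le> c"
    and y: "\<And>s t. a \<le> s \<Longrightarrow> s \<le> t \<Longrightarrow> t \<le> b \<Longrightarrow> norm (y t - y s) \<le> c * weight \<alpha> s t"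
    by (rule controlled_path_bounds[OF contr]) (rule that)
  define N where "N = \<bar>M\<bar> * B"
  have "0 \<le> N" using B_nonneg by (simp add: N_def)
  have quadratic: "norm (\<xi> t - \<xi> s - Dstep s t (y s) (\<xi> s)) \<le> N * (weight \<alpha> s t)\<^sup>2"
    if st: "a \<le> s" "s \<le> t" "t \<le> b" for s t
  proof -
    have "M * weight \<alpha> s t ^ 3 \<le> \<bar>M\<bar> * (B * (weight \<alpha> s t)\<^sup>2)"
      unfolding power3_eq_cube power2_eq_square mult.assoc using weight_le_B[OF st] B_nonneg
      by (intro mult_mono mult_nonneg_nonneg) auto
    then show ?thesis
      using expansion[OF st] by (simp add: N_def mult.assoc)
  qed
  define E where "E = norm (\<xi> a) + c_step * B * norm (\<xi> a) + N * B\<^sup>2"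
  have "0 \<le> E" using c_nonneg B_nonneg \<open>0 \<le> N\<close> by (simp add: E_def)
  have E: "norm (\<xi> t) \<le> E" if t: "a \<le> t" "t \<le> b" for t
  proof -
    have "norm (\<xi> t) = norm (\<xi> a + Dstep a t (y a) (\<xi> a) + (\<xi> t - \<xi> a - Dstep a t (y a) (\<xi> a)))"
      by simp
    also have "\<dots> \<le> norm (\<xi> a) + c_step * weight \<alpha> a t * norm (\<xi> a) + N * (weight \<alpha> a t)\<^sup>2"
      using t by (intro norm_triangle_mono Dstep_bound quadratic order.refl) auto
    also have "\<dots> \<le> E"
      unfolding E_def using t weight_le_B[of a t] c_nonneg \<open>0 \<le> N\<close>
      by (intro add_mono mult_right_mono mult_left_mono power_mono) auto
    finally show ?thesis .
  qed
  define c' where "c' = c_step * E + N * B"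
  have \<xi>: "norm (\<xi> t - \<xi> s) \<le> c' * weight \<alpha> s t" if st: "a \<le> s" "s \<le> t" "t \<le> b" for s t
  proof -
    have "norm (\<xi> t - \<xi> s) = norm (Dstep s t (y s) (\<xi> s) + (\<xi> t - \<xi> s - Dstep s t (y s) (\<xi> s)))"
      by simp
    also have "\<dots> \<le> c_step * weight \<alpha> s t * norm (\<xi> s) + N * (weight \<alpha> s t)\<^sup>2"
      by (intro norm_triangle_mono Dstep_bound quadratic st)
    also have "\<dots> \<le> c_step * weight \<alpha> s t * E + N * (B * weight \<alpha> s t)"
      unfolding power2_eq_square using st weight_le_B[OF st] c_nonneg \<open>0 \<le> N\<close>
      by (intro add_mono mult_right_mono mult_left_mono E) auto
    finally show ?thesis by (simp add: c'_def algebra_simps)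
  qed
  have c': "0 \<le> c'" using c_nonneg \<open>0 \<le> N\<close> \<open>0 \<le> E\<close> B_nonneg by (simp add: c'_def)
  define K where "K = c' + (B * c * E + B * c') + (B * (2 * B * B * E) * B + N)"
  have K: "c' \<le> K" "B * c * E + B * c' \<le> K" "B * (2 * B * B * E) * B + N \<le> K"
    using c c' B_nonneg \<open>0 \<le> N\<close> \<open>0 \<le> E\<close> by (simp_all add: K_def)
  have "controlled_path \<alpha> x {a..b} \<xi> (\<lambda>t. g1 (y t) (\<xi> t))"
  proof (rule controlled_pathI[OF exponent_nonneg(1), where C = K])
    fix s t assume st: "a \<le> s" "s \<le> t" "t \<le> b"
    show "norm (\<xi> t - \<xi> s) \<le> K * weight \<alpha> s t"
      using \<xi>[OF st] mult_right_mono[OF K(1) weight_nonneg, of \<alpha> s t] by linarith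
    have "norm (g1 (y t) (\<xi> t) - g1 (y s) (\<xi> s)) = norm ((g1 (y t) - g1 (y s)) (\<xi> t) + g1 (y s) (\<xi> t - \<xi> s))"
      by (simp add: blinfun.diff_left blinfun.diff_right)
    also have "\<dots> \<le> (B * (c * weight \<alpha> s t)) * E + B * (c' * weight \<alpha> s t)"
    proof (intro norm_triangle_mono norm_blinfun_le g1_bound B_nonneg \<xi> st)
      show "norm (g1 (y t) - g1 (y s)) \<le> B * (c * weight \<alpha> s t)"
        using g1_lip[of "y t" "y s"] mult_left_mono[OF y[OF st] B_nonneg] by linarith
      show "norm (\<xi> t) \<le> E" using st by (intro E) auto
    qed (use B_nonneg c in simp)
    also have "\<dots> = (B * c * E + B * c') * weight \<alpha> s t"
      by (simp add: algebra_simps)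
    also have "\<dots> \<le> K * weight \<alpha> s t"
      by (intro mult_right_mono K weight_nonneg)
    finally show "norm (g1 (y t) (\<xi> t) - g1 (y s) (\<xi> s)) \<le> K * weight \<alpha> s t" .
    have "\<xi> t - \<xi> s - g1 (y s) (\<xi> s) (x t - x s) =
        tensor_apply (DF (y s) (\<xi> s)) (X s t) + (\<xi> t - \<xi> s - Dstep s t (y s) (\<xi> s))"
      by (simp add: Dstep_def)
    then have "norm (\<xi> t - \<xi> s - g1 (y s) (\<xi> s) (x t - x s))
        \<le> B * (2 * B * B * E) * (B * (weight \<alpha> s t)\<^sup>2) + N * (weight \<alpha> s t)\<^sup>2"
    proof (simp only:, intro norm_triangle_mono tensor_le X_bound quadratic st)
      have "2 * B * B * norm (\<xi> s) \<le> 2 * B * B * E"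
        using B_nonneg st by (intro mult_left_mono E) auto
      then show "norm (DF (y s) (\<xi> s)) \<le> 2 * B * B * E"
        using DF_bound[of "y s" "\<xi> s"] by linarith
    qed
    also have "\<dots> = (B * (2 * B * B * E) * B + N) * (weight \<alpha> s t)\<^sup>2"
      by (simp add: algebra_simps)
    also have "\<dots> \<le> K * (weight \<alpha> s t)\<^sup>2"
      by (intro mult_right_mono K zero_le_power2)
    finally show "norm (\<xi> t - \<xi> s - g1 (y s) (\<xi> s) (x t - x s)) \<le> K * (weight \<alpha> s t)\<^sup>2" .
  qed (rule x_continuous)
  moreover have "has_rough_integral x X a t (\<lambda>u. fderiv g (y u) (\<xi> u))
      (\<lambda>u. lin_integrand_deriv g (y u) (\<xi> u) (fderiv g (y u) (\<xi> u))) (\<xi> t - \<xi> a)" if "t \<in> {a..b}" for t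
    by (rule expansion_imp_integral[OF exponent, where b = b and K = M]) (use that expansion in \<open>auto simp: linear_germ\<close>)
  ultimately show ?thesis
    by (simp add: lin_rde_solution_def)
qed

end

section \<open>Differentiability with respect to the initial condition\<close>

text \<open>Hoelder bounds with exponent \<open>\<nu>\<close> are Hoelder bounds with the smaller exponent \<open>\<alpha>\<close> on a bounded interval, with
the loss \<open>h = (b - a)\<^sup>\<nu>\<^sup>-\<^sup>\<alpha>\<close>. The bound on the third derivative of \<open>g\<close> becomes the Lipschitz bound on the second.\<close>

lemma rough_equation_of_C3b:
  fixes g :: "real ^ 'd \<Rightarrow> ((real ^ 'm) \<Rightarrow>\<^sub>L (real ^ 'd))"
  assumes \<alpha>: "1/3 < \<alpha>" "\<alpha> < \<nu>" and "a \<le> b" and "C3b g" and rough: "rough_path \<nu> {a..b} x X"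
  obtains B where "rough_equation \<alpha> a b B g x X"
proof -
  have g: "(g has_derivative fderiv g z) (at z)" "(fderiv g has_derivative fderiv (fderiv g) z) (at z)"
    "(fderiv (fderiv g) has_derivative fderiv (fderiv (fderiv g)) z) (at z)" for z
    using \<open>C3b g\<close> by (auto simp: C3b_def fderiv_works[symmetric] differentiable_on_def)
  obtain B0 B1 B2 B3 where B0: "\<And>z. norm (g z) \<le> B0" and B1: "\<And>z. norm (fderiv g z) \<le> B1"
    and B2: "\<And>z. norm (fderiv (fderiv g) z) \<le> B2" and B3: "\<And>z. norm (fderiv (fderiv (fderiv g)) z) \<le> B3"
    using \<open>C3b g\<close> by (auto simp: C3b_def bounded_iff)
  have "0 \<le> B3" using B3[of 0] norm_ge_zero order.trans by blast
  have lip: "norm (fderiv (fderiv g) z - fderiv (fderiv g) w) \<le> B3 * norm (z - w)" for z w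
    by (rule mean_value_bound[OF g(3)]) (auto intro!: norm_blinfun_le B3 \<open>0 \<le> B3\<close>)
  obtain K where K: "0 < K" and tensor: "\<And>(A :: (real ^ 'm) \<Rightarrow>\<^sub>L ((real ^ 'm) \<Rightarrow>\<^sub>L (real ^ 'd))) M.
      norm (tensor_apply A M) \<le> norm A * norm M * K"
    using bounded_bilinear.pos_bounded[OF bounded_bilinear_tensor_apply] by blast
  obtain Cx where Cx: "\<And>s t. a \<le> s \<Longrightarrow> s \<le> t \<Longrightarrow> t \<le> b \<Longrightarrow> norm (x t - x s) \<le> Cx * weight \<nu> s t"
    using rough unfolding rough_path_def hoelder_path_iff by blast
  have chen: "X s t - X s u - X u t = tensor (x u - x s) (x t - x u)"
    if "a \<le> s" "s \<le> u" "u \<le> t" "t \<le> b" for s u t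
    using rough that by (auto simp: rough_path_def)
  obtain CX where CX: "\<forall>s\<in>{a..b}. \<forall>t\<in>{a..b}. s < t \<longrightarrow> norm (X s t) \<le> CX * \<bar>t - s\<bar> powr (2 * \<nu>)"
    using rough unfolding rough_path_def hoelder2_def by blast
  have X: "norm (X s t) \<le> CX * (weight \<nu> s t)\<^sup>2" if "a \<le> s" "s \<le> t" "t \<le> b" for s t
  proof (cases "s = t")
    case True
    have "tensor (0 :: real ^ 'm) 0 = 0"
      by (simp add: tensor_def vec_eq_iff)
    then show ?thesis
      using chen[of s s s] that True by simp
  next
    case False
    then show ?thesis
      using CX[rule_format, of s t] that by (simp add: weight_square)
  qed
  define h where "h = weight (\<nu> - \<alpha>) a b"
  have h: "weight \<nu> s t \<le> h * weight \<alpha> s t" if "a \<le> s" "s \<le> t" "t \<le> b" for s t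
  proof -
    have "weight \<nu> s t = weight (\<nu> - \<alpha>) s t * weight \<alpha> s t"
      by (simp add: weight_def powr_add[symmetric])
    also have "\<dots> \<le> h * weight \<alpha> s t"
      unfolding h_def using \<alpha> that by (intro mult_right_mono weight_mono) auto
    finally show ?thesis .
  qed
  have "0 \<le> h" by (simp add: h_def)
  define B where "B = 1 + \<bar>B0\<bar> + \<bar>B1\<bar> + \<bar>B2\<bar> + B3 + K + \<bar>Cx\<bar> * h + \<bar>CX\<bar> * h\<^sup>2 + weight \<alpha> a b"
  have nonneg: "0 \<le> \<bar>Cx\<bar> * h" "0 \<le> \<bar>CX\<bar> * h\<^sup>2" "0 \<le> weight \<alpha> a b"
    using \<open>0 \<le> h\<close> by simp_all
  have B: "1 \<le> B" "B0 \<le> B" "B1 \<le> B" "B2 \<le> B" "B3 \<le> B" "K \<le> B" "\<bar>Cx\<bar> * h \<le> B" "\<bar>CX\<bar> * h\<^sup>2 \<le> B" "weight \<alpha> a b \<le> B"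
    using K nonneg \<open>0 \<le> B3\<close> unfolding B_def by linarith+
  have "rough_equation \<alpha> a b B g x X"
  proof
    show "norm (g z) \<le> B" "norm (fderiv g z) \<le> B" "norm (fderiv (fderiv g) z) \<le> B" for z
      using B0[of z] B1[of z] B2[of z] B by linarith+
    show "norm (fderiv (fderiv g) z - fderiv (fderiv g) w) \<le> B * norm (z - w)" for z w
      using lip[of z w] mult_right_mono[OF B(5), of "norm (z - w)"] by simp
    show "norm (tensor_apply A M) \<le> B * norm A * norm M"
      for A :: "(real ^ 'm) \<Rightarrow>\<^sub>L ((real ^ 'm) \<Rightarrow>\<^sub>L (real ^ 'd))" and M
      using tensor[of A M] mult_right_mono[OF B(6), of "norm A * norm M"] by (simp add: mult_ac)
    fix s t assume st: "a \<le> s" "s \<le> t" "t \<le> b"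
    have "norm (x t - x s) \<le> \<bar>Cx\<bar> * weight \<nu> s t"
      using Cx[OF st] mult_right_mono[OF abs_ge_self[of Cx] weight_nonneg[of \<nu> s t]] by linarith
    also have "\<dots> \<le> \<bar>Cx\<bar> * (h * weight \<alpha> s t)"
      by (intro mult_left_mono h st) auto
    also have "\<dots> \<le> B * weight \<alpha> s t"
      unfolding mult.assoc[symmetric] by (intro mult_right_mono B weight_nonneg)
    finally show "norm (x t - x s) \<le> B * weight \<alpha> s t" .
    have "norm (X s t) \<le> \<bar>CX\<bar> * (weight \<nu> s t)\<^sup>2"
      using X[OF st] mult_right_mono[OF abs_ge_self[of CX] zero_le_power2[of "weight \<nu> s t"]] by linarith
    also have "\<dots> \<le> \<bar>CX\<bar> * (h * weight \<alpha> s t)\<^sup>2"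
      by (intro mult_left_mono power_mono h st) auto
    also have "\<dots> = (\<bar>CX\<bar> * h\<^sup>2) * (weight \<alpha> s t)\<^sup>2"
      by (simp add: power_mult_distrib)
    also have "\<dots> \<le> B * (weight \<alpha> s t)\<^sup>2"
      by (intro mult_right_mono B zero_le_power2)
    finally show "norm (X s t) \<le> B * (weight \<alpha> s t)\<^sup>2" .
  qed (use \<alpha> B g chen in auto)
  then show thesis by (rule that)
qed

lemma column_matrix: "column j (matrix f) = f (axis j 1)"
  by (simp add: column_def matrix_def vec_eq_iff)

text \<open>The columns of the Jacobian are the directional derivatives along the standard basis vectors, so the matrix equation
reduces to vector equations for the images of these vectors under the derivative.\<close>

theorem theorem3p4:
  fixes \<alpha> \<nu> a b :: real
    and g :: "real ^ 'd \<Rightarrow> ((real ^ 'm) \<Rightarrow>\<^sub>L (real ^ 'd))"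
    and x :: "real \<Rightarrow> real ^ 'm"
    and X :: "real \<Rightarrow> real \<Rightarrow> real ^ 'm ^ 'm"
    and y :: "real ^ 'd \<Rightarrow> real \<Rightarrow> real ^ 'd"
    and ya :: "real ^ 'd"
  assumes "1/3 < \<alpha>" and "\<alpha> < \<nu>" and "\<nu> < 1/2"
    and "a \<le> b"
    and "C3b g"
    and "rough_path \<nu> {a..b} x X"
    and "\<And>z. rde_solution \<alpha> g x X a b z (y z)"
  shows "(\<forall>t\<in>{a..b}. (\<lambda>z. y z t) differentiable (at ya)) \<and>
    matrix_lin_rde_solution \<alpha> g x X a b (y ya) (\<lambda>t. jacobian (\<lambda>z. y z t) (at ya)) \<and>
    (\<forall>\<Xi>. matrix_lin_rde_solution \<alpha> g x X a b (y ya) \<Xi> \<longrightarrow>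
       (\<forall>t\<in>{a..b}. \<Xi> t = jacobian (\<lambda>z. y z t) (at ya)))"
proof -
  obtain B where "rough_equation \<alpha> a b B g x X"
    using rough_equation_of_C3b[OF assms(1,2,4-6)] .
  then interpret rough_equation \<alpha> a b B g x X .
  have sol: "rde_solution \<alpha> g x X a b z (y z)" for z
    by (rule assms(7))
  have fl: "flow_line (y z)" for z
    by (rule rde_solution_flow_line[OF sol])
  have init: "y z a = z" for z
    using sol[of z] by (simp add: rde_solution_def)
  define D where "D t = frechet_derivative (\<lambda>z. y z t) (at ya)" for t
  have diff: "(\<lambda>z. y z t) differentiable (at ya)" if "a \<le> t" "t \<le> b" for t
    using fl init that by (rule flow_differentiable)
  then have deriv: "((\<lambda>z. y z t) has_derivative D t) (at ya)" if "a \<le> t" "t \<le> b" for t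
    using that by (simp add: D_def frechet_derivative_works[symmetric])
  have D_a: "D a = (\<lambda>v. v)"
    by (simp add: D_def init)
  have columns: "column j (jacobian (\<lambda>z. y z t) (at ya)) = D t (axis j 1)" for j t
    by (simp add: jacobian_def column_matrix D_def)
  have solves: "lin_rde_solution \<alpha> g x X a b (y ya) (axis j 1) (\<lambda>t. D t (axis j 1))" for j
  proof -
    obtain M where M: "\<And>s t. a \<le> s \<Longrightarrow> s \<le> t \<Longrightarrow> t \<le> b \<Longrightarrow>
        norm (D t (axis j 1) - D s (axis j 1) - Dstep s t (y ya s) (D s (axis j 1))) \<le> M * weight \<alpha> s t ^ 3"
      using derivative_solves_linearized[of y D ya "axis j 1", OF fl init deriv] by blast
    show ?thesis
      using expansion_imp_lin_rde_solution[OF sol M] by (simp add: D_a)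
  qed
  have unique: "\<Xi> t = jacobian (\<lambda>z. y z t) (at ya)"
    if \<Xi>: "matrix_lin_rde_solution \<alpha> g x X a b (y ya) \<Xi>" and t: "a \<le> t" "t \<le> b" for \<Xi> t
  proof -
    have "column j (\<Xi> t) = D t (axis j 1)" for j
    proof -
      have lin: "lin_rde_solution \<alpha> g x X a b (y ya) (axis j 1) (\<lambda>t. column j (\<Xi> t))"
        using \<Xi> by (simp add: matrix_lin_rde_solution_def)
      obtain M where M: "\<And>s t. a \<le> s \<Longrightarrow> s \<le> t \<Longrightarrow> t \<le> b \<Longrightarrow>
          norm (column j (\<Xi> t) - column j (\<Xi> s) - Dstep s t (y ya s) (column j (\<Xi> s))) \<le> M * weight \<alpha> s t ^ 3"
        using lin_rde_solution_imp_expansion[OF sol lin] by blast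
      obtain N where N: "\<And>s t. a \<le> s \<Longrightarrow> s \<le> t \<Longrightarrow> t \<le> b \<Longrightarrow>
          norm (D t (axis j 1) - D s (axis j 1) - Dstep s t (y ya s) (D s (axis j 1))) \<le> N * weight \<alpha> s t ^ 3"
        using lin_rde_solution_imp_expansion[OF sol solves] by blast
      show ?thesis
        by (rule linearized_unique[of "y ya" "\<lambda>t. column j (\<Xi> t)" M "\<lambda>t. D t (axis j 1)" N])
          (use fl M N t lin in \<open>auto simp: D_a lin_rde_solution_def\<close>)
    qed
    then have "column j (\<Xi> t) = column j (jacobian (\<lambda>z. y z t) (at ya))" for j
      by (simp add: columns)
    then show ?thesis
      by (simp add: column_def vec_eq_iff)
  qed
  show ?thesis
    using diff solves unique by (simp add: matrix_lin_rde_solution_def columns)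
qed

end
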